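(* Let $Y=\mathbb{P}^{n_1}\times\dots\times\mathbb{P}^{n_k}$ and let $E\sqcup F=\{1,\dots,k\}$ be a partition with $\sharp F=h$, $0<h<k$. Let $M_F:=\prod_{i\in F}(n_i+1)$ and fix an integer $0<c<M_F$. Let $A\subset Y$ be a zero-dimensional scheme of degree $\deg(A)=c+1$ (respectively, a finite set with $\sharp A=c+1$). Assume that $h^1(\mathcal{I}_A(E))=0$ and $h^1(\mathcal{I}_A(F))=0$. Then any $T\in\langle\nu(A)\rangle$ such that $T\notin\langle\nu(A')\rangle$ for any $A'\subsetneq A$ has cactus rank (respectively, cactus rank and rank) equal to $c+1$.
   Context: The base field is $\mathbb{C}$. $\nu:Y\to\mathbb{P}^M$, $M=-1+\prod_{i=1}^k(n_i+1)$, is the Segre embedding and $X=\nu(Y)$. $\langle Z\rangle$ denotes the linear span of a subscheme $Z$ of a projective space. $\deg$ of a zero-dimensional scheme is its length. For $\mathbf{u}\subset\{1,\dots,k\}$, $\mathcal{O}(\mathbf{u})$ is the line bundle on $Y$ of multidegree $1$ on the factors with index in $\mathbf{u}$ and $0$ on the others; for a subscheme $Z\subset Y$ with ideal sheaf $\mathcal{I}_Z$, $\mathcal{I}_Z(\mathbf{u})=\mathcal{I}_Z\otimes\mathcal{O}(\mathbf{u})$ and $h^i(\mathcal{I}_Z(\mathbf{u}))=\dim H^i(Y,\mathcal{I}_Z(\mathbf{u}))$. For $T\in\mathbb{P}^M$: the rank of $T$ is the minimal cardinality of a finite reduced set $S\subset Y$ with $T\in\langle\nu(S)\rangle$; the cactus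 rank of $T$ is the minimal degree of a zero-dimensional subscheme $\Gamma\subset X$ with $T\in\langle\Gamma\rangle$. *)

theory Defs
  imports
    Complex_Main
    "HOL-Library.FuncSet"
    "HOL-Library.Extended_Nat"
    "HOL-Library.Function_Algebras"
    "HOL-Library.Poly_Mapping"
begin

section \<open>Dimensions of quotient spaces\<close>

text \<open>
  The dimension of \<open>W / U\<close>, for subspaces \<open>U \<subseteq> W\<close> of a complex vector space with scalar
  multiplication \<open>sc\<close>: the least number of elements of \<open>W\<close> which together with \<open>U\<close> span \<open>W\<close>,
  and \<open>\<infinity>\<close> if no finite number suffices.
\<close>

definition quot_dim :: "(complex \<Rightarrow> 'b \<Rightarrow> 'b::ab_group_add) \<Rightarrow> 'b set \<Rightarrow> 'b set \<Rightarrow> enat"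
  where "quot_dim sc W U =
    Inf {enat (card B) | B. finite B \<and> B \<subseteq> W \<and> W \<subseteq> module.span sc (U \<union> B)}"


section \<open>The Cox ring of a product of projective spaces\<close>

text \<open>
  A product of projective spaces is given by a finite set \<open>K\<close> of factors and, for each factor
  \<open>i \<in> K\<close>, a finite non-empty set \<open>V i\<close> labelling its homogeneous coordinates; the coordinates of
  the product are thus indexed by \<open>Sigma K V\<close>, and the dimension of factor \<open>i\<close> is
  \<open>card (V i) - 1\<close>.  A single projective space is the case \<open>K = {()}\<close>.

  All rings occurring below (the multihomogeneous coordinate ring and its localizations at
  products of coordinates) are subrings of one ring of Laurent polynomials.
\<close>

type_synonym ('i, 'v) expo = "('i \<times> 'v) \<Rightarrow>\<^sub>0 int"
type_synonym ('i, 'v) laurent = "(('i \<times> 'v) \<Rightarrow>\<^sub>0 int) \<Rightarrow>\<^sub>0 complex"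

definition lscale :: "complex \<Rightarrow> ('i, 'v) laurent \<Rightarrow> ('i, 'v) laurent"
  where "lscale a p = Poly_Mapping.single 0 a * p"

definition fscale :: "complex \<Rightarrow> ('j \<Rightarrow> ('i, 'v) laurent) \<Rightarrow> ('j \<Rightarrow> ('i, 'v) laurent)"
  where "fscale a s = (\<lambda>J. lscale a (s J))"

definition coord :: "'i \<times> 'v \<Rightarrow> ('i, 'v) laurent"
  where "coord x = Poly_Mapping.single (Poly_Mapping.single x 1) 1"

definition cox_ring :: "'i set \<Rightarrow> ('i \<Rightarrow> 'v set) \<Rightarrow> ('i, 'v) laurent set"
  where "cox_ring K V =
    {p. \<forall>m \<in> Poly_Mapping.keys p. Poly_Mapping.keys m \<subseteq> Sigma K V \<and>
          (\<forall>x. 0 \<le> Poly_Mapping.lookup m x)}"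

definition multideg :: "('i, 'v) expo \<Rightarrow> 'i \<Rightarrow> int"
  where "multideg m i =
    (\<Sum>x \<in> Poly_Mapping.keys m. if fst x = i then Poly_Mapping.lookup m x else 0)"

definition homog :: "('i \<Rightarrow> int) \<Rightarrow> ('i, 'v) laurent set"
  where "homog d = {p. \<forall>m \<in> Poly_Mapping.keys p. multideg m = d}"

definition component :: "('i \<Rightarrow> int) \<Rightarrow> ('i, 'v) laurent \<Rightarrow> ('i, 'v) laurent"
  where "component d p =
    (\<Sum>m \<in> {m \<in> Poly_Mapping.keys p. multideg m = d}.
        Poly_Mapping.single m (Poly_Mapping.lookup p m))"

text \<open>The multidegree of the line bundle \<open>\<O>(u)\<close>.\<close>

definition deg_of :: "'i set \<Rightarrow> 'i \<Rightarrow> int"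
  where "deg_of u = (\<lambda>i. if i \<in> u then 1 else 0)"


section \<open>Standard charts and closed subschemes\<close>

text \<open>
  A standard affine chart \<open>U\<^sub>J\<close> is given by a choice \<open>J\<close> of one coordinate in each factor; it is
  the open set where the coordinates in \<open>chart_vars K J\<close> do not vanish, and \<open>U\<^sub>J \<inter> U\<^sub>J'\<close>
  is the open set where those in \<open>chart_vars K J \<union> chart_vars K J'\<close> do not vanish.
\<close>

definition charts :: "'i set \<Rightarrow> ('i \<Rightarrow> 'v set) \<Rightarrow> ('i \<Rightarrow> 'v) set"
  where "charts K V = PiE K V"

definition chart_vars :: "'i set \<Rightarrow> ('i \<Rightarrow> 'v) \<Rightarrow> ('i \<times> 'v) set"
  where "chart_vars K J = (\<lambda>i. (i, J i)) ` K"

definition localize :: "('i, 'v) laurent set \<Rightarrow> ('i \<times> 'v) set \<Rightarrow> ('i, 'v) laurent set"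
  where "localize I W = {q. \<exists>N::nat. (\<Prod>x \<in> W. coord x) ^ N * q \<in> I}"

text \<open>
  Closed subschemes are represented by their multihomogeneous ideals in the Cox ring, saturated
  with respect to the irrelevant ideal (which is generated by the products of \<open>chart_vars K J\<close>,
  \<open>J\<close> a chart).  This is a bijection between closed subschemes and such ideals, reversing
  inclusions; the whole space is \<open>{0}\<close> and the empty scheme is \<open>cox_ring K V\<close>.
\<close>

definition closed_subscheme :: "'i set \<Rightarrow> ('i \<Rightarrow> 'v set) \<Rightarrow> ('i, 'v) laurent set \<Rightarrow> bool"
  where "closed_subscheme K V I \<longleftrightarrow>
    I \<subseteq> cox_ring K V \<and> 0 \<in> I \<and>
    (\<forall>p \<in> I. \<forall>q \<in> I. p + q \<in> I) \<and>
    (\<forall>s \<in> cox_ring K V. \<forall>p \<in> I. s * p \<in> I) \<and>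
    (\<forall>p \<in> I. \<forall>d. component d p \<in> I) \<and>
    (\<forall>p \<in> cox_ring K V. (\<forall>J \<in> charts K V. p \<in> localize I (chart_vars K J)) \<longrightarrow> p \<in> I)"

text \<open>
  The sections of \<open>\<I>\<^sub>Z(d)\<close> over the open set where the coordinates in \<open>W\<close> do not vanish.
  For \<open>I = cox_ring K V\<close> these are the sections of \<open>\<O>(d)\<close>.
\<close>

definition sections :: "('i, 'v) laurent set \<Rightarrow> ('i \<Rightarrow> int) \<Rightarrow> ('i \<times> 'v) set \<Rightarrow> ('i, 'v) laurent set"
  where "sections I d W = localize I W \<inter> homog d"

text \<open>
  A scheme of finite type over \<open>\<complex>\<close> has dimension at most zero iff the coordinate rings of its
  affine charts are finite-dimensional vector spaces.  The empty scheme is allowed here; it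
  has degree 0.
\<close>

definition zero_dimensional :: "'i set \<Rightarrow> ('i \<Rightarrow> 'v set) \<Rightarrow> ('i, 'v) laurent set \<Rightarrow> bool"
  where "zero_dimensional K V I \<longleftrightarrow> closed_subscheme K V I \<and>
    (\<forall>J \<in> charts K V.
      quot_dim lscale (sections (cox_ring K V) 0 (chart_vars K J)) (sections I 0 (chart_vars K J))
        < \<infinity>)"


section \<open>Cohomology\<close>

text \<open>
  Cech cohomology for the standard affine cover.  Cochains are not required to be alternating,
  and they vanish outside their index set.
\<close>

definition cech_C0 ::
    "'i set \<Rightarrow> ('i \<Rightarrow> 'v set) \<Rightarrow> ('i, 'v) laurent set \<Rightarrow> ('i \<Rightarrow> int) \<Rightarrow>
      (('i \<Rightarrow> 'v) \<Rightarrow> ('i, 'v) laurent) set"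
  where "cech_C0 K V I d =
    {s. (\<forall>J \<in> charts K V. s J \<in> sections I d (chart_vars K J)) \<and>
        (\<forall>J. J \<notin> charts K V \<longrightarrow> s J = 0)}"

definition cech_C1 ::
    "'i set \<Rightarrow> ('i \<Rightarrow> 'v set) \<Rightarrow> ('i, 'v) laurent set \<Rightarrow> ('i \<Rightarrow> int) \<Rightarrow>
      (('i \<Rightarrow> 'v) \<times> ('i \<Rightarrow> 'v) \<Rightarrow> ('i, 'v) laurent) set"
  where "cech_C1 K V I d =
    {s. (\<forall>J \<in> charts K V. \<forall>J' \<in> charts K V.
          s (J, J') \<in> sections I d (chart_vars K J \<union> chart_vars K J')) \<and>
        (\<forall>P. P \<notin> charts K V \<times> charts K V \<longrightarrow> s P = 0)}"

definition cech_d0 ::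
    "'i set \<Rightarrow> ('i \<Rightarrow> 'v set) \<Rightarrow> (('i \<Rightarrow> 'v) \<Rightarrow> ('i, 'v) laurent) \<Rightarrow>
      (('i \<Rightarrow> 'v) \<times> ('i \<Rightarrow> 'v) \<Rightarrow> ('i, 'v) laurent)"
  where "cech_d0 K V t =
    (\<lambda>(J, J'). if J \<in> charts K V \<and> J' \<in> charts K V then t J' - t J else 0)"

text \<open>
  The restriction maps to triple intersections are inclusions inside the Laurent polynomial
  ring, so the cocycle condition can be stated there.
\<close>

definition cech_Z1 ::
    "'i set \<Rightarrow> ('i \<Rightarrow> 'v set) \<Rightarrow> ('i, 'v) laurent set \<Rightarrow> ('i \<Rightarrow> int) \<Rightarrow>
      (('i \<Rightarrow> 'v) \<times> ('i \<Rightarrow> 'v) \<Rightarrow> ('i, 'v) laurent) set"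
  where "cech_Z1 K V I d =
    {s \<in> cech_C1 K V I d.
      \<forall>J \<in> charts K V. \<forall>J' \<in> charts K V. \<forall>J'' \<in> charts K V.
        s (J', J'') - s (J, J'') + s (J, J') = 0}"

definition h1 :: "'i set \<Rightarrow> ('i \<Rightarrow> 'v set) \<Rightarrow> ('i, 'v) laurent set \<Rightarrow> ('i \<Rightarrow> int) \<Rightarrow> enat"
  where "h1 K V I d = quot_dim fscale (cech_Z1 K V I d) (cech_d0 K V ` cech_C0 K V I d)"

text \<open>
  The length of a zero-dimensional scheme \<open>Z\<close> is the dimension of \<open>H\<^sup>0(Z, \<O>\<^sub>Z)\<close>.  Here
  \<open>\<O>\<^sub>Z = \<O>/\<I>\<^sub>Z\<close>, so that an element of \<open>H\<^sup>0\<close> is given by regular functions on the charts whose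
  differences on the overlaps lie in \<open>\<I>\<^sub>Z\<close>, modulo functions lying in \<open>\<I>\<^sub>Z\<close>.
\<close>

definition degree :: "'i set \<Rightarrow> ('i \<Rightarrow> 'v set) \<Rightarrow> ('i, 'v) laurent set \<Rightarrow> enat"
  where "degree K V I =
    quot_dim fscale
      {s \<in> cech_C0 K V (cox_ring K V) 0. cech_d0 K V s \<in> cech_C1 K V I 0}
      (cech_C0 K V I 0)"


section \<open>Points and finite sets of points\<close>

definition coord_vectors :: "'i set \<Rightarrow> ('i \<Rightarrow> 'v set) \<Rightarrow> ('i \<times> 'v \<Rightarrow> complex) set"
  where "coord_vectors K V =
    {x. (\<forall>y. y \<notin> Sigma K V \<longrightarrow> x y = 0) \<and> (\<forall>i \<in> K. \<exists>v \<in> V i. x (i, v) \<noteq> 0)}"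

definition proportional ::
    "'i set \<Rightarrow> ('i \<Rightarrow> 'v set) \<Rightarrow> (('i \<times> 'v \<Rightarrow> complex) \<times> ('i \<times> 'v \<Rightarrow> complex)) set"
  where "proportional K V =
    {(x, y). x \<in> coord_vectors K V \<and> y \<in> coord_vectors K V \<and>
       (\<exists>a. \<forall>i \<in> K. a i \<noteq> 0 \<and> (\<forall>v. y (i, v) = a i * x (i, v)))}"

definition points :: "'i set \<Rightarrow> ('i \<Rightarrow> 'v set) \<Rightarrow> ('i \<times> 'v \<Rightarrow> complex) set set"
  where "points K V = coord_vectors K V // proportional K V"

definition evaluate :: "('i, 'v) laurent \<Rightarrow> ('i \<times> 'v \<Rightarrow> complex) \<Rightarrow> complex"
  where "evaluate p x =
    (\<Sum>m \<in> Poly_Mapping.keys p.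
        Poly_Mapping.lookup p m * (\<Prod>y \<in> Poly_Mapping.keys m. x y powi Poly_Mapping.lookup m y))"

text \<open>
  The ideal of a finite set of points with its reduced structure.  Vanishing at all coordinate
  vectors of a point forces all multihomogeneous components to vanish there.
\<close>

definition points_ideal ::
    "'i set \<Rightarrow> ('i \<Rightarrow> 'v set) \<Rightarrow> ('i \<times> 'v \<Rightarrow> complex) set set \<Rightarrow> ('i, 'v) laurent set"
  where "points_ideal K V S = {p \<in> cox_ring K V. \<forall>P \<in> S. \<forall>x \<in> P. evaluate p x = 0}"


section \<open>The Segre embedding, linear spans and ranks\<close>

text \<open>
  The homogeneous coordinates of the target of the Segre embedding are indexed by the choices
  of one coordinate in each factor, so the target is the projective space given by
  \<open>K = {()}\<close> and \<open>V = tensor_vars K V\<close>.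
\<close>

definition tensor_vars :: "'i set \<Rightarrow> ('i \<Rightarrow> 'v set) \<Rightarrow> unit \<Rightarrow> ('i \<Rightarrow> 'v) set"
  where "tensor_vars K V = (\<lambda>_. charts K V)"

abbreviation segre_target :: "'i set \<Rightarrow> ('i \<Rightarrow> 'v set) \<Rightarrow> (unit \<times> ('i \<Rightarrow> 'v) \<Rightarrow> complex) set set"
  where "segre_target K V \<equiv> points {()} (tensor_vars K V)"

text \<open>
  Pullback of polynomials along the Segre embedding: the ring homomorphism sending the
  coordinate \<open>z\<^sub>J\<close> to the product of the coordinates \<open>(i, J i)\<close>, \<open>i \<in> K\<close>.
\<close>

definition segre_expo :: "'i set \<Rightarrow> (unit, 'i \<Rightarrow> 'v) expo \<Rightarrow> ('i, 'v) expo"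
  where "segre_expo K m =
    (\<Sum>x \<in> Poly_Mapping.keys m. \<Sum>i \<in> K.
        Poly_Mapping.single (i, snd x i) (Poly_Mapping.lookup m x))"

definition segre_pullback :: "'i set \<Rightarrow> (unit, 'i \<Rightarrow> 'v) laurent \<Rightarrow> ('i, 'v) laurent"
  where "segre_pullback K p =
    (\<Sum>m \<in> Poly_Mapping.keys p.
        Poly_Mapping.single (segre_expo K m) (Poly_Mapping.lookup p m))"

text \<open>
  The image \<open>\<nu>(Z)\<close> of a closed subscheme \<open>Z\<close>: its ideal consists of the polynomials whose pullback
  vanishes on \<open>Z\<close>.  In particular \<open>segre_image K V {0}\<close> is the ideal of the Segre variety \<open>X\<close>.
\<close>

definition segre_image ::
    "'i set \<Rightarrow> ('i \<Rightarrow> 'v set) \<Rightarrow> ('i, 'v) laurent set \<Rightarrow> (unit, 'i \<Rightarrow> 'v) laurent set"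
  where "segre_image K V I = {p \<in> cox_ring {()} (tensor_vars K V). segre_pullback K p \<in> I}"

text \<open>
  The linear span of a closed subscheme of a projective space (one factor): the intersection of
  the hyperplanes containing the subscheme.
\<close>

definition linear_span ::
    "(unit \<Rightarrow> 'w set) \<Rightarrow> (unit, 'w) laurent set \<Rightarrow> (unit \<times> 'w \<Rightarrow> complex) set set"
  where "linear_span V I =
    {P \<in> points {()} V. \<forall>l \<in> I \<inter> homog (\<lambda>_. 1). \<forall>t \<in> P. evaluate l t = 0}"

definition segre_span ::
    "'i set \<Rightarrow> ('i \<Rightarrow> 'v set) \<Rightarrow> ('i, 'v) laurent set \<Rightarrow> (unit \<times> ('i \<Rightarrow> 'v) \<Rightarrow> complex) set set"
  where "segre_span K V I = linear_span (tensor_vars K V) (segre_image K V I)"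

definition tensor_rank ::
    "'i set \<Rightarrow> ('i \<Rightarrow> 'v set) \<Rightarrow> (unit \<times> ('i \<Rightarrow> 'v) \<Rightarrow> complex) set \<Rightarrow> nat"
  where "tensor_rank K V T =
    (LEAST r. \<exists>S. finite S \<and> S \<subseteq> points K V \<and> card S = r \<and>
       T \<in> segre_span K V (points_ideal K V S))"

definition cactus_rank ::
    "'i set \<Rightarrow> ('i \<Rightarrow> 'v set) \<Rightarrow> (unit \<times> ('i \<Rightarrow> 'v) \<Rightarrow> complex) set \<Rightarrow> nat"
  where "cactus_rank K V T =
    (LEAST r. \<exists>G. zero_dimensional {()} (tensor_vars K V) G \<and>
       segre_image K V {0} \<subseteq> G \<and>
       degree {()} (tensor_vars K V) G = enat r \<and>
       T \<in> linear_span (tensor_vars K V) G)"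

text \<open>
  The points in the span of \<open>\<nu>(A)\<close> which do not lie in the span of \<open>\<nu>(A')\<close> for any proper closed
  subscheme \<open>A'\<close> of \<open>A\<close>.  Passing to ideals reverses the inclusion.
\<close>

definition minimally_spanned ::
    "'i set \<Rightarrow> ('i \<Rightarrow> 'v set) \<Rightarrow> ('i, 'v) laurent set \<Rightarrow> (unit \<times> ('i \<Rightarrow> 'v) \<Rightarrow> complex) set \<Rightarrow> bool"
  where "minimally_spanned K V I T \<longleftrightarrow>
    T \<in> segre_span K V I \<and>
    (\<forall>I'. closed_subscheme K V I' \<and> I \<subset> I' \<longrightarrow> T \<notin> segre_span K V I')"

end

theory Submission
  imports "HOL-Computational_Algebra.Fundamental_Theorem_Algebra" Defs
begin

text \<open>
  For \<open>T\<close> in the linear span of \<open>\<nu>(Z)\<close>, the bilinear form \<open>(f, g) \<mapsto> T(f g)\<close> on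
  \<open>H\<^sup>0(\<O>(E)) \<times> H\<^sup>0(\<O>(F))\<close> factors through the functions on \<open>Z\<close>, so its rank (the flattening rank
  of \<open>T\<close>) is at most the degree of \<open>Z\<close>.  The hypotheses on \<open>h\<^sup>1\<close> say that \<open>H\<^sup>0(\<O>(E))\<close> and
  \<open>H\<^sup>0(\<O>(F))\<close> map onto the functions on \<open>A\<close>; the kernel of the form is then an ideal of functions
  on \<open>A\<close> killed by \<open>T\<close>, hence zero by minimality, and the flattening rank equals the degree of \<open>A\<close>.

  The line bundles are trivialized along a zero-dimensional scheme by products of linear forms
  vanishing at none of its points.  These are found on a rational curve in the space of forms, where
  distinct monomials have distinct powers of a parameter \<open>t\<close> as coefficients.
\<close>

section \<open>Linear independence modulo a subspace\<close>

text \<open>The delicate point is that the kernel lies in the ideal \<open>I\<close> of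
  \<open>A\<close>. For a form f of degree E in the kernel, \<open>T\<close> should lie in the span
  of the part of \<open>A\<close> where f vanishes. But subschemes are saturated ideals, so a linear
  form p vanishing there only satisfies L^M * p = i + f * s with i in \<open>I\<close>, a power of a
  generic L, and s of too large multidegree. Here h^1(I_A(F)) = 0 enters: forms of degree F already
  give all functions on \<open>A\<close>, so s is L^M * g modulo \<open>I\<close> with g of degree
  F, and cancelling L^M leaves p = f * g modulo \<open>I\<close>, which \<open>T\<close> kills. A
  competitor for the cactus rank is a scheme in the target, described there by its own ideal; the 2
  x 2 minors in that ideal tie it to products f * g. For this a generic linear form on the target
  must pull back to a form of degree E times one of degree F, which is why coefficients come from a
  curve compatible with all factors. Dimensions are those of quotients, possibly infinite; they are
  compared through maps injective or surjective modulo subspaces.\<close>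

lemma enat_le_iff_all_nat: "(a::enat) \<le> b \<longleftrightarrow> (\<forall>n. enat n \<le> a \<longrightarrow> enat n \<le> b)"
proof (intro iffI allI impI)
  assume *: "\<forall>n. enat n \<le> a \<longrightarrow> enat n \<le> b"
  show "a \<le> b"
  proof (cases b)
    case (enat m)
    have "\<not> enat (Suc m) \<le> a"
      using * by (auto simp: enat)
    then show ?thesis
      by (cases a) (auto simp: enat)
  qed simp
qed (auto intro: order.trans)

lemma quot_dim_le_card:
  assumes "finite B" "B \<subseteq> W" "W \<subseteq> module.span sc (U \<union> B)"
  shows "quot_dim sc W U \<le> enat (card B)"
  unfolding quot_dim_def by (rule Inf_lower) (use assms in blast)

lemma quot_dim_eqE:
  assumes "quot_dim sc W U = enat n"
  obtains B where "finite B" "B \<subseteq> W" "W \<subseteq> module.span sc (U \<union> B)" "card B = n"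
proof -
  let ?D = "{enat (card B) | B. finite B \<and> B \<subseteq> W \<and> W \<subseteq> module.span sc (U \<union> B)}"
  have *: "Inf ?D = enat n"
    using assms by (simp add: quot_dim_def)
  then have "?D \<noteq> {}"
    by (metis (no_types, lifting) Inf_enat_def enat.distinct(2))
  then have "Inf ?D \<in> ?D"
    unfolding Inf_enat_def by (metis (no_types, lifting) LeastI_ex ex_in_conv)
  then show ?thesis
    using * that by auto
qed

text \<open>Linear independence of the classes of \<open>X\<close> modulo \<open>U\<close>, with
  distinct elements having distinct classes; phrased on representatives so that no quotient type has
  to be formed.\<close>

definition indep_mod :: "('a::zero \<Rightarrow> 'b \<Rightarrow> 'b::ab_group_add) \<Rightarrow> 'b set \<Rightarrow> 'b set \<Rightarrow> bool"
  where "indep_mod sc U X \<longleftrightarrow>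
    finite X \<and> (\<forall>c. (\<Sum>x\<in>X. sc (c x) x) \<in> U \<longrightarrow> (\<forall>x\<in>X. c x = 0))"

lemma indep_modD:
  assumes "indep_mod sc U X" "(\<Sum>x\<in>X. sc (c x) x) \<in> U" "x \<in> X"
  shows "c x = 0"
  using assms unfolding indep_mod_def by blast

locale complex_vector_space = vector_space scale
  for scale :: "complex \<Rightarrow> 'b::ab_group_add \<Rightarrow> 'b" (infixr "*s" 75)
begin

text \<open>The exchange bound in the quotient. \<open>U\<close> may be infinite-dimensional while
  the exchange theorem wants a finite spanning set, so only the finitely many basis vectors of
  \<open>U\<close> that occur in expressions for elements of \<open>X\<close> are kept; they cancel
  in the final count.\<close>

lemma indep_mod_card_le:
  assumes U: "subspace U" and B: "finite B" and X: "indep_mod scale U X" "X \<subseteq> span (U \<union> B)"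
  shows "card X \<le> card B"
proof -
  have finX: "finite X"
    using X(1) by (simp add: indep_mod_def)
  obtain BU where BU: "BU \<subseteq> U" "independent BU" "U \<subseteq> span BU"
    using maximal_independent_subset by blast
  have spanBU: "span BU = U"
    using BU U by (simp add: span_minimal subset_antisym)
  have dec: "\<exists>S. finite S \<and> S \<subseteq> BU \<and> x \<in> span (S \<union> B)" if "x \<in> X" for x
  proof -
    have "span (BU \<union> B) = span (U \<union> B)"
      using U by (simp add: span_Un spanBU span_eq_iff[THEN iffD2])
    then have "x \<in> span (BU \<union> B)"
      using X(2) that by blast
    then obtain t r where t: "finite t" "t \<subseteq> BU \<union> B" "x = (\<Sum>a\<in>t. r a *s a)"
      unfolding span_explicit by blast
    have "a \<in> span ((t \<inter> BU) \<union> B)" if "a \<in> t" for a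
      using t(2) that by (intro span_base) blast
    then have "x \<in> span ((t \<inter> BU) \<union> B)"
      unfolding t(3)
      by (auto intro!: span_sum span_scale intro: span_base)
    then show ?thesis
      using t(1) by (intro exI[of _ "t \<inter> BU"]) auto
  qed
  then obtain S where S: "\<And>x. x \<in> X \<Longrightarrow> finite (S x) \<and> S x \<subseteq> BU \<and> x \<in> span (S x \<union> B)"
    by metis
  define BU' where "BU' = (\<Union>x\<in>X. S x)"
  have BU': "finite BU'" "BU' \<subseteq> BU"
    using S finX by (auto simp: BU'_def)
  have X': "X \<subseteq> span (BU' \<union> B)"
  proof
    fix x assume "x \<in> X"
    then have "x \<in> span (S x \<union> B)" "S x \<union> B \<subseteq> BU' \<union> B"
      using S by (auto simp: BU'_def)
    then show "x \<in> span (BU' \<union> B)"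
      using span_mono by blast
  qed
  have disj: "X \<inter> U = {}"
  proof (rule ccontr)
    assume "X \<inter> U \<noteq> {}"
    then obtain x where x: "x \<in> X" "x \<in> U" by blast
    have "(\<Sum>y\<in>X. (if y = x then 1 else 0) *s y) = (\<Sum>y\<in>X. if y = x then y else 0)"
      by (rule sum.cong) auto
    also have "\<dots> = x"
      using x finX by (simp add: sum.delta)
    finally have "(\<Sum>y\<in>X. (if y = x then 1 else 0) *s y) \<in> U"
      using x by simp
    then have "(if x = x then 1 else (0::complex)) = 0"
      using indep_modD[OF X(1), of "\<lambda>y. if y = x then 1 else 0" x] x(1) by blast
    then show False
      by simp
  qed
  have "independent (BU' \<union> X)"
  proof
    assume "dependent (BU' \<union> X)"
    then obtain u where u: "(\<Sum>v\<in>BU' \<union> X. u v *s v) = 0" "\<exists>v\<in>BU' \<union> X. u v \<noteq> 0"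
      using BU'(1) finX by (auto simp: dependent_finite)
    have "BU' \<inter> X = {}"
      using disj BU' BU by blast
    then have eq: "(\<Sum>v\<in>BU'. u v *s v) + (\<Sum>v\<in>X. u v *s v) = 0"
      using u(1) BU'(1) finX by (simp add: sum.union_disjoint)
    have "(\<Sum>v\<in>BU'. u v *s v) \<in> U"
      using U BU' BU by (intro subspace_sum subspace_scale) auto
    then have "(\<Sum>v\<in>X. u v *s v) \<in> U"
      using eq U by (metis add.inverse_unique subspace_neg)
    then have "\<forall>v\<in>X. u v = 0"
      using X(1) by (simp add: indep_mod_def)
    moreover from this have "(\<Sum>v\<in>BU'. u v *s v) = 0"
      using eq by simp
    then have "\<forall>v\<in>BU'. u v = 0"
      using BU(2) BU' by (metis independent_explicit_finite_subsets)
    ultimately show False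
      using u(2) by blast
  qed
  moreover have "BU' \<union> X \<subseteq> span (BU' \<union> B)"
    using X' by (auto intro: span_base)
  ultimately have "card (BU' \<union> X) \<le> card (BU' \<union> B)"
    using independent_span_bound[of "BU' \<union> B"] BU'(1) B by simp
  also have "\<dots> \<le> card BU' + card B"
    by (rule card_Un_le)
  also have "card (BU' \<union> X) = card BU' + card X"
    using BU' BU disj finX by (intro card_Un_disjoint) auto
  finally show ?thesis
    by simp
qed

lemma indep_mod_insert:
  assumes U: "subspace U" and X: "indep_mod scale U X" and w: "w \<notin> span (U \<union> X)"
  shows "indep_mod scale U (insert w X)"
  unfolding indep_mod_def
proof (intro conjI allI impI)
  show "finite (insert w X)"
    using X by (simp add: indep_mod_def)
  fix c assume c: "(\<Sum>x\<in>insert w X. c x *s x) \<in> U"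
  have "w \<notin> X"
    using w by (auto intro: span_base)
  then have *: "c w *s w + (\<Sum>x\<in>X. c x *s x) \<in> U"
    using c X by (simp add: indep_mod_def)
  have sX: "(\<Sum>x\<in>X. c x *s x) \<in> span (U \<union> X)"
    by (rule span_sum, rule span_scale, rule span_base) simp
  have "c w *s w + (\<Sum>x\<in>X. c x *s x) \<in> span (U \<union> X)"
    using * by (auto intro: span_base)
  then have "c w *s w \<in> span (U \<union> X)"
    using sX by (metis add_diff_cancel_right' span_diff)
  then have "c w = 0"
    using w by (metis scale_one scale_scale span_scale left_inverse)
  then show "\<forall>x\<in>insert w X. c x = 0"
    using * X by (simp add: indep_mod_def)
qed

text \<open>Duality between spanning and independent sets: an independent set that does not yet span
  can be enlarged, and the exchange bound gives the converse. Being a statement about every finite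
  \<open>n\<close>, it also covers infinite dimension.\<close>

lemma le_quot_dim_iff:
  assumes U: "subspace U"
  shows "enat n \<le> quot_dim scale W U \<longleftrightarrow> (\<exists>X. X \<subseteq> W \<and> indep_mod scale U X \<and> card X = n)"
proof
  assume "enat n \<le> quot_dim scale W U"
  then show "\<exists>X. X \<subseteq> W \<and> indep_mod scale U X \<and> card X = n"
  proof (induction n)
    case 0
    then show ?case
      by (intro exI[of _ "{}"]) (auto simp: indep_mod_def)
  next
    case (Suc n)
    from Suc.prems have "enat n \<le> quot_dim scale W U"
      by (metis Suc_ile_eq order_less_imp_le)
    then obtain X where X: "X \<subseteq> W" "indep_mod scale U X" "card X = n"
      using Suc.IH by blast
    have fin: "finite X"
      using X by (simp add: indep_mod_def)
    have "\<not> W \<subseteq> span (U \<union> X)"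
    proof
      assume "W \<subseteq> span (U \<union> X)"
      then have "quot_dim scale W U \<le> enat n"
        using quot_dim_le_card[of X W scale U] X fin by simp
      with Suc.prems show False
        by (metis Suc_n_not_le_n enat_ord_simps(1) order.trans)
    qed
    then obtain w where w: "w \<in> W" "w \<notin> span (U \<union> X)" by blast
    moreover have "w \<notin> X"
      using w by (auto intro: span_base)
    ultimately show ?case
      using indep_mod_insert[OF U X(2) w(2)] X fin
      by (intro exI[of _ "insert w X"]) auto
  qed
next
  assume "\<exists>X. X \<subseteq> W \<and> indep_mod scale U X \<and> card X = n"
  then obtain X where X: "X \<subseteq> W" "indep_mod scale U X" "card X = n" by blast
  show "enat n \<le> quot_dim scale W U"
  proof (cases "quot_dim scale W U")
    case (enat m)
    then obtain B where B: "finite B" "B \<subseteq> W" "W \<subseteq> span (U \<union> B)" "card B = m"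
      by (rule quot_dim_eqE)
    then have "n \<le> m"
      using indep_mod_card_le[OF U B(1) X(2)] X by auto
    then show ?thesis
      by (simp add: enat)
  qed simp
qed

lemma quot_dim_antimono:
  assumes "subspace U" "subspace U'" "U \<subseteq> U'"
  shows "quot_dim scale W U' \<le> quot_dim scale W U"
proof -
  have "indep_mod scale U X" if "indep_mod scale U' X" for X
    using that assms(3) unfolding indep_mod_def by blast
  then show ?thesis
    unfolding enat_le_iff_all_nat[of "quot_dim scale W U'"]
      le_quot_dim_iff[OF assms(1)] le_quot_dim_iff[OF assms(2)] by blast
qed

lemma quot_dim_eq_0D:
  assumes "quot_dim scale W U = 0" "subspace U"
  shows "W \<subseteq> U"
proof -
  obtain B where B: "finite B" "W \<subseteq> span (U \<union> B)" "card B = 0"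
    using quot_dim_eqE[of scale W U 0] assms(1) by (metis zero_enat_def)
  then have "B = {}" by simp
  then show ?thesis
    using B(2) assms(2) by (metis span_eq_iff sup_bot_right)
qed

text \<open>Applied to the powers of a function on a chart, this yields an annihilating polynomial
  modulo the ideal. The top coefficient is non-zero so that the polynomial can be made monic and
  split later.\<close>

lemma poly_in_subspace:
  assumes U: "subspace U" and W: "quot_dim scale W U \<noteq> \<infinity>"
    and y: "\<And>j. y j \<in> W"
  shows "\<exists>n c. (\<Sum>j\<le>n. c j *s y j) \<in> U \<and> c (n::nat) \<noteq> 0"
proof -
  obtain m where m: "quot_dim scale W U = enat m"
    using W by auto
  have neg: "\<not> (\<exists>X. X \<subseteq> W \<and> indep_mod scale U X \<and> card X = Suc m)"
    using le_quot_dim_iff[OF U, of "Suc m" W] m by simp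
  have "\<exists>c. (\<Sum>j\<le>m. c j *s y j) \<in> U \<and> (\<exists>j\<le>m. c j \<noteq> 0)"
  proof (cases "inj_on y {..m}")
    case True
    then have "card (y ` {..m}) = Suc m"
      by (simp add: card_image)
    moreover have "y ` {..m} \<subseteq> W"
      using y by blast
    ultimately have "\<not> indep_mod scale U (y ` {..m})"
      using neg by blast
    then obtain c where c: "(\<Sum>x\<in>y ` {..m}. c x *s x) \<in> U" "\<exists>x\<in>y ` {..m}. c x \<noteq> 0"
      unfolding indep_mod_def by auto
    from c(1) have "(\<Sum>j\<le>m. c (y j) *s y j) \<in> U"
      by (simp add: sum.reindex[OF True])
    moreover have "\<exists>j\<le>m. c (y j) \<noteq> 0"
      using c(2) by auto
    ultimately show ?thesis
      by (intro exI[of _ "\<lambda>j. c (y j)"]) blast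
  next
    case False
    \<comment> \<open>Repeated terms collapse in the image set, where independence cannot see them;
      the difference of two equal terms is then the relation.\<close>
    then obtain i j where ij: "i \<le> m" "j \<le> m" "i \<noteq> j" "y i = y j"
      by (auto simp: inj_on_def)
    let ?c = "\<lambda>k. if k = i then 1 else if k = j then - 1 else (0::complex)"
    have "(\<Sum>k\<le>m. ?c k *s y k) = (\<Sum>k\<in>{i, j}. ?c k *s y k)"
      using ij by (intro sum.mono_neutral_right) auto
    also have "\<dots> = 0"
      using ij by simp
    finally have "(\<Sum>k\<le>m. ?c k *s y k) \<in> U"
      using U by (simp add: subspace_0)
    moreover have "?c i \<noteq> 0" by simp
    ultimately show ?thesis
      using ij(1) by (intro exI[of _ ?c]) blast
  qed
  then obtain c where c: "(\<Sum>j\<le>m. c j *s y j) \<in> U" "\<exists>j\<le>m. c j \<noteq> 0" by blast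
  define n where "n = Max {j. j \<le> m \<and> c j \<noteq> 0}"
  have "n \<in> {j. j \<le> m \<and> c j \<noteq> 0}"
    unfolding n_def using c(2) by (intro Max_in) auto
  moreover have le: "j \<le> n" if "j \<le> m" "c j \<noteq> 0" for j
    unfolding n_def using that by (intro Max_ge) auto
  have "(\<Sum>j\<le>m. c j *s y j) = (\<Sum>j\<le>n. c j *s y j)"
    using calculation le by (intro sum.mono_neutral_right) force+
  ultimately show ?thesis
    using c(1) by auto
qed

end

section \<open>Quotient dimensions compared along linear maps\<close>

locale complex_vector_space_pair = vs1: complex_vector_space s1 + vs2: complex_vector_space s2
  for s1 :: "complex \<Rightarrow> 'b::ab_group_add \<Rightarrow> 'b" and s2 :: "complex \<Rightarrow> 'c::ab_group_add \<Rightarrow> 'c"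
begin

sublocale vector_space_pair s1 s2 ..

lemma linearI:
  assumes "\<And>x y. f (x + y) = f x + f y" "\<And>c x. f (s1 c x) = s2 c (f x)"
  shows "Vector_Spaces.linear s1 s2 f"
  by unfold_locales (use assms in auto)

lemma quot_dim_le_surj:
  assumes "Vector_Spaces.linear s1 s2 f" "vs1.subspace U1" "f ` W1 \<subseteq> W2" "f ` U1 \<subseteq> U2"
    and "\<And>w. w \<in> W2 \<Longrightarrow> \<exists>v\<in>W1. w - f v \<in> U2"
  shows "quot_dim s2 W2 U2 \<le> quot_dim s1 W1 U1"
proof (cases "quot_dim s1 W1 U1")
  case (enat m)
  then obtain B where B: "finite B" "B \<subseteq> W1" "W1 \<subseteq> vs1.span (U1 \<union> B)" "card B = m"
    by (rule quot_dim_eqE)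
  have "W2 \<subseteq> vs2.span (U2 \<union> f ` B)"
  proof
    fix w assume "w \<in> W2"
    then obtain v where v: "v \<in> W1" "w - f v \<in> U2"
      using assms(5) by blast
    then have "f v \<in> vs2.span (f ` (U1 \<union> B))"
      using B(3) by (metis image_eqI in_mono linear_span_image[OF assms(1)])
    moreover have "f ` (U1 \<union> B) \<subseteq> U2 \<union> f ` B"
      using assms(4) by blast
    ultimately have "f v \<in> vs2.span (U2 \<union> f ` B)"
      using vs2.span_mono by blast
    moreover have "w - f v \<in> vs2.span (U2 \<union> f ` B)"
      using v by (auto intro: vs2.span_base)
    ultimately show "w \<in> vs2.span (U2 \<union> f ` B)"
      by (metis diff_add_cancel vs2.span_add)
  qed
  then have "quot_dim s2 W2 U2 \<le> enat (card (f ` B))"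
    using B assms(3) by (intro quot_dim_le_card) blast+
  also have "\<dots> \<le> enat m"
    using B card_image_le by auto
  finally show ?thesis
    by (simp add: enat)
qed simp

lemma indep_mod_image:
  assumes f: "Vector_Spaces.linear s1 s2 f" and "vs1.subspace W1" "vs1.subspace U1" "vs2.subspace U2"
    and ker: "\<And>v. v \<in> W1 \<Longrightarrow> f v \<in> U2 \<Longrightarrow> v \<in> U1"
    and X: "X \<subseteq> W1" "indep_mod s1 U1 X"
  shows "indep_mod s2 U2 (f ` X)" "card (f ` X) = card X"
proof -
  have fin: "finite X"
    using X by (simp add: indep_mod_def)
  have inj: "inj_on f X"
  proof (rule inj_onI, rule ccontr)
    fix x y assume xy: "x \<in> X" "y \<in> X" "f x = f y" "x \<noteq> y"
    let ?c = "\<lambda>k. if k = x then 1 else if k = y then - 1 else (0::complex)"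
    have "(\<Sum>k\<in>X. s1 (?c k) k) = (\<Sum>k\<in>{x, y}. s1 (?c k) k)"
      using xy fin by (intro sum.mono_neutral_right) auto
    also have "\<dots> = x - y"
      using xy by simp
    also have "\<dots> \<in> U1"
    proof (rule ker)
      show "x - y \<in> W1"
        using xy X assms(2) by (auto intro: vs1.subspace_diff)
      show "f (x - y) \<in> U2"
        using xy assms(4) by (simp add: linear_diff[OF f] vs2.subspace_0)
    qed
    finally have "?c x = 0"
      using indep_modD[OF X(2), of ?c x] xy(1) by blast
    then show False
      by simp
  qed
  then show "card (f ` X) = card X"
    by (rule card_image)
  show "indep_mod s2 U2 (f ` X)"
    unfolding indep_mod_def
  proof (intro conjI allI impI)
    show "finite (f ` X)"
      using fin by simp
    fix c assume c: "(\<Sum>x\<in>f ` X. s2 (c x) x) \<in> U2"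
    have "f (\<Sum>x\<in>X. s1 (c (f x)) x) = (\<Sum>x\<in>f ` X. s2 (c x) x)"
      by (simp add: sum.reindex[OF inj] linear_sum[OF f] linear_scale[OF f])
    then have "(\<Sum>x\<in>X. s1 (c (f x)) x) \<in> U1"
      using c X assms(2) by (intro ker) (auto intro!: vs1.subspace_sum vs1.subspace_scale)
    then have "\<forall>x\<in>X. c (f x) = 0"
      using indep_modD[OF X(2), of "\<lambda>x. c (f x)"] by blast
    then show "\<forall>x\<in>f ` X. c x = 0"
      by blast
  qed
qed

lemma quot_dim_le_inj:
  assumes "Vector_Spaces.linear s1 s2 f" "vs1.subspace W1" "vs1.subspace U1" "vs2.subspace U2" "f ` W1 \<subseteq> W2"
    and "\<And>v. v \<in> W1 \<Longrightarrow> f v \<in> U2 \<Longrightarrow> v \<in> U1"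
  shows "quot_dim s1 W1 U1 \<le> quot_dim s2 W2 U2"
  unfolding enat_le_iff_all_nat[of "quot_dim s1 W1 U1"]
    vs1.le_quot_dim_iff[OF assms(3)] vs2.le_quot_dim_iff[OF assms(4)]
proof (intro allI impI)
  fix n assume "\<exists>X\<subseteq>W1. indep_mod s1 U1 X \<and> card X = n"
  then obtain X where "X \<subseteq> W1" "indep_mod s1 U1 X" "card X = n" by blast
  then show "\<exists>X\<subseteq>W2. indep_mod s2 U2 X \<and> card X = n"
    using indep_mod_image[OF assms(1-4,6)] assms(5) by (intro exI[of _ "f ` X"]) blast
qed

text \<open>The images of \<open>n\<close> independent elements of \<open>W1\<close> are independent
  in \<open>W2\<close>, where no larger independent set exists; hence they span. This serves to
  invert a generic form on a chart and to divide by a power of one in the graded ring.\<close>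

lemma surj_mod_if_inj_mod:
  assumes "Vector_Spaces.linear s1 s2 f" "vs1.subspace W1" "vs1.subspace U1" "vs2.subspace U2" "f ` W1 \<subseteq> W2"
    and "\<And>v. v \<in> W1 \<Longrightarrow> f v \<in> U2 \<Longrightarrow> v \<in> U1"
    and "enat n \<le> quot_dim s1 W1 U1" "quot_dim s2 W2 U2 \<le> enat n" "w \<in> W2"
  shows "\<exists>v\<in>W1. w - f v \<in> U2"
proof -
  obtain X where X: "X \<subseteq> W1" "indep_mod s1 U1 X" "card X = n"
    using assms(7) vs1.le_quot_dim_iff[OF assms(3)] by blast
  note fX = indep_mod_image[OF assms(1-4,6) X(1,2)]
  have "w \<in> vs2.span (U2 \<union> f ` X)"
  proof (rule ccontr)
    assume nin: "w \<notin> vs2.span (U2 \<union> f ` X)"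
    then have "indep_mod s2 U2 (insert w (f ` X))"
      using vs2.indep_mod_insert[OF assms(4) fX(1)] by blast
    moreover have "w \<notin> f ` X"
      using nin by (auto intro: vs2.span_base)
    then have "card (insert w (f ` X)) = Suc n"
      using fX X(3) by (simp add: indep_mod_def)
    moreover have "insert w (f ` X) \<subseteq> W2"
      using X(1) assms(5,9) by blast
    ultimately have "enat (Suc n) \<le> quot_dim s2 W2 U2"
      using vs2.le_quot_dim_iff[OF assms(4)] by blast
    then show False
      using assms(8) by (metis Suc_n_not_le_n enat_ord_simps(1) order.trans)
  qed
  then obtain u v where uv: "u \<in> U2" "v \<in> vs2.span (f ` X)" "w = u + v"
    using assms(4) vs2.span_eq_iff[of U2] unfolding vs2.span_Un by blast
  then obtain x where "x \<in> vs1.span X" "v = f x"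
    using linear_span_image[OF assms(1)] by blast
  moreover have "vs1.span X \<subseteq> W1"
    using X(1) assms(2) by (rule vs1.span_minimal)
  ultimately show ?thesis
    using uv by (intro bexI[of _ x]) auto
qed

end

section \<open>Laurent polynomials\<close>

abbreviation single :: "'a \<Rightarrow> 'b::zero \<Rightarrow> 'a \<Rightarrow>\<^sub>0 'b"
  where "single \<equiv> Poly_Mapping.single"

abbreviation lookup :: "('a \<Rightarrow>\<^sub>0 'b::zero) \<Rightarrow> 'a \<Rightarrow> 'b"
  where "lookup \<equiv> Poly_Mapping.lookup"

abbreviation keys :: "('a \<Rightarrow>\<^sub>0 'b::zero) \<Rightarrow> 'a set"
  where "keys \<equiv> Poly_Mapping.keys"

lemma poly_mapping_eq_sum_single:
  fixes p :: "'a \<Rightarrow>\<^sub>0 'b::comm_monoid_add"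
  shows "p = (\<Sum>m\<in>keys p. single m (lookup p m))"
  by (rule poly_mapping_eqI)
    (simp add: lookup_sum lookup_single when_def sum.delta in_keys_iff)

lemma poly_mapping_single_induct [case_names zero single add]:
  fixes p :: "'a \<Rightarrow>\<^sub>0 'b::comm_monoid_add"
  assumes "P 0" "\<And>m c. P (single m c)" "\<And>p q. P p \<Longrightarrow> P q \<Longrightarrow> P (p + q)"
  shows "P p"
proof -
  have "P (\<Sum>m\<in>M. single m (lookup p m))" if "finite M" for M
    using that by induction (use assms in auto)
  from this[OF finite_keys, of p] show ?thesis
    using poly_mapping_eq_sum_single[of p] by simp
qed

lemma lookup_single_mult:
  fixes m :: "'a::ab_group_add" and p :: "'a \<Rightarrow>\<^sub>0 'b::comm_ring_1"
  shows "lookup (single m c * p) n = c * lookup p (n - m)"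
proof (induction p rule: poly_mapping_single_induct)
  case (single k d)
  show ?case
    by (auto simp: mult_single lookup_single when_def algebra_simps)
qed (auto simp: algebra_simps lookup_add)

lemma complex_vector_space_lscale: "complex_vector_space lscale"
  unfolding complex_vector_space_def lscale_def
  by unfold_locales (auto simp: algebra_simps single_add mult_single mult.assoc[symmetric])

interpretation lsc: complex_vector_space lscale
  by (rule complex_vector_space_lscale)

interpretation fsc: complex_vector_space "fscale :: complex \<Rightarrow> ('j \<Rightarrow> ('i, 'v) laurent) \<Rightarrow> _"
  unfolding complex_vector_space_def fscale_def
  by unfold_locales
    (auto simp: fun_eq_iff lsc.scale_right_distrib lsc.scale_left_distrib)

lemma lscale_mult_left: "lscale a p * q = lscale a (p * q)"
  and lscale_mult_right: "p * lscale a q = lscale a (p * q)"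
  by (simp_all add: lscale_def algebra_simps)

lemma lookup_lscale: "lookup (lscale a p) m = a * lookup p m"
  by (simp add: lscale_def lookup_single_mult)

definition lmonom :: "('i, 'v) expo \<Rightarrow> ('i, 'v) laurent"
  where "lmonom m = single m 1"

lemma lmonom_0 [simp]: "lmonom 0 = 1"
  by (simp add: lmonom_def)

lemma lmonom_add: "lmonom (m + n) = lmonom m * lmonom n"
  by (simp add: lmonom_def mult_single)

lemma lmonom_sum: "lmonom (sum f A) = (\<Prod>x\<in>A. lmonom (f x))"
  by (induction A rule: infinite_finite_induct) (auto simp: lmonom_add)

lemma lmonom_uminus_mult [simp]: "lmonom m * lmonom (- m) = 1" "lmonom (- m) * lmonom m = 1"
  by (simp_all flip: lmonom_add)

lemma lmonom_cancel [simp]: "lmonom m * (lmonom (- m) * p) = p" "lmonom (- m) * (lmonom m * p) = p"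
  by (simp_all flip: mult.assoc)

lemma lmonom_power: "lmonom m ^ N = lmonom (frag_cmul (int N) m)"
  by (induction N) (auto simp: frag_cmul_distrib simp flip: lmonom_add)

lemma lookup_lmonom_mult: "lookup (lmonom m * p) n = lookup p (n - m)"
  by (simp add: lmonom_def lookup_single_mult)

lemma keys_lmonom_mult: "keys (lmonom m * p) = (+) m ` keys p"
proof (intro set_eqI iffI)
  fix n assume "n \<in> keys (lmonom m * p)"
  then have "n - m \<in> keys p"
    by (simp add: in_keys_iff lookup_lmonom_mult)
  then show "n \<in> (+) m ` keys p"
    by (intro image_eqI[of _ _ "n - m"]) auto
qed (auto simp: in_keys_iff lookup_lmonom_mult)

lemma coord_eq_lmonom: "coord x = lmonom (single x 1)"
  by (simp add: coord_def lmonom_def)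

definition char_expo :: "('i \<times> 'v) set \<Rightarrow> ('i, 'v) expo"
  where "char_expo W = (\<Sum>x\<in>W. single x 1)"

lemma prod_coord: "(\<Prod>x\<in>W. coord x) = lmonom (char_expo W)"
  by (simp add: coord_eq_lmonom char_expo_def lmonom_sum)

lemma lookup_char_expo: "finite W \<Longrightarrow> lookup (char_expo W) x = (if x \<in> W then 1 else 0)"
  by (simp add: char_expo_def lookup_sum lookup_single when_def sum.delta)

lemma keys_char_expo: "finite W \<Longrightarrow> keys (char_expo W) = W"
  by (rule set_eqI) (simp add: in_keys_iff lookup_char_expo)

abbreviation vars_pow :: "('i \<times> 'v) set \<Rightarrow> nat \<Rightarrow> ('i, 'v) laurent"
  where "vars_pow W N \<equiv> lmonom (frag_cmul (int N) (char_expo W))"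

lemma localize_iff: "q \<in> localize I W \<longleftrightarrow> (\<exists>N::nat. vars_pow W N * q \<in> I)"
  by (simp add: localize_def prod_coord lmonom_power)


subsection \<open>Multidegrees\<close>

lemma multideg_add: "multideg (m + n) = multideg m + multideg n"
proof
  fix i
  show "multideg (m + n) i = (multideg m + multideg n) i"
    using setsum_keys_plus_distrib[of "\<lambda>x c. if fst x = i then c else 0" m n]
    by (simp add: multideg_def)
qed

lemma multideg_single: "multideg (single x c) = (\<lambda>i. if fst x = i then c else 0)"
  by (auto simp: multideg_def fun_eq_iff)

lemma multideg_0 [simp]: "multideg 0 = 0"
  by (auto simp: multideg_def fun_eq_iff)

lemma multideg_sum_apply: "multideg (sum f A) i = (\<Sum>x\<in>A. multideg (f x) i)"
  by (induction A rule: infinite_finite_induct) (auto simp: multideg_add)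

lemma multideg_uminus: "multideg (- m) = - multideg m"
  by (metis add.inverse_unique add.right_inverse multideg_0 multideg_add)

lemma homog_0 [simp]: "0 \<in> homog d"
  by (simp add: homog_def)

lemma homog_add: "p \<in> homog d \<Longrightarrow> q \<in> homog d \<Longrightarrow> p + q \<in> homog d"
  using keys_add[of p q] by (auto simp: homog_def)

lemma homog_single: "multideg m = d \<Longrightarrow> single m c \<in> homog d"
  by (simp add: homog_def)

lemma homog_lmonom: "multideg m = d \<Longrightarrow> lmonom m \<in> homog d"
  by (simp add: lmonom_def homog_single)

lemma homog_mult: "p \<in> homog d \<Longrightarrow> q \<in> homog e \<Longrightarrow> p * q \<in> homog (d + e)"
  using keys_mult[of p q] by (fastforce simp: homog_def multideg_add)

lemma homog_uminus: "p \<in> homog d \<Longrightarrow> - p \<in> homog d"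
  by (simp add: homog_def in_keys_iff)

lemma homog_diff: "p \<in> homog d \<Longrightarrow> q \<in> homog d \<Longrightarrow> p - q \<in> homog d"
  using homog_add[OF _ homog_uminus] by fastforce

lemma homog_sum: "(\<And>x. x \<in> A \<Longrightarrow> f x \<in> homog d) \<Longrightarrow> sum f A \<in> homog d"
  by (induction A rule: infinite_finite_induct) (auto simp: homog_add)

lemma homog_lscale: "p \<in> homog d \<Longrightarrow> lscale a p \<in> homog d"
  by (auto simp: homog_def in_keys_iff lookup_lscale)

lemma homog_one: "1 \<in> homog 0"
  by (simp add: homog_def)

lemma lookup_component: "lookup (component d p) m = (if multideg m = d then lookup p m else 0)"
  by (auto simp: component_def lookup_sum lookup_single when_def sum.delta in_keys_iff)

lemma component_0 [simp]: "component d 0 = 0"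
  by (rule poly_mapping_eqI) (simp add: lookup_component)

lemma component_add: "component d (p + q) = component d p + component d q"
  by (rule poly_mapping_eqI) (simp add: lookup_component lookup_add)

lemma component_homog: "component d p \<in> homog d"
  by (auto simp: homog_def in_keys_iff lookup_component split: if_splits)

lemma component_homog_same: "p \<in> homog d \<Longrightarrow> component d p = p"
  by (rule poly_mapping_eqI) (auto simp: lookup_component homog_def in_keys_iff)

lemma component_homog_other: "p \<in> homog e \<Longrightarrow> e \<noteq> d \<Longrightarrow> component d p = 0"
  by (rule poly_mapping_eqI) (auto simp: lookup_component homog_def in_keys_iff)

lemma component_mult_homog:
  assumes "f \<in> homog e"
  shows "component (d + e) (f * p) = f * component d p"
proof (induction p rule: poly_mapping_single_induct)
  case (single m c)
  have *: "f * single m c \<in> homog (e + multideg m)"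
    using assms by (intro homog_mult homog_single) auto
  show ?case
  proof (cases "multideg m = d")
    case True
    then have "component (d + e) (f * single m c) = f * single m c"
      using * by (intro component_homog_same) (metis add.commute)
    then show ?thesis
      using component_homog_same[OF homog_single[OF True]] by metis
  next
    case False
    then have "e + multideg m \<noteq> d + e"
      by (metis add.commute add_left_cancel)
    then show ?thesis
      using component_homog_other[OF *] component_homog_other[OF homog_single[OF refl] False]
      by (metis mult_zero_right)
  qed
qed (auto simp: component_add algebra_simps)

lemma sum_component: "p = (\<Sum>d\<in>multideg ` keys p. component d p)"
proof (rule poly_mapping_eqI)
  fix m
  show "lookup p m = lookup (\<Sum>d\<in>multideg ` keys p. component d p) m"
    by (auto simp: lookup_sum lookup_component sum.delta' in_keys_iff intro!: image_eqI)
qed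

lemma keys_component: "keys (component d p) \<subseteq> keys p"
  by (auto simp: in_keys_iff lookup_component split: if_splits)


subsection \<open>The Cox ring and its ideals\<close>

lemma cox_ringI:
  assumes "\<And>m x. m \<in> keys p \<Longrightarrow> x \<in> keys m \<Longrightarrow> x \<in> Sigma K V"
    "\<And>m x. m \<in> keys p \<Longrightarrow> 0 \<le> lookup m x"
  shows "p \<in> cox_ring K V"
  using assms unfolding cox_ring_def by blast

lemma cox_ringD:
  assumes "p \<in> cox_ring K V" "m \<in> keys p"
  shows "keys m \<subseteq> Sigma K V" "0 \<le> lookup m x"
  using assms unfolding cox_ring_def by blast+

lemma cox_ring_0 [simp]: "0 \<in> cox_ring K V"
  by (simp add: cox_ring_def)

lemma cox_ring_add: "p \<in> cox_ring K V \<Longrightarrow> q \<in> cox_ring K V \<Longrightarrow> p + q \<in> cox_ring K V"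
  using keys_add[of p q] unfolding cox_ring_def by blast

lemma cox_ring_mult:
  assumes "p \<in> cox_ring K V" "q \<in> cox_ring K V"
  shows "p * q \<in> cox_ring K V"
proof (rule cox_ringI)
  fix m x assume "m \<in> keys (p * q)"
  then obtain a b where ab: "m = a + b" "a \<in> keys p" "b \<in> keys q"
    using keys_mult[of p q] by blast
  show "0 \<le> lookup m x"
    using cox_ringD(2)[OF assms(1) ab(2), of x] cox_ringD(2)[OF assms(2) ab(3), of x]
    by (simp add: ab(1) lookup_add)
  assume "x \<in> keys m"
  then have "x \<in> keys a \<union> keys b"
    using keys_add[of a b] ab(1) by blast
  then show "x \<in> Sigma K V"
    using cox_ringD(1)[OF assms(1) ab(2)] cox_ringD(1)[OF assms(2) ab(3)] by blast
qed

lemma cox_ring_single_0: "single 0 a \<in> cox_ring K V"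
  by (simp add: cox_ring_def)

lemma cox_ring_one [simp]: "1 \<in> cox_ring K V"
  by (simp add: cox_ring_def)

lemma cox_ring_lscale: "p \<in> cox_ring K V \<Longrightarrow> lscale a p \<in> cox_ring K V"
  unfolding lscale_def by (intro cox_ring_mult cox_ring_single_0)

lemma cox_ring_uminus: "p \<in> cox_ring K V \<Longrightarrow> - p \<in> cox_ring K V"
  by (simp add: cox_ring_def in_keys_iff)

lemma cox_ring_diff: "p \<in> cox_ring K V \<Longrightarrow> q \<in> cox_ring K V \<Longrightarrow> p - q \<in> cox_ring K V"
  using cox_ring_add[OF _ cox_ring_uminus] by fastforce

lemma cox_ring_sum: "(\<And>x. x \<in> A \<Longrightarrow> f x \<in> cox_ring K V) \<Longrightarrow> sum f A \<in> cox_ring K V"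
  by (induction A rule: infinite_finite_induct) (auto simp: cox_ring_add)

lemma cox_ring_power: "p \<in> cox_ring K V \<Longrightarrow> p ^ n \<in> cox_ring K V"
  by (induction n) (auto simp: cox_ring_mult)

lemma cox_ring_lmonom:
  assumes "keys m \<subseteq> Sigma K V" "\<And>x. 0 \<le> lookup m x"
  shows "lmonom m \<in> cox_ring K V"
  using assms by (auto simp: cox_ring_def lmonom_def)

lemma cox_ring_coord: "x \<in> Sigma K V \<Longrightarrow> coord x \<in> cox_ring K V"
  unfolding coord_eq_lmonom by (rule cox_ring_lmonom) (auto simp: lookup_single when_def)

lemma cox_ring_component: "p \<in> cox_ring K V \<Longrightarrow> component d p \<in> cox_ring K V"
  using keys_component[of d p] unfolding cox_ring_def by blast

lemma closed_subschemeD: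
  assumes "closed_subscheme K V I"
  shows "I \<subseteq> cox_ring K V" "0 \<in> I"
    "p \<in> I \<Longrightarrow> q \<in> I \<Longrightarrow> p + q \<in> I"
    "s \<in> cox_ring K V \<Longrightarrow> p \<in> I \<Longrightarrow> s * p \<in> I"
    "p \<in> I \<Longrightarrow> component d p \<in> I"
    "p \<in> cox_ring K V \<Longrightarrow> (\<And>J. J \<in> charts K V \<Longrightarrow> p \<in> localize I (chart_vars K J)) \<Longrightarrow> p \<in> I"
  using assms unfolding closed_subscheme_def by blast+

locale projective_product =
  fixes K :: "'i set" and V :: "'i \<Rightarrow> 'v set"
  assumes finite_K: "finite K" and finite_V: "i \<in> K \<Longrightarrow> finite (V i)"
    and V_nonempty: "i \<in> K \<Longrightarrow> V i \<noteq> {}"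
begin

abbreviation "S \<equiv> cox_ring K V"
abbreviation "cvars \<equiv> chart_vars K"

lemma finite_charts: "finite (charts K V)"
  unfolding charts_def using finite_K finite_V by (rule finite_PiE)

lemma finite_Sigma_KV: "finite (Sigma K V)"
  using finite_K finite_V by blast

lemma finite_cvars: "finite (cvars J)"
  using finite_K by (simp add: chart_vars_def)

lemma cvars_subset: "J \<in> charts K V \<Longrightarrow> cvars J \<subseteq> Sigma K V"
  by (auto simp: chart_vars_def charts_def PiE_def Pi_def)

lemma char_expo_cox:
  assumes "W \<subseteq> Sigma K V"
  shows "vars_pow W N \<in> S"
proof -
  have "finite W"
    using assms finite_Sigma_KV finite_subset by blast
  then show ?thesis
    using assms by (intro cox_ring_lmonom) (auto simp: lookup_char_expo keys_char_expo)
qed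

lemma ex_chart: "\<exists>J. J \<in> charts K V"
proof
  show "(\<lambda>i. if i \<in> K then SOME v. v \<in> V i else undefined) \<in> charts K V"
    using V_nonempty by (auto simp: charts_def some_in_eq)
qed

text \<open>A Laurent polynomial regular on every chart can have a pole only along a coordinate of a
  factor with a single coordinate, and there homogeneity excludes it.\<close>

lemma global_section_cox:
  assumes "\<And>J. J \<in> charts K V \<Longrightarrow> q \<in> localize S (cvars J)" "q \<in> homog d" "\<And>i. i \<in> K \<Longrightarrow> 0 \<le> d i"
  shows "q \<in> S"
proof -
  have loc: "keys m \<subseteq> Sigma K V"
    "x \<notin> cvars J \<Longrightarrow> 0 \<le> lookup m x"
    if J: "J \<in> charts K V" and m: "m \<in> keys q" for J m x
  proof -
    obtain N where "vars_pow (cvars J) N * q \<in> S"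
      using assms(1)[OF J] unfolding localize_iff by blast
    from cox_ringD[OF this, of "frag_cmul (int N) (char_expo (cvars J)) + m"]
    have *: "keys (frag_cmul (int N) (char_expo (cvars J)) + m) \<subseteq> Sigma K V"
      "\<And>x. 0 \<le> lookup (frag_cmul (int N) (char_expo (cvars J)) + m) x"
      using m by (auto simp: keys_lmonom_mult)
    show "0 \<le> lookup m x" if "x \<notin> cvars J"
      using *(2)[of x] that by (simp add: lookup_add lookup_char_expo finite_cvars)
    show "keys m \<subseteq> Sigma K V"
    proof
      fix y assume y: "y \<in> keys m"
      show "y \<in> Sigma K V"
      proof (cases "y \<in> cvars J")
        case True
        then show ?thesis
          using cvars_subset[OF J] by blast
      next
        case False
        then have "y \<in> keys (frag_cmul (int N) (char_expo (cvars J)) + m)"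
          using y unfolding in_keys_iff lookup_add lookup_frag_cmul lookup_char_expo[OF finite_cvars]
          by simp
        then show ?thesis
          using *(1) by blast
      qed
    qed
  qed
  obtain J0 where J0: "J0 \<in> charts K V"
    using ex_chart by blast
  show ?thesis
  proof (rule cox_ringI)
    fix m x assume m: "m \<in> keys q"
    note sub = loc(1)[OF J0 m]
    show "x \<in> Sigma K V" if "x \<in> keys m"
      using sub that by blast
    show "0 \<le> lookup m x"
    proof (cases "x \<in> Sigma K V")
      case False
      then have "lookup m x = 0"
        using sub by (metis in_keys_iff subsetD)
      then show ?thesis by simp
    next
      case True
      then obtain i v where x: "x = (i, v)" "i \<in> K" "v \<in> V i" by blast
      show ?thesis
      proof (cases "V i = {v}")
        case True
        have "d i = multideg m i"
          using assms(2) m by (auto simp: homog_def)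
        also have "\<dots> = (\<Sum>y\<in>keys m. if y = x then lookup m y else 0)"
          unfolding multideg_def
        proof (rule sum.cong)
          fix y assume "y \<in> keys m"
          then have "y \<in> Sigma K V"
            using sub by blast
          then show "(if fst y = i then lookup m y else 0) = (if y = x then lookup m y else 0)"
            using True x(1) by (cases y) auto
        qed simp
        also have "\<dots> = lookup m x"
          by (simp add: sum.delta in_keys_iff)
        finally show ?thesis
          using assms(3)[OF x(2)] by simp
      next
        case False
        then obtain w where w: "w \<in> V i" "w \<noteq> v"
          using x(3) by blast
        \<comment> \<open>A second coordinate \<open>w\<close> of the factor gives a chart on which
          the coordinate \<open>x\<close> is not inverted.\<close>
        have "J0(i := w) \<in> charts K V"
          using J0 x w by (auto simp: charts_def PiE_def extensional_def)
        moreover have "x \<notin> cvars (J0(i := w))"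
          using x w by (auto simp: chart_vars_def)
        ultimately show ?thesis
          using loc(2) m by blast
      qed
    qed
  qed
qed

lemma lmonom_localize:
  assumes "keys m \<subseteq> W" "W \<subseteq> Sigma K V"
  shows "lmonom m \<in> localize S W"
proof -
  have finW: "finite W"
    using assms(2) finite_Sigma_KV finite_subset by blast
  \<comment> \<open>A bound for all exponents at once, hence a power that clears every pole.\<close>
  define N where "N = (\<Sum>x\<in>W. nat \<bar>lookup m x\<bar>)"
  have le: "\<bar>lookup m x\<bar> \<le> int N" if "x \<in> W" for x
    using member_le_sum[of x W "\<lambda>x. nat \<bar>lookup m x\<bar>"] finW that
    unfolding N_def by linarith
  have zero: "lookup m x = 0" if "x \<notin> W" for x
    using assms(1) that by (auto simp: in_keys_iff)
  have "lmonom (frag_cmul (int N) (char_expo W) + m) \<in> S"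
  proof (rule cox_ring_lmonom)
    show "keys (frag_cmul (int N) (char_expo W) + m) \<subseteq> Sigma K V"
      using assms keys_add[of "frag_cmul (int N) (char_expo W)" m] keys_cmul[of "int N" "char_expo W"]
      by (metis (no_types, lifting) finW keys_char_expo Un_least subset_trans)
    show "0 \<le> lookup (frag_cmul (int N) (char_expo W) + m) x" for x
      using le[of x] zero[of x] finW by (auto simp: lookup_add lookup_char_expo)
  qed
  then show ?thesis
    unfolding localize_iff lmonom_add by blast
qed

text \<open>On the chart \<open>J\<close> this monomial trivializes the line bundle of multidegree
  \<open>d\<close>: it is a unit there, and multiplication by it or its inverse passes between
  degree 0 and degree \<open>d\<close>. Its multidegree is \<open>d\<close> only for
  \<open>d\<close> supported on \<open>K\<close>, whence the support conditions in later
  lemmas.\<close>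

definition xmon :: "('i \<Rightarrow> 'v) \<Rightarrow> ('i \<Rightarrow> int) \<Rightarrow> ('i, 'v) expo"
  where "xmon J d = (\<Sum>i\<in>K. single (i, J i) (d i))"

lemma xmon_uminus: "xmon J (- d) = - xmon J d"
  by (simp add: xmon_def single_uminus sum_negf)

lemma multideg_xmon:
  assumes "\<And>i. i \<notin> K \<Longrightarrow> d i = 0"
  shows "multideg (xmon J d) = d"
proof
  fix i
  have "multideg (xmon J d) i = (\<Sum>j\<in>K. if j = i then d j else 0)"
    by (simp add: xmon_def multideg_sum_apply multideg_single)
  also have "\<dots> = d i"
    using assms finite_K by (simp add: sum.delta)
  finally show "multideg (xmon J d) i = d i" .
qed

lemma keys_xmon: "keys (xmon J d) \<subseteq> cvars J"
  using keys_sum[of "\<lambda>i. single (i, J i) (d i)" K]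
  by (force simp: xmon_def chart_vars_def split: if_splits)

lemma xmon_localize: "cvars J \<subseteq> W \<Longrightarrow> W \<subseteq> Sigma K V \<Longrightarrow> lmonom (xmon J d) \<in> localize S W"
  using keys_xmon by (intro lmonom_localize) (rule subset_trans)

end

interpretation ll: complex_vector_space_pair lscale lscale
  by (simp add: complex_vector_space_pair_def complex_vector_space_lscale)

interpretation ff: complex_vector_space_pair
  "fscale :: complex \<Rightarrow> ('j \<Rightarrow> ('i, 'v) laurent) \<Rightarrow> _" "fscale :: complex \<Rightarrow> ('k \<Rightarrow> ('h, 'w) laurent) \<Rightarrow> _"
  by (intro complex_vector_space_pair.intro fsc.complex_vector_space_axioms)

interpretation lf: complex_vector_space_pair
  "lscale :: complex \<Rightarrow> ('i, 'v) laurent \<Rightarrow> _" "fscale :: complex \<Rightarrow> ('k \<Rightarrow> ('h, 'w) laurent) \<Rightarrow> _"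
  by (intro complex_vector_space_pair.intro fsc.complex_vector_space_axioms complex_vector_space_lscale)

context projective_product
begin

subsection \<open>Localizations\<close>

lemma finite_if_subset_Sigma: "W \<subseteq> Sigma K V \<Longrightarrow> finite W"
  using finite_Sigma_KV finite_subset by blast

text \<open>This provides common denominators for two local sections. Only closure under
  multiplication by \<open>S\<close> is asked of \<open>I\<close>, because the lemma is also applied
  to an ideal that is not saturated.\<close>

lemma localize_ideal_all_ge:
  assumes "\<And>s p. s \<in> S \<Longrightarrow> p \<in> I \<Longrightarrow> s * p \<in> I" "W \<subseteq> Sigma K V" "q \<in> localize I W"
  shows "\<exists>N::nat. \<forall>N'\<ge>N. vars_pow W N' * q \<in> I"
proof -
  obtain N where N: "vars_pow W N * q \<in> I"
    using assms(3) unfolding localize_iff by blast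
  have "vars_pow W N' * q \<in> I" if "N' \<ge> N" for N'
  proof -
    have "int N' = int (N' - N) + int N"
      using that by simp
    then have "vars_pow W N' * q
      = vars_pow W (N' - N) * (vars_pow W N * q)"
      by (simp only: frag_cmul_distrib lmonom_add mult.assoc)
    then show ?thesis
      using assms(1)[OF char_expo_cox[OF assms(2)] N] by simp
  qed
  then show ?thesis by blast
qed

lemma localize_all_ge:
  assumes "closed_subscheme K V I" "W \<subseteq> Sigma K V" "q \<in> localize I W"
  shows "\<exists>N::nat. \<forall>N'\<ge>N. vars_pow W N' * q \<in> I"
  by (rule localize_ideal_all_ge[OF closed_subschemeD(4)[OF assms(1)] assms(2,3)])

lemma localize_add:
  assumes I: "closed_subscheme K V I" and W: "W \<subseteq> Sigma K V"
    and "p \<in> localize I W" "q \<in> localize I W"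
  shows "p + q \<in> localize I W"
proof -
  obtain M N where "\<forall>N'\<ge>M. vars_pow W N' * p \<in> I"
    "\<forall>N'\<ge>N. vars_pow W N' * q \<in> I"
    using localize_all_ge[OF I W] assms(3,4) by meson
  then have "vars_pow W (max M N) * (p + q) \<in> I"
    using closed_subschemeD(3)[OF I] by (simp add: distrib_left)
  then show ?thesis
    unfolding localize_iff by blast
qed

lemma localize_mult:
  assumes I: "closed_subscheme K V I" and W: "W \<subseteq> Sigma K V"
    and "s \<in> localize S W" "q \<in> localize I W"
  shows "s * q \<in> localize I W"
proof -
  obtain M N where *: "vars_pow W M * s \<in> S"
    "vars_pow W N * q \<in> I"
    using assms(3,4) unfolding localize_iff by blast
  have "vars_pow W (M + N) * (s * q)
    = (vars_pow W M * s) * (vars_pow W N * q)"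
    by (simp only: of_nat_add frag_cmul_distrib lmonom_add mult_ac)
  then have "vars_pow W (M + N) * (s * q) \<in> I"
    using closed_subschemeD(4)[OF I *] by simp
  then show ?thesis
    unfolding localize_iff by blast
qed

lemma localize_base: "p \<in> I \<Longrightarrow> p \<in> localize I W"
  unfolding localize_iff by (rule exI[of _ 0]) simp

lemma localize_0: "closed_subscheme K V I \<Longrightarrow> 0 \<in> localize I W"
  by (intro localize_base closed_subschemeD(2))

lemma localize_lscale:
  assumes "closed_subscheme K V I" "W \<subseteq> Sigma K V" "q \<in> localize I W"
  shows "lscale a q \<in> localize I W"
  unfolding lscale_def by (intro localize_mult assms localize_base cox_ring_single_0)

lemma localize_diff:
  assumes "closed_subscheme K V I" "W \<subseteq> Sigma K V" "p \<in> localize I W" "q \<in> localize I W"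
  shows "p - q \<in> localize I W"
  using localize_add[OF assms(1,2,3) localize_lscale[OF assms(1,2,4), of "-1"]] by simp

lemma localize_subset:
  assumes I: "closed_subscheme K V I" and W: "W \<subseteq> W'" "W' \<subseteq> Sigma K V"
    and q: "q \<in> localize I W"
  shows "q \<in> localize I W'"
proof -
  obtain N where N: "vars_pow W N * q \<in> I"
    using q unfolding localize_iff by blast
  have fin: "finite W'" "finite W"
    using finite_if_subset_Sigma[OF W(2)] finite_subset[OF W(1)] by blast+
  have "char_expo W' = char_expo (W' - W) + char_expo W"
    unfolding char_expo_def using W fin by (simp add: sum.subset_diff)
  then have "vars_pow W' N * q
    = vars_pow (W' - W) N * (vars_pow W N * q)"
    by (simp only: frag_cmul_distrib2 lmonom_add mult.assoc)
  moreover have "vars_pow (W' - W) N \<in> S"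
    using W by (intro char_expo_cox) auto
  ultimately show ?thesis
    unfolding localize_iff using closed_subschemeD(4)[OF I _ N] by metis
qed

lemma closed_subscheme_cox: "closed_subscheme K V S"
  unfolding closed_subscheme_def by (auto intro: cox_ring_add cox_ring_mult cox_ring_component)

lemma localize_cox:
  assumes "closed_subscheme K V I" "q \<in> localize I W"
  shows "q \<in> localize S W"
  using assms closed_subschemeD(1) unfolding localize_def by blast

text \<open>For a form \<open>L\<close> and a zero-dimensional scheme this says that the
  hypersurface of \<open>L\<close> misses the scheme, so that \<open>L\<close> trivializes its line
  bundle along the scheme.\<close>

definition nonzerodivisor :: "('i, 'v) laurent set \<Rightarrow> ('i, 'v) laurent \<Rightarrow> bool"
  where "nonzerodivisor I L \<longleftrightarrow> (\<forall>p\<in>S. L * p \<in> I \<longrightarrow> p \<in> I)"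

lemma localize_nonzerodivisor:
  assumes I: "closed_subscheme K V I" and W: "W \<subseteq> Sigma K V"
    and L: "nonzerodivisor I L" and q: "q \<in> localize S W" "L * q \<in> localize I W"
  shows "q \<in> localize I W"
proof -
  obtain M N where
    "\<forall>N'\<ge>M. vars_pow W N' * q \<in> S"
    "\<forall>N'\<ge>N. vars_pow W N' * (L * q) \<in> I"
    using localize_all_ge[OF I W q(2)] localize_all_ge[OF closed_subscheme_cox W q(1)] by blast
  then have "vars_pow W (max M N) * q \<in> S"
    "L * (vars_pow W (max M N) * q) \<in> I"
    by (simp_all add: mult.left_commute)
  then have "vars_pow W (max M N) * q \<in> I"
    using L unfolding nonzerodivisor_def by blast
  then show ?thesis
    unfolding localize_iff by blast
qed


subsection \<open>Sections and cochains\<close>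

lemma sections_mult:
  assumes "closed_subscheme K V I" "W \<subseteq> Sigma K V" "s \<in> sections S e W" "q \<in> sections I d W"
  shows "s * q \<in> sections I (e + d) W"
  using assms localize_mult[OF assms(1,2)] homog_mult unfolding sections_def by blast

lemma sections_subspace:
  assumes "closed_subscheme K V I" "W \<subseteq> Sigma K V"
  shows "lsc.subspace (sections I d W)"
  using assms by (auto simp: lsc.subspace_def sections_def homog_add homog_lscale
      intro: localize_0 localize_add localize_lscale)

lemma sections_subset:
  assumes "closed_subscheme K V I" "W \<subseteq> W'" "W' \<subseteq> Sigma K V"
  shows "sections I d W \<subseteq> sections I d W'"
  using localize_subset[OF assms] by (auto simp: sections_def)

lemma sections_cox:
  assumes "closed_subscheme K V I"
  shows "sections I d W \<subseteq> sections S d W"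
  using localize_cox[OF assms] by (auto simp: sections_def)

lemma homog_part_subspace:
  assumes "closed_subscheme K V I"
  shows "lsc.subspace (I \<inter> homog d)"
  unfolding lsc.subspace_def
proof (intro conjI ballI allI)
  show "0 \<in> I \<inter> homog d"
    using closed_subschemeD(2)[OF assms] by simp
  show "p + q \<in> I \<inter> homog d" if "p \<in> I \<inter> homog d" "q \<in> I \<inter> homog d" for p q
    using that closed_subschemeD(3)[OF assms] homog_add by blast
  show "lscale a p \<in> I \<inter> homog d" if "p \<in> I \<inter> homog d" for a p
    using that closed_subschemeD(4)[OF assms cox_ring_single_0, of p a] homog_lscale[of p d a]
    by (simp add: lscale_def)
qed

lemma homog_part_sections: "I \<inter> homog d \<subseteq> sections I d W"
  by (auto simp: sections_def intro: localize_base)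

lemma sections_diff:
  assumes "closed_subscheme K V I" "W \<subseteq> Sigma K V" "p \<in> sections I d W" "q \<in> sections I d W"
  shows "p - q \<in> sections I d W"
  using lsc.subspace_diff[OF sections_subspace[OF assms(1,2)] assms(3,4)] .

lemma cvars_Un_subset: "J \<in> charts K V \<Longrightarrow> J' \<in> charts K V \<Longrightarrow> cvars J \<union> cvars J' \<subseteq> Sigma K V"
  using cvars_subset by blast

lemma sections_Un:
  assumes "closed_subscheme K V I" "J \<in> charts K V" "J' \<in> charts K V"
  shows "sections I d (cvars J) \<subseteq> sections I d (cvars J \<union> cvars J')"
    "sections I d (cvars J') \<subseteq> sections I d (cvars J \<union> cvars J')"
  using sections_subset[OF assms(1) _ cvars_Un_subset[OF assms(2,3)]] by auto

lemma cech_C0_subspace: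
  assumes "closed_subscheme K V I"
  shows "fsc.subspace (cech_C0 K V I d)"
  using sections_subspace[OF assms cvars_subset, of _ d]
  unfolding fsc.subspace_def cech_C0_def lsc.subspace_def
  by (auto simp: fscale_def)

lemma cech_C1_subspace:
  assumes "closed_subscheme K V I"
  shows "fsc.subspace (cech_C1 K V I d)"
  using sections_subspace[OF assms cvars_Un_subset, of _ _ d]
  unfolding fsc.subspace_def cech_C1_def lsc.subspace_def
  by (auto simp: fscale_def)

lemma linear_cech_d0: "Vector_Spaces.linear fscale fscale (cech_d0 K V)"
  by (rule ff.linearI)
    (auto simp: cech_d0_def fscale_def fun_eq_iff lsc.scale_right_diff_distrib)

text \<open>The cochains representing sections of \<open>\<O>\<^sub>Z(d)\<close> for the scheme \<open>Z\<close> of the ideal \<open>I\<close>.\<close>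

definition cech_Z0 :: "('i, 'v) laurent set \<Rightarrow> ('i \<Rightarrow> int) \<Rightarrow> (('i \<Rightarrow> 'v) \<Rightarrow> ('i, 'v) laurent) set"
  where "cech_Z0 I d = {s \<in> cech_C0 K V S d. cech_d0 K V s \<in> cech_C1 K V I d}"

lemma degree_eq: "degree K V I = quot_dim fscale (cech_Z0 I 0) (cech_C0 K V I 0)"
  by (simp add: degree_def cech_Z0_def)

lemma cech_Z0_iff:
  "s \<in> cech_Z0 I d \<longleftrightarrow> s \<in> cech_C0 K V S d \<and>
    (\<forall>J\<in>charts K V. \<forall>J'\<in>charts K V. s J' - s J \<in> sections I d (cvars J \<union> cvars J'))"
  by (auto simp: cech_Z0_def cech_C1_def cech_d0_def)

lemma cech_Z0_subspace:
  assumes "closed_subscheme K V I"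
  shows "fsc.subspace (cech_Z0 I d)"
proof -
  have "cech_Z0 I d = cech_C0 K V S d \<inter> (cech_d0 K V -` cech_C1 K V I d)"
    by (auto simp: cech_Z0_def)
  moreover have "fsc.subspace (cech_d0 K V -` cech_C1 K V I d)"
    using ff.linear_subspace_vimage[OF linear_cech_d0 cech_C1_subspace[OF assms]] .
  ultimately show ?thesis
    using fsc.subspace_inter cech_C0_subspace[OF closed_subscheme_cox] by metis
qed

lemma cech_C0_subset_Z0:
  assumes "closed_subscheme K V I"
  shows "cech_C0 K V I d \<subseteq> cech_Z0 I d"
proof
  fix s assume s: "s \<in> cech_C0 K V I d"
  show "s \<in> cech_Z0 I d"
    unfolding cech_Z0_iff
  proof (intro conjI ballI)
    show "s \<in> cech_C0 K V S d"
      using s sections_cox[OF assms] unfolding cech_C0_def by blast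
    fix J J' assume J: "J \<in> charts K V" "J' \<in> charts K V"
    then show "s J' - s J \<in> sections I d (cvars J \<union> cvars J')"
      using s sections_Un[OF assms J, of d] unfolding cech_C0_def
      by (intro sections_diff[OF assms cvars_Un_subset]) blast+
  qed
qed

text \<open>The exact sequence 0 -> I_Z(d) -> O(d) -> O_Z(d) -> 0 in cochains: the coboundary of
  \<open>s\<close> is a cocycle of the ideal, hence the coboundary of some \<open>t\<close> in the
  ideal, and \<open>s - t\<close> glues to a section of O(d), which is a polynomial by
  \<open>global_section_cox\<close>.\<close>

lemma section_lifts:
  assumes I: "closed_subscheme K V I" and h1: "h1 K V I d = 0"
    and d: "\<And>i. i \<in> K \<Longrightarrow> 0 \<le> d i" and s: "s \<in> cech_Z0 I d"
  shows "\<exists>p\<in>S \<inter> homog d. \<forall>J\<in>charts K V. s J - p \<in> sections I d (cvars J)"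
proof -
  have "cech_Z1 K V I d \<subseteq> cech_d0 K V ` cech_C0 K V I d"
    using h1 ff.linear_subspace_image[OF linear_cech_d0 cech_C0_subspace[OF I]]
    unfolding h1_def by (rule fsc.quot_dim_eq_0D)
  moreover have "cech_d0 K V s \<in> cech_Z1 K V I d"
    using s by (auto simp: cech_Z1_def cech_Z0_def cech_d0_def)
  ultimately obtain t where t: "t \<in> cech_C0 K V I d" "cech_d0 K V s = cech_d0 K V t"
    by blast
  obtain J0 where J0: "J0 \<in> charts K V"
    using ex_chart by blast
  \<comment> \<open>Any chart would do, as \<open>s - t\<close> takes the same value on all of
    them.\<close>
  define p where "p = s J0 - t J0"
  have p: "s J - p = t J" if "J \<in> charts K V" for J
    using fun_cong[OF t(2), of "(J0, J)"] that J0 unfolding p_def cech_d0_def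
    by (simp add: algebra_simps)
  have pJ: "p \<in> sections S d (cvars J)" if J: "J \<in> charts K V" for J
  proof -
    have "p = s J - t J"
      using p[OF J] by (simp add: algebra_simps)
    moreover have "s J \<in> sections S d (cvars J)" "t J \<in> sections S d (cvars J)"
      using s t(1) J sections_cox[OF I, of d "cvars J"] unfolding cech_Z0_def cech_C0_def by blast+
    ultimately show ?thesis
      using sections_diff[OF closed_subscheme_cox cvars_subset[OF J]] by simp
  qed
  have "p \<in> homog d"
    using pJ[OF J0] by (simp add: sections_def)
  moreover from this have "p \<in> S"
    using pJ d by (intro global_section_cox) (auto simp: sections_def)
  moreover have "\<forall>J\<in>charts K V. s J - p \<in> sections I d (cvars J)"
    using p t(1) unfolding cech_C0_def by simp
  ultimately show ?thesis by blast
qed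

text \<open>Multiplication by \<open>L\<close> embeds the functions on the scheme into its sections
  of O(d), and by \<open>section_lifts\<close> all of those come from forms of degree
  \<open>d\<close>.\<close>

lemma degree_le_hilbert:
  assumes I: "closed_subscheme K V I" and h1: "h1 K V I d = 0"
    and d: "\<And>i. i \<in> K \<Longrightarrow> 0 \<le> d i"
    and L: "L \<in> S \<inter> homog d" "nonzerodivisor I L"
  shows "degree K V I \<le> quot_dim lscale (S \<inter> homog d) (I \<inter> homog d)"
proof -
  have LS: "L \<in> sections S d W" for W
    using L(1) homog_part_sections by blast
  have LI: "L * q \<in> sections I d W" if "q \<in> sections I 0 W" "W \<subseteq> Sigma K V" "closed_subscheme K V I" for q W I
    using sections_mult[OF that(3,2) LS that(1)] by simp
  have "degree K V I \<le> quot_dim fscale (cech_Z0 I d) (cech_C0 K V I d)"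
    unfolding degree_eq
  proof (rule ff.quot_dim_le_inj)
    show "Vector_Spaces.linear fscale fscale (\<lambda>s J. L * s J)"
      by (rule ff.linearI) (auto simp: fscale_def fun_eq_iff distrib_left lscale_mult_right)
    show "fsc.subspace (cech_Z0 I 0)" "fsc.subspace (cech_C0 K V I 0)" "fsc.subspace (cech_C0 K V I d)"
      using I by (rule cech_Z0_subspace cech_C0_subspace)+
    show "(\<lambda>s J. L * s J) ` cech_Z0 I 0 \<subseteq> cech_Z0 I d"
    proof
      fix t assume "t \<in> (\<lambda>s J. L * s J) ` cech_Z0 I 0"
      then obtain s where s: "s \<in> cech_Z0 I 0" "t = (\<lambda>J. L * s J)" by blast
      show "t \<in> cech_Z0 I d"
        unfolding cech_Z0_iff
      proof (intro conjI ballI)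
        show "t \<in> cech_C0 K V S d"
          using s LI[OF _ cvars_subset closed_subscheme_cox] by (auto simp: cech_Z0_iff cech_C0_def)
        fix J J' assume "J \<in> charts K V" "J' \<in> charts K V"
        then show "t J' - t J \<in> sections I d (cvars J \<union> cvars J')"
          using s LI[OF _ cvars_Un_subset I, of _ J J'] by (auto simp: cech_Z0_iff simp flip: right_diff_distrib)
      qed
    qed
    fix s assume s: "s \<in> cech_Z0 I 0" "(\<lambda>J. L * s J) \<in> cech_C0 K V I d"
    show "s \<in> cech_C0 K V I 0"
      unfolding cech_C0_def
    proof (intro CollectI conjI allI ballI impI)
      fix J
      show "s J = 0" if "J \<notin> charts K V"
        using s(1) that by (simp add: cech_Z0_def cech_C0_def)
      assume J: "J \<in> charts K V"
      then have "s J \<in> localize S (cvars J)" "s J \<in> homog 0" "L * s J \<in> localize I (cvars J)"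
        using s by (simp_all add: cech_Z0_def cech_C0_def sections_def)
      then show "s J \<in> sections I 0 (cvars J)"
        using localize_nonzerodivisor[OF I cvars_subset[OF J] L(2)] by (simp add: sections_def)
    qed
  qed
  also have "\<dots> \<le> quot_dim lscale (S \<inter> homog d) (I \<inter> homog d)"
  proof (rule lf.quot_dim_le_surj)
    let ?f = "\<lambda>p J. if J \<in> charts K V then p else 0"
    show "Vector_Spaces.linear lscale fscale ?f"
      by (rule lf.linearI) (auto simp: fscale_def fun_eq_iff)
    show "lsc.subspace (I \<inter> homog d)"
      using I by (rule homog_part_subspace)
    show "?f ` (I \<inter> homog d) \<subseteq> cech_C0 K V I d"
      by (auto simp: cech_C0_def intro!: subsetD[OF homog_part_sections])
    show "?f ` (S \<inter> homog d) \<subseteq> cech_Z0 I d"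
      using lsc.subspace_0[OF sections_subspace[OF I cvars_Un_subset]]
      by (auto simp: cech_Z0_iff cech_C0_def intro!: subsetD[OF homog_part_sections])
    fix s assume s: "s \<in> cech_Z0 I d"
    obtain p where p: "p \<in> S \<inter> homog d" "\<forall>J\<in>charts K V. s J - p \<in> sections I d (cvars J)"
      using section_lifts[OF I h1 d s] by blast
    have "s - ?f p \<in> cech_C0 K V I d"
      using p(2) s by (auto simp: cech_C0_def cech_Z0_def)
    then show "\<exists>p\<in>S \<inter> homog d. s - ?f p \<in> cech_C0 K V I d"
      using p(1) by blast
  qed
  finally show ?thesis .
qed

text \<open>On every chart \<open>L\<close> is a unit modulo \<open>I\<close>; dividing by it sends forms of degree \<open>d\<close> to functions
  on the scheme.\<close>

lemma hilbert_le_degree: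
  assumes I: "zero_dimensional K V I" and supp: "\<And>i. i \<notin> K \<Longrightarrow> d i = 0"
    and L: "L \<in> S \<inter> homog d" "nonzerodivisor I L"
  shows "quot_dim lscale (S \<inter> homog d) (I \<inter> homog d) \<le> degree K V I"
proof -
  have cs: "closed_subscheme K V I"
    using I by (simp add: zero_dimensional_def)
  let ?R = "\<lambda>J. sections S 0 (cvars J)" and ?I = "\<lambda>J. sections I 0 (cvars J)"
  let ?x = "\<lambda>J. lmonom (- xmon J d)"
  have xS: "?x J \<in> sections S (- d) (cvars J)" if "J \<in> charts K V" for J
    using xmon_localize[OF _ cvars_subset[OF that], of J "- d"] multideg_xmon[of d J] supp
    by (auto simp: sections_def xmon_uminus intro!: homog_lmonom simp: multideg_uminus)
  have xmult: "p * ?x J \<in> sections I 0 (cvars J)"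
    if "J \<in> charts K V" "p \<in> sections I d (cvars J)" "closed_subscheme K V I" for p J I
    using sections_mult[OF that(3) cvars_subset[OF that(1)] xS[OF that(1)] that(2)]
    by (simp add: mult.commute)
  have LS: "L \<in> sections S d W" for W
    using L(1) homog_part_sections by blast
  \<comment> \<open>Multiplication by the function \<open>L * ?x J\<close> is injective on the
    finite-dimensional ring of the chart modulo the ideal, hence surjective; hitting 1 produces its
    inverse \<open>w\<close>.\<close>
  have "\<exists>w\<in>?R J. 1 - L * ?x J * w \<in> ?I J" if J: "J \<in> charts K V" for J
  proof -
    obtain n where n: "quot_dim lscale (?R J) (?I J) = enat n"
      using I J unfolding zero_dimensional_def by fastforce
    have u: "L * ?x J \<in> ?R J"
      using xmult[OF J LS closed_subscheme_cox] .
    show ?thesis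
    proof (rule ll.surj_mod_if_inj_mod[where f = "\<lambda>w. L * ?x J * w" and n = n])
      show "Vector_Spaces.linear lscale lscale (\<lambda>w. L * ?x J * w)"
        by (rule ll.linearI) (auto simp: distrib_left lscale_mult_right)
      show "lsc.subspace (?R J)" "lsc.subspace (?I J)" "lsc.subspace (?I J)"
        by (intro sections_subspace cvars_subset J closed_subscheme_cox cs)+
      show "(\<lambda>w. L * ?x J * w) ` ?R J \<subseteq> ?R J"
        using sections_mult[OF closed_subscheme_cox cvars_subset[OF J] u] by fastforce
      show "1 \<in> ?R J"
        by (simp add: sections_def homog_one localize_base)
      show "enat n \<le> quot_dim lscale (?R J) (?I J)" "quot_dim lscale (?R J) (?I J) \<le> enat n"
        by (simp_all add: n)
      fix w assume w: "w \<in> ?R J" "L * ?x J * w \<in> ?I J"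
      have "lmonom (xmon J d) * (L * ?x J * w) \<in> localize I (cvars J)"
        using w xmon_localize[OF order_refl cvars_subset[OF J], of d]
          localize_mult[OF cs cvars_subset[OF J]] by (auto simp: sections_def)
      then have "L * w \<in> localize I (cvars J)"
        by (simp add: mult_ac)
      then show "w \<in> ?I J"
        using w localize_nonzerodivisor[OF cs cvars_subset[OF J] L(2)] by (auto simp: sections_def)
    qed
  qed
  then obtain w where w: "\<And>J. J \<in> charts K V \<Longrightarrow> w J \<in> ?R J"
    "\<And>J. J \<in> charts K V \<Longrightarrow> 1 - L * ?x J * w J \<in> ?I J"
    by metis
  \<comment> \<open>On each chart this is the quotient p / L, since \<open>?x J * w J\<close> is an
    inverse of \<open>L\<close> modulo the ideal.\<close>
  let ?f = "\<lambda>p J. if J \<in> charts K V then p * ?x J * w J else 0"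
  show ?thesis
    unfolding degree_eq
  proof (rule lf.quot_dim_le_inj)
    show "Vector_Spaces.linear lscale fscale ?f"
      by (rule lf.linearI) (auto simp: fscale_def fun_eq_iff distrib_right lscale_mult_left)
    show "lsc.subspace (S \<inter> homog d)" "lsc.subspace (I \<inter> homog d)" "fsc.subspace (cech_C0 K V I 0)"
      by (intro homog_part_subspace cech_C0_subspace closed_subscheme_cox cs)+
    have fR: "p * ?x J * w J \<in> ?R J" if "p \<in> S \<inter> homog d" "J \<in> charts K V" for p J
    proof -
      have "p * ?x J \<in> ?R J"
        using xmult[OF that(2) _ closed_subscheme_cox] homog_part_sections that(1) by blast
      then show ?thesis
        using sections_mult[OF closed_subscheme_cox cvars_subset[OF that(2)] _ w(1)[OF that(2)]] by fastforce
    qed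
    have fI: "p - L * (p * ?x J * w J) \<in> localize I (cvars J)"
      if p: "p \<in> S \<inter> homog d" and J: "J \<in> charts K V" for p J
    proof -
      have "p * (1 - L * ?x J * w J) \<in> localize I (cvars J)"
        using p w(2)[OF J] localize_mult[OF cs cvars_subset[OF J] localize_base]
        by (auto simp: sections_def)
      then show ?thesis
        by (simp add: algebra_simps)
    qed
    show "?f ` (S \<inter> homog d) \<subseteq> cech_Z0 I 0"
    proof
      fix s assume "s \<in> ?f ` (S \<inter> homog d)"
      then obtain p where p: "p \<in> S \<inter> homog d" "s = ?f p" by blast
      show "s \<in> cech_Z0 I 0"
        unfolding cech_Z0_iff
      proof (intro conjI ballI)
        show "s \<in> cech_C0 K V S 0"
          using fR[OF p(1)] by (simp add: p(2) cech_C0_def)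
        fix J J' assume J: "J \<in> charts K V" "J' \<in> charts K V"
        note sub = cvars_Un_subset[OF J]
        have "?f p J \<in> sections S 0 (cvars J)" "?f p J' \<in> sections S 0 (cvars J')"
          using fR[OF p(1)] J by simp_all
        then have *: "s J' - s J \<in> sections S 0 (cvars J \<union> cvars J')"
          unfolding p(2) using sections_Un[OF closed_subscheme_cox J]
          by (intro sections_diff[OF closed_subscheme_cox sub]) blast+
        \<comment> \<open>On the overlap both local quotients times \<open>L\<close> equal
          \<open>p\<close> modulo the ideal, so they agree once \<open>L\<close> is
          cancelled.\<close>
        have "(p - L * s J) - (p - L * s J') \<in> localize I (cvars J \<union> cvars J')"
        proof (rule localize_diff[OF cs sub])
          show "p - L * s J \<in> localize I (cvars J \<union> cvars J')"
            using fI[OF p(1) J(1)] J(1) localize_subset[OF cs _ sub, of "cvars J"] by (auto simp: p(2))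
          show "p - L * s J' \<in> localize I (cvars J \<union> cvars J')"
            using fI[OF p(1) J(2)] J(2) localize_subset[OF cs _ sub, of "cvars J'"] by (auto simp: p(2))
        qed
        then have "L * (s J' - s J) \<in> localize I (cvars J \<union> cvars J')"
          by (simp add: algebra_simps)
        then show "s J' - s J \<in> sections I 0 (cvars J \<union> cvars J')"
          using * localize_nonzerodivisor[OF cs sub L(2)] by (auto simp: sections_def)
      qed
    qed
    fix p assume p: "p \<in> S \<inter> homog d" "?f p \<in> cech_C0 K V I 0"
    have "p \<in> I"
    proof (rule closed_subschemeD(6)[OF cs])
      show "p \<in> S"
        using p(1) by blast
      fix J assume J: "J \<in> charts K V"
      then have "p * ?x J * w J \<in> localize I (cvars J)"
        using p(2) unfolding cech_C0_def sections_def by fastforce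
      then have "L * (p * ?x J * w J) \<in> localize I (cvars J)"
        using L(1) localize_mult[OF cs cvars_subset[OF J] localize_base] by auto
      then have "(p - L * (p * ?x J * w J)) + L * (p * ?x J * w J) \<in> localize I (cvars J)"
        by (intro localize_add[OF cs cvars_subset[OF J]] fI[OF p(1) J])
      then show "p \<in> localize I (cvars J)"
        by simp
    qed
    then show "p \<in> I \<inter> homog d"
      using p(1) by blast
  qed
qed

end

section \<open>Generic linear forms\<close>

definition eval_poly :: "('i, 'v) laurent \<Rightarrow> complex poly \<Rightarrow> ('i, 'v) laurent"
  where "eval_poly y p = fold_coeffs (\<lambda>a b. single 0 a + y * b) p 0"

lemma eval_poly_pCons: "eval_poly y (pCons a p) = single 0 a + y * eval_poly y p"
  by (cases "p = 0 \<and> a = 0") (auto simp: eval_poly_def fold_coeffs_pCons_not_0_0_eq)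

lemma eval_poly_0 [simp]: "eval_poly y 0 = 0"
  by (simp add: eval_poly_def)

lemma eval_poly_add: "eval_poly y (p + q) = eval_poly y p + eval_poly y q"
  by (induction p q rule: poly_induct2) (auto simp: eval_poly_pCons single_add algebra_simps)

lemma eval_poly_smult: "eval_poly y (smult c p) = lscale c (eval_poly y p)"
  by (induction p) (auto simp: eval_poly_pCons lscale_def mult_single algebra_simps)

lemma eval_poly_sum: "eval_poly y (sum f A) = (\<Sum>x\<in>A. eval_poly y (f x))"
  by (induction A rule: infinite_finite_induct) (auto simp: eval_poly_add)

lemma eval_poly_monom: "eval_poly y (monom c n) = lscale c (y ^ n)"
  by (induction n) (auto simp: monom_0 monom_Suc eval_poly_pCons lscale_def mult_ac)

lemma eval_poly_linear_mult: "eval_poly y ([:- a, 1:] * p) = (y - single 0 a) * eval_poly y p"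
proof -
  have "[:- a, 1:] * p = smult (- a) p + pCons 0 p"
    by simp
  then show ?thesis
    by (simp only: eval_poly_add eval_poly_smult eval_poly_pCons)
      (simp add: lscale_def single_uminus algebra_simps)
qed

lemma eval_poly_linear_factors:
  "eval_poly y (\<Prod>i<n. [:- rt i, 1:]) = (\<Prod>i<(n::nat). y - single 0 (rt i))"
proof (induction n)
  case 0
  then show ?case
    by (simp add: one_pCons eval_poly_pCons)
next
  case (Suc n)
  then show ?case
    using eval_poly_linear_mult[of y "rt n" "\<Prod>i<n. [:- rt i, 1:]"]
    by (simp only: prod.lessThan_Suc mult.commute)
qed

text \<open>The fundamental theorem of algebra: the annihilating polynomial splits into linear
  factors, and its leading coefficient can be divided out because \<open>U\<close> is a
  subspace.\<close>

lemma ex_split_relation: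
  assumes U: "lsc.subspace U" and c: "(\<Sum>j\<le>n. lscale (c j) (y ^ j)) \<in> U" "c (n::nat) \<noteq> 0"
  shows "\<exists>(m::nat) rt. (\<Prod>i<m. y - single 0 (rt i)) \<in> U"
proof -
  define q where "q = (\<Sum>j\<le>n. monom (c j) j)"
  have "coeff q n = c n"
    by (simp add: q_def coeff_sum sum.delta)
  then have lc: "lead_coeff q \<noteq> 0"
    using c(2) by auto
  obtain rt where rt: "smult (lead_coeff q) (\<Prod>i<Polynomial.degree q. [:- rt i, 1:]) = q"
    by (rule complex_poly_decompose')
  have "eval_poly y q = (\<Sum>j\<le>n. lscale (c j) (y ^ j))"
    by (simp add: q_def eval_poly_sum eval_poly_monom)
  then have "lscale (inverse (lead_coeff q)) (eval_poly y q) \<in> U"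
    using c(1) U by (metis lsc.subspace_scale)
  moreover have "eval_poly y q = lscale (lead_coeff q) (\<Prod>i<Polynomial.degree q. y - single 0 (rt i))"
    by (metis rt eval_poly_smult eval_poly_linear_factors)
  ultimately have "(\<Prod>i<Polynomial.degree q. y - single 0 (rt i)) \<in> U"
    using lc by simp
  then show ?thesis by blast
qed

text \<open>\<open>R\<close> stands for the coordinate ring of a chart and \<open>U\<close> for the
  ideal of a scheme in it. Elements of \<open>R\<close> outside \<open>U\<close> are the non-zero
  vectors of the quotient ring, on which functions act by multiplication.\<close>

locale laurent_subalgebra_ideal =
  fixes R U :: "('i, 'v) laurent set"
  assumes single_0: "single 0 a \<in> R"
    and R_mult: "p \<in> R \<Longrightarrow> q \<in> R \<Longrightarrow> p * q \<in> R"
    and R_diff: "p \<in> R \<Longrightarrow> q \<in> R \<Longrightarrow> p - q \<in> R"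
    and U_add: "p \<in> U \<Longrightarrow> q \<in> U \<Longrightarrow> p + q \<in> U"
    and U_0: "0 \<in> U"
    and U_mult: "p \<in> R \<Longrightarrow> q \<in> U \<Longrightarrow> p * q \<in> U"
begin

lemma U_lscale: "q \<in> U \<Longrightarrow> lscale a q \<in> U"
  unfolding lscale_def by (intro U_mult single_0)

lemma U_sum: "(\<And>x. x \<in> A \<Longrightarrow> f x \<in> U) \<Longrightarrow> sum f A \<in> U"
  by (induction A rule: infinite_finite_induct) (auto simp: U_0 U_add)

text \<open>Apply the linear factors to \<open>w\<close> one at a time. The whole product leads into
  \<open>U\<close> while \<open>w\<close> is outside, so some factor is the first to do so; the
  vector just before it is an eigenvector and a multiple of \<open>w\<close>.\<close>

lemma ex_eigenvector:
  assumes y: "y \<in> R" and w: "w \<in> R" "w \<notin> U"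
    and "(\<Prod>i<(m::nat). y - single 0 (rt i)) * w \<in> U"
  shows "\<exists>r\<in>R. \<exists>i<m. r * w \<notin> U \<and> (y - single 0 (rt i)) * (r * w) \<in> U"
  using w(1) w(2) assms(4)
proof (induction m arbitrary: w)
  case 0
  then show ?case by simp
next
  case (Suc m)
  let ?z = "y - single 0 (rt m)"
  have z: "?z \<in> R"
    by (intro R_diff y single_0)
  show ?case
  proof (cases "?z * w \<in> U")
    case True
    then show ?thesis
      using Suc.prems single_0[of 1] by (intro bexI[of _ 1] exI[of _ m]) auto
  next
    case False
    have "(\<Prod>i<m. y - single 0 (rt i)) * (?z * w) \<in> U"
      using Suc.prems(3) by (simp add: mult_ac)
    then obtain r i where r: "r \<in> R" "i < m" "r * (?z * w) \<notin> U"
      "(y - single 0 (rt i)) * (r * (?z * w)) \<in> U"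
      using Suc.IH[OF R_mult[OF z Suc.prems(1)] False] by blast
    then show ?thesis
      by (intro bexI[of _ "r * ?z"] exI[of _ i])
        (auto simp: mult.assoc intro!: R_mult z)
  qed
qed

text \<open>Passing from \<open>r * w\<close> to a multiple of it keeps the eigenvalues found so
  far, because \<open>U\<close> is an ideal and multiplication commutes.\<close>

lemma ex_common_eigenvector:
  assumes "finite X" and y: "\<And>v. v \<in> X \<Longrightarrow> y v \<in> R"
    and rel: "\<And>v. v \<in> X \<Longrightarrow> (\<Prod>i<(m v::nat). y v - single 0 (rt v i)) \<in> U"
    and w: "w \<in> R" "w \<notin> U"
  shows "\<exists>r\<in>R. r * w \<notin> U \<and>
    (\<forall>v\<in>X. \<exists>i<m v. (y v - single 0 (rt v i)) * (r * w) \<in> U)"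
  using assms(1) y rel
proof (induction X)
  case empty
  then show ?case
    using w single_0[of 1] by (intro bexI[of _ 1]) auto
next
  case (insert v X)
  then obtain r where r: "r \<in> R" "r * w \<notin> U"
    "\<forall>v\<in>X. \<exists>i<m v. (y v - single 0 (rt v i)) * (r * w) \<in> U"
    by auto
  have rw: "r * w \<in> R"
    using r(1) w(1) by (rule R_mult)
  have "(\<Prod>i<m v. y v - single 0 (rt v i)) * (r * w) \<in> U"
    using U_mult[OF rw insert.prems(2)[of v]] by (simp add: mult.commute)
  then obtain r' i where r': "r' \<in> R" "i < m v" "r' * (r * w) \<notin> U"
    "(y v - single 0 (rt v i)) * (r' * (r * w)) \<in> U"
    using ex_eigenvector[where y = "y v", OF _ rw r(2)] insert.prems(1) by blast
  have "\<exists>i<m u. (y u - single 0 (rt u i)) * (r' * r * w) \<in> U" if "u \<in> insert v X" for u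
  proof (cases "u = v")
    case True
    then show ?thesis
      using r'(2,4) by (auto simp only: mult.assoc)
  next
    case False
    then have "u \<in> X"
      using that by simp
    from bspec[OF r(3) this] obtain j
      where "j < m u" "(y u - single 0 (rt u j)) * (r * w) \<in> U"
      by (elim exE conjE)
    moreover from this have "(y u - single 0 (rt u j)) * (r' * r * w) \<in> U"
      using U_mult[OF r'(1), of "(y u - single 0 (rt u j)) * (r * w)"]
      by (simp only: mult.left_commute mult.assoc)
    ultimately show ?thesis
      by blast
  qed
  then show ?case
    using r' r(1) by (intro bexI[of _ "r' * r"]) (auto simp: mult.assoc intro: R_mult)
qed

text \<open>On a common eigenvector modulo \<open>U\<close> the combination acts as a scalar, which is a non-zero
  polynomial in \<open>t\<close> because the element \<open>1\<close> has eigenvalue \<open>1\<close>.\<close>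

lemma finite_zero_divisor_parameters:
  assumes X: "finite X" and y: "\<And>v. v \<in> X \<Longrightarrow> y v \<in> R"
    and rel: "\<And>v. v \<in> X \<Longrightarrow> (\<Prod>i<(m v::nat). y v - single 0 (rt v i)) \<in> U"
    and e: "inj_on e X" and u: "u \<in> X" "y u = 1"
  shows "finite {t. \<exists>w\<in>R. w \<notin> U \<and> (\<Sum>v\<in>X. lscale (t ^ e v) (y v)) * w \<in> U}"
proof -
  \<comment> \<open>All candidate systems of eigenvalues, finitely many. As \<open>e\<close> is
    injective, the normalization at \<open>u\<close> gives \<open>q a\<close> the coefficient 1 at
    \<open>e u\<close>.\<close>
  define A where "A = {a \<in> (\<Pi>\<^sub>E v\<in>X. rt v ` {..<m v}). a u = 1}"
  define q where "q a = (\<Sum>v\<in>X. monom (a v :: complex) (e v))" for a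
  have "finite A"
    unfolding A_def by (rule finite_subset[of _ "\<Pi>\<^sub>E v\<in>X. rt v ` {..<m v}"]) (use X in \<open>auto intro!: finite_PiE\<close>)
  have q: "q a \<noteq> 0" if "a \<in> A" for a
  proof -
    have "coeff (q a) (e u) = (\<Sum>v\<in>X. if v = u then a v else 0)"
      unfolding q_def coeff_sum using e u(1) by (intro sum.cong) (auto simp: inj_on_def)
    also have "\<dots> = 1"
      using that u(1) X by (simp add: A_def sum.delta)
    finally show ?thesis by auto
  qed
  have "t \<in> (\<Union>a\<in>A. {t. poly (q a) t = 0})"
    if w: "w \<in> R" "w \<notin> U" "(\<Sum>v\<in>X. lscale (t ^ e v) (y v)) * w \<in> U" for t w
  proof -
    obtain r where r: "r \<in> R" "r * w \<notin> U"
      "\<forall>v\<in>X. \<exists>i<m v. (y v - single 0 (rt v i)) * (r * w) \<in> U"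
      using ex_common_eigenvector[where y = y and m = m and rt = rt, OF X y rel w(1,2)] by blast
    define w' where "w' = r * w"
    have w': "w' \<notin> U"
      using r by (simp add: w'_def)
    have "\<forall>v\<in>X. \<exists>b\<in>rt v ` {..<m v}. y v * w' - lscale b w' \<in> U"
    proof
      fix v assume "v \<in> X"
      then obtain i where "i < m v" "(y v - single 0 (rt v i)) * w' \<in> U"
        using r(3) w'_def by auto
      then show "\<exists>b\<in>rt v ` {..<m v}. y v * w' - lscale b w' \<in> U"
        by (intro bexI[of _ "rt v i"]) (auto simp: lscale_def algebra_simps)
    qed
    then obtain b where b: "\<And>v. v \<in> X \<Longrightarrow> b v \<in> rt v ` {..<m v}"
      "\<And>v. v \<in> X \<Longrightarrow> y v * w' - lscale (b v) w' \<in> U"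
      by metis
    define a where "a = restrict b X"
    have eig: "y v * w' - lscale (a v) w' \<in> U" if "v \<in> X" for v
      using b(2) that by (simp add: a_def)
    have scalar: "c = 0" if "lscale c w' \<in> U" for c
      using U_lscale[OF that, of "inverse c"] w' by (cases "c = 0") auto
    have "lscale (1 - a u) w' \<in> U"
      using eig[OF u(1)] u(2) by (simp add: lsc.scale_left_diff_distrib)
    then have "a u = 1"
      using scalar by fastforce
    then have "a \<in> A"
      using b(1) by (auto simp: A_def a_def)
    have "(\<Sum>v\<in>X. lscale (t ^ e v) (y v)) * w' \<in> U"
      using U_mult[OF r(1) w(3)] by (simp add: w'_def mult_ac)
    moreover have "(\<Sum>v\<in>X. lscale (- (t ^ e v)) (y v * w' - lscale (a v) w')) \<in> U"
      using eig by (intro U_sum U_lscale)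
    \<comment> \<open>Subtracting the eigenvalue relations, weighted by the powers of
      \<open>t\<close>, leaves a scalar multiple of \<open>w'\<close> in \<open>U\<close>, so the
      scalar is 0.\<close>
    ultimately have "(\<Sum>v\<in>X. lscale (t ^ e v) (y v)) * w'
      + (\<Sum>v\<in>X. lscale (- (t ^ e v)) (y v * w' - lscale (a v) w')) \<in> U"
      by (rule U_add)
    also have "(\<Sum>v\<in>X. lscale (t ^ e v) (y v)) * w'
      + (\<Sum>v\<in>X. lscale (- (t ^ e v)) (y v * w' - lscale (a v) w'))
      = (\<Sum>v\<in>X. lscale (a v * t ^ e v) w')"
      by (simp add: sum_distrib_right sum_distrib_left lscale_mult_left lscale_mult_right
          lsc.scale_right_diff_distrib mult.commute sum_subtractf)
    also have "\<dots> = lscale (poly (q a) t) w'"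
      by (simp add: q_def poly_sum poly_monom lsc.scale_sum_left)
    finally have "poly (q a) t = 0"
      by (rule scalar)
    then show ?thesis
      using \<open>a \<in> A\<close> by blast
  qed
  then have "{t. \<exists>w\<in>R. w \<notin> U \<and> (\<Sum>v\<in>X. lscale (t ^ e v) (y v)) * w \<in> U}
    \<subseteq> (\<Union>a\<in>A. {t. poly (q a) t = 0})"
    by blast
  moreover have "finite (\<Union>a\<in>A. {t. poly (q a) t = 0})"
    using \<open>finite A\<close> q by (intro finite_UN_I poly_roots_finite)
  ultimately show ?thesis
    by (rule finite_subset)
qed

end

context projective_product
begin

lemma multideg_supp:
  assumes "keys m \<subseteq> Sigma K V" "i \<notin> K"
  shows "multideg m i = 0"
  unfolding multideg_def by (rule sum.neutral) (use assms in auto)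

lemma sections_0_subalgebra_ideal:
  assumes "closed_subscheme K V I" "W \<subseteq> Sigma K V"
  shows "laurent_subalgebra_ideal (sections S 0 W) (sections I 0 W)"
proof
  note R = sections_subspace[OF closed_subscheme_cox assms(2), of 0]
  note U = sections_subspace[OF assms, of 0]
  show "single 0 a \<in> sections S 0 W" for a
    by (auto simp: sections_def cox_ring_single_0 intro!: localize_base homog_single)
  show "p * q \<in> sections S 0 W" if "p \<in> sections S 0 W" "q \<in> sections S 0 W" for p q
    using sections_mult[OF closed_subscheme_cox assms(2) that] by simp
  show "p - q \<in> sections S 0 W" if "p \<in> sections S 0 W" "q \<in> sections S 0 W" for p q
    using lsc.subspace_diff[OF R that] .
  show "p + q \<in> sections I 0 W" if "p \<in> sections I 0 W" "q \<in> sections I 0 W" for p q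
    using lsc.subspace_add[OF U that] .
  show "0 \<in> sections I 0 W"
    using lsc.subspace_0[OF U] .
  show "p * q \<in> sections I 0 W" if "p \<in> sections S 0 W" "q \<in> sections I 0 W" for p q
    using sections_mult[OF assms that] by simp
qed

abbreviation unit_deg :: "'i \<Rightarrow> int"
  where "unit_deg \<equiv> deg_of K"

lemma multideg_xmon_unit: "multideg (xmon J unit_deg) = unit_deg"
  by (rule multideg_xmon) (simp add: deg_of_def)

lemma xmon_unit_cox:
  assumes "J \<in> charts K V"
  shows "lmonom (xmon J unit_deg) \<in> S"
proof (rule cox_ring_lmonom)
  show "keys (xmon J unit_deg) \<subseteq> Sigma K V"
    using keys_xmon cvars_subset[OF assms] by (rule subset_trans)
  show "0 \<le> lookup (xmon J unit_deg) x" for x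
    by (auto simp: xmon_def lookup_sum lookup_single when_def deg_of_def intro!: sum_nonneg)
qed

text \<open>A combination of the generators of the irrelevant ideal, that is, a general section of
  O(1,...,1). In a single projective space it is a general linear form.\<close>

definition chart_form :: "(('i \<Rightarrow> 'v) \<Rightarrow> complex) \<Rightarrow> ('i, 'v) laurent"
  where "chart_form a = (\<Sum>J\<in>charts K V. lscale (a J) (lmonom (xmon J unit_deg)))"

lemma chart_form_cox: "chart_form a \<in> S \<inter> homog unit_deg"
  unfolding chart_form_def
  by (intro IntI cox_ring_sum homog_sum cox_ring_lscale homog_lscale xmon_unit_cox homog_lmonom multideg_xmon_unit)

text \<open>On each of the finitely many charts only finitely many \<open>t\<close> make the form a
  zero divisor. The conclusion passes from functions on charts to homogeneous elements by dividing
  by monomials, and to all elements by taking components.\<close>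

theorem ex_generic_chart_form:
  assumes I: "zero_dimensional K V I" and e: "inj_on e (charts K V)"
  shows "\<exists>t. nonzerodivisor I (chart_form (\<lambda>J. t ^ e J))"
proof -
  have cs: "closed_subscheme K V I"
    using I by (simp add: zero_dimensional_def)
  let ?R = "\<lambda>J. sections S 0 (cvars J)" and ?I = "\<lambda>J. sections I 0 (cvars J)"
  \<comment> \<open>The monomial of \<open>J'\<close> as a function on the chart \<open>J\<close>.
    Since \<open>y J J = 1\<close>, the chart itself supplies the element whose eigenvalue is
    1.\<close>
  define y where "y J J' = lmonom (xmon J' unit_deg) * lmonom (- xmon J unit_deg)" for J J'
  define Z where "Z J = {t. \<exists>w\<in>?R J. w \<notin> ?I J \<and>
    (\<Sum>J'\<in>charts K V. lscale (t ^ e J') (y J J')) * w \<in> ?I J}" for J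
  have yR: "y J J' \<in> ?R J" if "J \<in> charts K V" "J' \<in> charts K V" for J J'
  proof -
    have "lmonom (xmon J' unit_deg) \<in> sections S unit_deg (cvars J)"
      using xmon_unit_cox[OF that(2)] homog_lmonom[OF multideg_xmon_unit]
      by (simp add: sections_def localize_base)
    moreover have "lmonom (- xmon J unit_deg) \<in> sections S (- unit_deg) (cvars J)"
      using xmon_localize[OF order_refl cvars_subset[OF that(1)], of "- unit_deg"] multideg_xmon_unit
      by (auto simp: sections_def xmon_uminus multideg_uminus intro!: homog_lmonom)
    ultimately show ?thesis
      using sections_mult[OF closed_subscheme_cox cvars_subset[OF that(1)]] unfolding y_def by fastforce
  qed
  have "finite (Z J)" if J: "J \<in> charts K V" for J
  proof -
    interpret laurent_subalgebra_ideal "?R J" "?I J"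
      using cs cvars_subset[OF J] by (rule sections_0_subalgebra_ideal)
    have pow: "y J J' ^ j \<in> ?R J" if "J' \<in> charts K V" for J' j
      using yR[OF J that] single_0[of 1] by (induction j) (auto intro: R_mult)
    have "\<exists>(m::nat) rt. (\<Prod>i<m. y J J' - single 0 (rt i)) \<in> ?I J"
      if J': "J' \<in> charts K V" for J'
    proof -
      have "quot_dim lscale (?R J) (?I J) \<noteq> \<infinity>"
        using I J unfolding zero_dimensional_def by fastforce
      then obtain n c where "(\<Sum>j\<le>n. lscale (c j) (y J J' ^ j)) \<in> ?I J" "c n \<noteq> 0"
        using lsc.poly_in_subspace[where y = "\<lambda>j. y J J' ^ j", OF sections_subspace[OF cs cvars_subset[OF J]] _ pow[OF J']]
        by blast
      then show ?thesis
        using ex_split_relation[OF sections_subspace[OF cs cvars_subset[OF J]]] by blast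
    qed
    then obtain m rt where
      "\<And>J'. J' \<in> charts K V \<Longrightarrow> (\<Prod>i<m J'::nat. y J J' - single 0 (rt J' i)) \<in> ?I J"
      by metis
    then show ?thesis
      unfolding Z_def
      by (intro finite_zero_divisor_parameters[where m = m and rt = rt and u = J]
          finite_charts yR[OF J] e J) (auto simp: y_def)
  qed
  then have "finite (\<Union>J\<in>charts K V. Z J)"
    using finite_charts by blast
  then obtain t where t: "t \<notin> (\<Union>J\<in>charts K V. Z J)"
    using infinite_UNIV_char_0 ex_new_if_finite by blast
  let ?L = "chart_form (\<lambda>J. t ^ e J)"
  have L: "(\<Sum>J'\<in>charts K V. lscale (t ^ e J') (y J J')) = ?L * lmonom (- xmon J unit_deg)" for J
    by (simp add: chart_form_def y_def sum_distrib_right lscale_mult_left)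
  have hom: "p \<in> I" if p: "p \<in> S" "p \<in> homog d" "?L * p \<in> I" for p d
  proof (cases "p = 0")
    case True
    then show ?thesis
      using closed_subschemeD(2)[OF cs] by simp
  next
    case False
    \<comment> \<open>A non-zero form has its multidegree \<open>d\<close> supported on
      \<open>K\<close>, so each chart has a Laurent monomial of multidegree \<open>d\<close> to
      divide by.\<close>
    then obtain m where "m \<in> keys p"
      by (metis ex_in_conv keys_eq_empty)
    then have d: "d i = 0" if "i \<notin> K" for i
      using p(2) multideg_supp[OF cox_ringD(1)[OF p(1)] that] by (auto simp: homog_def)
    show ?thesis
    proof (rule closed_subschemeD(6)[OF cs p(1)])
      fix J assume J: "J \<in> charts K V"
      let ?x = "lmonom (- xmon J d)" and ?u = "lmonom (- xmon J unit_deg)"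
      have x: "?x \<in> localize S (cvars J)" "?x \<in> homog (- d)"
        "?u \<in> localize S (cvars J)" "?u \<in> homog (- unit_deg)"
        using xmon_localize[OF order_refl cvars_subset[OF J], of "- d"] multideg_xmon[OF d]
          xmon_localize[OF order_refl cvars_subset[OF J], of "- unit_deg"] multideg_xmon_unit
        by (auto simp: xmon_uminus multideg_uminus intro!: homog_lmonom)
      note loc = localize_mult[OF _ cvars_subset[OF J]]
      have "?x * p \<in> localize S (cvars J)"
        using loc[OF closed_subscheme_cox x(1) localize_base[OF p(1)]] .
      moreover have hom: "?x * p \<in> homog 0"
        using homog_mult[OF x(2) p(2)] by simp
      ultimately have R: "?x * p \<in> ?R J"
        by (simp add: sections_def)
      have "?u * (?x * (?L * p)) \<in> localize I (cvars J)"
        using loc[OF cs x(3) loc[OF cs x(1) localize_base[OF p(3)]]] .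
      moreover have "?u * (?x * (?L * p)) \<in> homog 0"
      proof -
        have "?u * ?L \<in> homog (- unit_deg + unit_deg)"
          using x(4) chart_form_cox by (intro homog_mult) auto
        then have "(?u * ?L) * (?x * p) \<in> homog (0 + 0)"
          using hom by (intro homog_mult) auto
        then show ?thesis
          by (simp add: mult_ac)
      qed
      ultimately have "(\<Sum>J'\<in>charts K V. lscale (t ^ e J') (y J J')) * (?x * p) \<in> ?I J"
        unfolding L by (simp add: sections_def mult_ac)
      then have "?x * p \<in> ?I J"
        using t J R unfolding Z_def by blast
      then have "?x * p \<in> localize I (cvars J)"
        by (simp add: sections_def)
      then have "lmonom (xmon J d) * (?x * p) \<in> localize I (cvars J)"
        by (rule loc[OF cs xmon_localize[OF order_refl cvars_subset[OF J]]])
      then show "p \<in> localize I (cvars J)"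
        by (simp only: lmonom_cancel)
    qed
  qed
  have "p \<in> I" if p: "p \<in> S" "?L * p \<in> I" for p
  proof -
    have "component d p \<in> I" for d
    proof (rule hom[OF cox_ring_component[OF p(1)] component_homog])
      have "component (d + unit_deg) (?L * p) \<in> I"
        using closed_subschemeD(5)[OF cs p(2)] .
      then show "?L * component d p \<in> I"
        using component_mult_homog chart_form_cox by (metis IntD2)
    qed
    then have "(\<Sum>d\<in>D. component d p) \<in> I" for D
      by (induction D rule: infinite_finite_induct) (simp_all add: closed_subschemeD(2,3)[OF cs])
    then show ?thesis
      using sum_component[of p] by metis
  qed
  then show ?thesis
    unfolding nonzerodivisor_def by blast
qed

end

section \<open>The Segre embedding\<close>

lemma segre_expo_add: "segre_expo K (m + n) = segre_expo K m + segre_expo K n"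
  unfolding segre_expo_def
  by (rule setsum_keys_plus_distrib) (simp_all add: single_add sum.distrib)

lemma segre_expo_0 [simp]: "segre_expo K 0 = 0"
  by (simp add: segre_expo_def)

lemma segre_expo_sum: "segre_expo K (sum f A) = (\<Sum>x\<in>A. segre_expo K (f x))"
  by (induction A rule: infinite_finite_induct) (auto simp: segre_expo_add)

lemma segre_expo_frag_cmul: "segre_expo K (frag_cmul (int N) m) = frag_cmul (int N) (segre_expo K m)"
  by (induction N) (auto simp: frag_cmul_distrib segre_expo_add)

lemma segre_expo_single:
  "segre_expo K (single x c) = (\<Sum>i\<in>K. single (i, snd x i) c)"
  by (simp add: segre_expo_def)

lemma segre_pullback_0 [simp]: "segre_pullback K 0 = 0"
  by (simp add: segre_pullback_def)

lemma segre_pullback_add: "segre_pullback K (p + q) = segre_pullback K p + segre_pullback K q"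
  unfolding segre_pullback_def
  by (rule setsum_keys_plus_distrib) (simp_all add: single_add)

lemma segre_pullback_single:
  "segre_pullback K (single m c) = single (segre_expo K m) c"
  by (simp add: segre_pullback_def)

lemma segre_pullback_lmonom: "segre_pullback K (lmonom m) = lmonom (segre_expo K m)"
  by (simp add: lmonom_def segre_pullback_single)

lemma segre_pullback_mult: "segre_pullback K (p * q) = segre_pullback K p * segre_pullback K q"
proof (induction p rule: poly_mapping_single_induct)
  case (single m c)
  show ?case
    by (induction q rule: poly_mapping_single_induct)
      (auto simp: segre_pullback_single mult_single segre_expo_add segre_pullback_add algebra_simps)
qed (auto simp: segre_pullback_add algebra_simps)

lemma segre_pullback_lscale: "segre_pullback K (lscale a p) = lscale a (segre_pullback K p)"
  by (simp add: lscale_def segre_pullback_mult segre_pullback_single)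

lemma segre_pullback_diff: "segre_pullback K (p - q) = segre_pullback K p - segre_pullback K q"
  by (metis add_diff_cancel_right' diff_add_cancel segre_pullback_add)

lemma segre_pullback_sum: "segre_pullback K (sum f A) = (\<Sum>x\<in>A. segre_pullback K (f x))"
  by (induction A rule: infinite_finite_induct) (auto simp: segre_pullback_add)

definition diag_deg :: "'i set \<Rightarrow> int \<Rightarrow> 'i \<Rightarrow> int"
  where "diag_deg K e = (\<lambda>i. if i \<in> K then e else 0)"

lemma multideg_segre_expo:
  assumes "finite K"
  shows "multideg (segre_expo K m) = diag_deg K (multideg m ())"
proof
  fix i
  have "multideg (segre_expo K m) i
    = (\<Sum>x\<in>keys m. \<Sum>j\<in>K. if j = i then lookup m x else 0)"
    by (simp add: segre_expo_def multideg_sum_apply multideg_single)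
  also have "\<dots> = diag_deg K (multideg m ()) i"
    using assms by (simp add: sum.delta diag_deg_def multideg_def)
  finally show "multideg (segre_expo K m) i = diag_deg K (multideg m ()) i" .
qed

lemma segre_pullback_homog:
  assumes "finite K" "p \<in> homog d"
  shows "segre_pullback K p \<in> homog (diag_deg K (d ()))"
proof -
  have "single (segre_expo K m) c \<in> homog (diag_deg K (d ()))"
    if "m \<in> keys p" for m c
    using assms that by (intro homog_single) (auto simp: multideg_segre_expo homog_def)
  then show ?thesis
    unfolding segre_pullback_def by (intro homog_sum)
qed

text \<open>Degree e pulls back to multidegree (e,...,e), and for non-empty \<open>K\<close>
  different e stay different, so no two components are merged.\<close>

lemma segre_pullback_component:
  assumes "finite K" "K \<noteq> {}"
  shows "segre_pullback K (component d p) = component (diag_deg K (d ())) (segre_pullback K p)"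
proof (induction p rule: poly_mapping_single_induct)
  case (single m c)
  have hom: "single m c \<in> homog (multideg m)"
    "segre_pullback K (single m c) \<in> homog (diag_deg K (multideg m ()))"
    using segre_pullback_homog[OF assms(1) homog_single[OF refl]] by (auto intro: homog_single)
  show ?case
  proof (cases "multideg m = d")
    case True
    then show ?thesis
      using hom by (simp add: component_homog_same)
  next
    case False
    then have "multideg m () \<noteq> d ()"
      by (auto simp: fun_eq_iff)
    then have "diag_deg K (multideg m ()) \<noteq> diag_deg K (d ())"
      using assms(2) by (auto simp: diag_deg_def fun_eq_iff)
    then show ?thesis
      using component_homog_other[OF hom(1) False] component_homog_other[OF hom(2)] by simp
  qed
qed (auto simp: component_add segre_pullback_add)

locale segre = projective_product K V
  for K :: "'i set" and V :: "'i \<Rightarrow> 'v set" +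
  assumes K_nonempty: "K \<noteq> {}"
begin

sublocale target: projective_product "{()}" "tensor_vars K V"
  using finite_charts ex_chart by unfold_locales (auto simp: tensor_vars_def)

abbreviation "\<phi> \<equiv> segre_pullback K"

lemma target_charts: "T \<in> charts {()} (tensor_vars K V) \<longleftrightarrow> T () \<in> charts K V"
  by (auto simp: charts_def tensor_vars_def PiE_def extensional_def)

lemma char_expo_cvars: "char_expo (cvars J) = xmon J unit_deg"
  unfolding char_expo_def xmon_def chart_vars_def
  by (subst sum.reindex) (auto simp: inj_on_def deg_of_def intro: sum.cong)

lemma target_cvars: "target.cvars T = {((), T ())}"
  by (simp add: chart_vars_def)

lemma segre_expo_single_1: "segre_expo K (single ((), J) 1) = xmon J unit_deg"
  unfolding segre_expo_single xmon_def by (rule sum.cong) (auto simp: deg_of_def)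

lemma segre_expo_target_cvars:
  fixes T :: "unit \<Rightarrow> 'i \<Rightarrow> 'v"
  shows "segre_expo K (char_expo (target.cvars T)) = char_expo (cvars (T ()))"
proof -
  have "char_expo (target.cvars T) = single ((), T ()) 1"
    by (simp add: target_cvars char_expo_def)
  then show ?thesis
    by (simp only: segre_expo_single_1 char_expo_cvars)
qed

lemma segre_pullback_cox:
  assumes "p \<in> target.S"
  shows "\<phi> p \<in> S"
  unfolding segre_pullback_def
proof (rule cox_ring_sum)
  fix m assume m: "m \<in> keys p"
  have "segre_expo K m \<in> {n. keys n \<subseteq> Sigma K V \<and> (\<forall>x. 0 \<le> lookup n x)}" (is "_ \<in> ?A")
    unfolding segre_expo_def
  proof -
    have add: "a + b \<in> ?A" if "a \<in> ?A" "b \<in> ?A" for a b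
      using that keys_add[of a b] by (auto simp: lookup_add)
    have sum: "sum f B \<in> ?A" if "\<And>x. x \<in> B \<Longrightarrow> f x \<in> ?A" for f :: "'c \<Rightarrow> _" and B
      using that by (induction B rule: infinite_finite_induct) (use add in auto)
    have "single (i, snd x i) (lookup m x) \<in> ?A"
      if "x \<in> keys m" "i \<in> K" for x i
    proof -
      have "snd x \<in> charts K V"
        using cox_ringD(1)[OF assms m] that(1) by (auto simp: tensor_vars_def)
      then have "snd x i \<in> V i"
        using that(2) by (auto simp: charts_def)
      then show ?thesis
        using that(2) cox_ringD(2)[OF assms m, of x] by (auto simp: lookup_single when_def)
    qed
    then show "(\<Sum>x\<in>keys m. \<Sum>i\<in>K. single (i, snd x i) (lookup m x)) \<in> ?A"
      by (intro sum)
  qed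
  then have "lmonom (segre_expo K m) \<in> S"
    by (intro cox_ring_lmonom) auto
  then have "lscale (lookup p m) (lmonom (segre_expo K m)) \<in> S"
    by (rule cox_ring_lscale)
  then show "single (segre_expo K m) (lookup p m) \<in> S"
    by (simp add: lscale_def lmonom_def mult_single)
qed

text \<open>The single coordinate inverted on the target chart \<open>T\<close> pulls back to the
  product of all coordinates inverted on the chart \<open>T ()\<close>, so denominators on the two
  sides correspond.\<close>

lemma localize_segre_image:
  assumes I: "closed_subscheme K V I" and T: "T () \<in> charts K V"
    and q: "q \<in> localize target.S (target.cvars T)"
  shows "q \<in> localize (segre_image K V I) (target.cvars T) \<longleftrightarrow> \<phi> q \<in> localize I (cvars (T ()))"
proof -
  have *: "\<phi> (vars_pow (target.cvars T) N * q)
    = vars_pow (cvars (T ())) N * \<phi> q" for N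
    by (simp add: segre_pullback_mult segre_pullback_lmonom segre_expo_frag_cmul segre_expo_target_cvars)
  show ?thesis
  proof
    assume "q \<in> localize (segre_image K V I) (target.cvars T)"
    then show "\<phi> q \<in> localize I (cvars (T ()))"
      unfolding localize_iff segre_image_def using * by fastforce
  next
    assume "\<phi> q \<in> localize I (cvars (T ()))"
    then obtain N where N: "\<forall>N'\<ge>N. vars_pow (cvars (T ())) N' * \<phi> q \<in> I"
      using localize_all_ge[OF I cvars_subset[OF T]] by blast
    have "target.cvars T \<subseteq> Sigma {()} (tensor_vars K V)"
      using T by (auto simp: target_cvars tensor_vars_def)
    then obtain M where M: "\<forall>N'\<ge>M. vars_pow (target.cvars T) N' * q \<in> target.S"
      using target.localize_all_ge[OF target.closed_subscheme_cox _ q] by blast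
    have "vars_pow (target.cvars T) (max M N) * q \<in> segre_image K V I"
      using M N * by (simp add: segre_image_def)
    then show "q \<in> localize (segre_image K V I) (target.cvars T)"
      unfolding localize_iff by blast
  qed
qed

lemma segre_pullback_localize_cox:
  assumes "T () \<in> charts K V" "q \<in> localize target.S (target.cvars T)"
  shows "\<phi> q \<in> localize S (cvars (T ()))"
proof -
  obtain N where "vars_pow (target.cvars T) N * q \<in> target.S"
    using assms(2) unfolding localize_iff by blast
  from segre_pullback_cox[OF this] show ?thesis
    unfolding localize_iff
    by (auto simp: segre_pullback_mult segre_pullback_lmonom segre_expo_frag_cmul segre_expo_target_cvars)
qed

lemma closed_subscheme_segre_image:
  assumes I: "closed_subscheme K V I"
  shows "closed_subscheme {()} (tensor_vars K V) (segre_image K V I)"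
  unfolding closed_subscheme_def
proof (intro conjI ballI allI impI)
  note D = closed_subschemeD[OF I]
  show "segre_image K V I \<subseteq> target.S"
    by (auto simp: segre_image_def)
  show "0 \<in> segre_image K V I"
    using D(2) by (simp add: segre_image_def)
  show "p + q \<in> segre_image K V I" if "p \<in> segre_image K V I" "q \<in> segre_image K V I" for p q
    using that D(3) by (auto simp: segre_image_def segre_pullback_add cox_ring_add)
  show "s * p \<in> segre_image K V I" if "s \<in> target.S" "p \<in> segre_image K V I" for s p
    using that D(4) segre_pullback_cox by (auto simp: segre_image_def segre_pullback_mult cox_ring_mult)
  show "component d p \<in> segre_image K V I" if "p \<in> segre_image K V I" for p d
    using that D(5)
    by (auto simp: segre_image_def segre_pullback_component[OF finite_K K_nonempty] cox_ring_component)
  fix p assume p: "p \<in> target.S"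
    "\<forall>T\<in>charts {()} (tensor_vars K V). p \<in> localize (segre_image K V I) (target.cvars T)"
  have "\<phi> p \<in> I"
  proof (rule D(6)[OF segre_pullback_cox[OF p(1)]])
    fix J assume J: "J \<in> charts K V"
    then have "p \<in> localize (segre_image K V I) (target.cvars (\<lambda>_. J))"
      using p(2) by (simp add: target_charts)
    then show "\<phi> p \<in> localize I (cvars J)"
      using localize_segre_image[OF I, of "\<lambda>_. J" p] J localize_base[OF p(1)] by simp
  qed
  then show "p \<in> segre_image K V I"
    using p(1) by (simp add: segre_image_def)
qed

lemma linear_segre_pullback: "Vector_Spaces.linear lscale lscale \<phi>"
  by (rule ll.linearI) (simp_all add: segre_pullback_add segre_pullback_lscale)

lemma diag_deg_0 [simp]: "diag_deg A 0 = 0"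
  by (auto simp: diag_deg_def fun_eq_iff)

lemma segre_pullback_sections_cox:
  assumes "T () \<in> charts K V" "q \<in> sections target.S 0 (target.cvars T)"
  shows "\<phi> q \<in> sections S 0 (cvars (T ()))"
  using assms segre_pullback_localize_cox[where T = T, OF assms(1)] segre_pullback_homog[OF finite_K, of q 0]
  by (simp add: sections_def)

text \<open>The ideal of the image is a preimage under \<open>\<phi>\<close>, so on each chart
  \<open>\<phi>\<close> embeds the functions on the image into those on the scheme.\<close>

lemma zero_dimensional_segre_image:
  assumes "zero_dimensional K V I"
  shows "zero_dimensional {()} (tensor_vars K V) (segre_image K V I)"
  unfolding zero_dimensional_def
proof (intro conjI ballI)
  have I: "closed_subscheme K V I"
    using assms by (simp add: zero_dimensional_def)
  show G: "closed_subscheme {()} (tensor_vars K V) (segre_image K V I)"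
    using I by (rule closed_subscheme_segre_image)
  fix T assume T: "T \<in> charts {()} (tensor_vars K V)"
  then have T': "T () \<in> charts K V"
    by (simp add: target_charts)
  have "quot_dim lscale (sections target.S 0 (target.cvars T)) (sections (segre_image K V I) 0 (target.cvars T))
    \<le> quot_dim lscale (sections S 0 (cvars (T ()))) (sections I 0 (cvars (T ())))"
  proof (rule ll.quot_dim_le_inj[OF linear_segre_pullback])
    show "lsc.subspace (sections target.S 0 (target.cvars T))"
      "lsc.subspace (sections (segre_image K V I) 0 (target.cvars T))"
      by (intro target.sections_subspace target.closed_subscheme_cox target.cvars_subset G T)+
    show "lsc.subspace (sections I 0 (cvars (T ())))"
      by (intro sections_subspace I cvars_subset T')
    show "\<phi> ` sections target.S 0 (target.cvars T) \<subseteq> sections S 0 (cvars (T ()))"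
      using segre_pullback_sections_cox[where T = T, OF T'] by blast
    show "q \<in> sections (segre_image K V I) 0 (target.cvars T)"
      if "q \<in> sections target.S 0 (target.cvars T)" "\<phi> q \<in> sections I 0 (cvars (T ()))" for q
      using that localize_segre_image[where T = T, OF I T'] by (auto simp: sections_def)
  qed
  also have "\<dots> < \<infinity>"
    using assms T' by (simp add: zero_dimensional_def)
  finally show "quot_dim lscale (sections target.S 0 (target.cvars T))
    (sections (segre_image K V I) 0 (target.cvars T)) < \<infinity>" .
qed

lemma localize_segre_image_Un:
  assumes I: "closed_subscheme K V I" and T: "T () \<in> charts K V" "T' () \<in> charts K V"
    and q: "q \<in> localize (segre_image K V I) (target.cvars T \<union> target.cvars T')"
  shows "\<phi> q \<in> localize I (cvars (T ()) \<union> cvars (T' ()))"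
proof -
  let ?W = "cvars (T ()) \<union> cvars (T' ())"
  note W = cvars_Un_subset[OF T]
  obtain N where N: "vars_pow (target.cvars T \<union> target.cvars T') N * q
    \<in> segre_image K V I"
    using q unfolding localize_iff by blast
  \<comment> \<open>A coordinate common to two different charts occurs twice in this pulled-back
    monomial, so it need not be the product of the coordinates in \<open>?W\<close>; it is
    nevertheless a unit where these are inverted.\<close>
  define n where "n = segre_expo K (char_expo (target.cvars T \<union> target.cvars T'))"
  have "n = (\<Sum>x\<in>{((), T ()), ((), T' ())}. xmon (snd x) unit_deg)"
    unfolding n_def char_expo_def target_cvars segre_expo_sum
    by (rule sum.cong) (auto simp: segre_expo_single_1)
  then have "keys n \<subseteq> ?W"
    using keys_xmon[of "T ()" unit_deg] keys_xmon[of "T' ()" unit_deg]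
      keys_sum[of "\<lambda>x. xmon (snd x) unit_deg" "{((), T ()), ((), T' ())}"] by auto
  then have "keys (- frag_cmul (int N) n) \<subseteq> ?W"
    using keys_cmul[of "int N" n] by auto
  then have "lmonom (- frag_cmul (int N) n) \<in> localize S ?W"
    using W by (rule lmonom_localize)
  moreover have "lmonom (frag_cmul (int N) n) * \<phi> q \<in> I"
    using N by (simp add: segre_image_def segre_pullback_mult segre_pullback_lmonom segre_expo_frag_cmul n_def)
  ultimately have "lmonom (- frag_cmul (int N) n) * (lmonom (frag_cmul (int N) n) * \<phi> q) \<in> localize I ?W"
    using localize_mult[OF I W _ localize_base] by blast
  then show ?thesis
    by (simp only: lmonom_cancel)
qed

text \<open>Pulling back functions is injective modulo the ideals, chart by chart. For the scheme of
  the theorem the opposite inequality will come out of the flattening bound.\<close>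

lemma degree_segre_image_le:
  assumes I: "closed_subscheme K V I"
  shows "degree {()} (tensor_vars K V) (segre_image K V I) \<le> degree K V I"
  unfolding degree_eq target.degree_eq
proof (rule ff.quot_dim_le_inj)
  let ?G = "segre_image K V I"
  have G: "closed_subscheme {()} (tensor_vars K V) ?G"
    using I by (rule closed_subscheme_segre_image)
  let ?f = "\<lambda>s J. \<phi> (s (\<lambda>_::unit. J))"
  show "Vector_Spaces.linear fscale fscale ?f"
    by (rule ff.linearI) (auto simp: fscale_def fun_eq_iff segre_pullback_add segre_pullback_lscale)
  show "fsc.subspace (target.cech_Z0 ?G 0)" "fsc.subspace (cech_C0 {()} (tensor_vars K V) ?G 0)"
    "fsc.subspace (cech_C0 K V I 0)"
    using I G target.cech_Z0_subspace target.cech_C0_subspace cech_C0_subspace by blast+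
  show "?f ` target.cech_Z0 ?G 0 \<subseteq> cech_Z0 I 0"
  proof
    fix s' assume "s' \<in> ?f ` target.cech_Z0 ?G 0"
    then obtain s where s: "s \<in> target.cech_Z0 ?G 0" "s' = ?f s" by blast
    show "s' \<in> cech_Z0 I 0"
      unfolding cech_Z0_iff
    proof (intro conjI ballI)
      show "s' \<in> cech_C0 K V S 0"
        unfolding cech_C0_def
      proof (intro CollectI conjI ballI allI impI)
        show "s' J \<in> sections S 0 (cvars J)" if "J \<in> charts K V" for J
          using s that segre_pullback_sections_cox[of "\<lambda>_. J" "s (\<lambda>_. J)"]
          by (auto simp: target.cech_Z0_iff cech_C0_def target_charts)
        show "s' J = 0" if "J \<notin> charts K V" for J
          using s that by (auto simp: target.cech_Z0_iff cech_C0_def target_charts)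
      qed
      fix J J' assume J: "J \<in> charts K V" "J' \<in> charts K V"
      have "s (\<lambda>_. J') - s (\<lambda>_. J) \<in> sections ?G 0 (target.cvars (\<lambda>_. J) \<union> target.cvars (\<lambda>_. J'))"
        using s(1) J by (simp add: target.cech_Z0_iff target_charts)
      then show "s' J' - s' J \<in> sections I 0 (cvars J \<union> cvars J')"
        using localize_segre_image_Un[OF I, of "\<lambda>_. J" "\<lambda>_. J'"] J
          segre_pullback_homog[OF finite_K, of "s (\<lambda>_. J') - s (\<lambda>_. J)" 0]
        by (simp add: s(2) sections_def flip: segre_pullback_diff)
    qed
  qed
  fix s assume s: "s \<in> target.cech_Z0 ?G 0" "?f s \<in> cech_C0 K V I 0"
  show "s \<in> cech_C0 {()} (tensor_vars K V) ?G 0"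
    unfolding cech_C0_def
  proof (intro CollectI conjI ballI allI impI)
    show "s T = 0" if "T \<notin> charts {()} (tensor_vars K V)" for T
      using s(1) that by (auto simp: target.cech_Z0_iff cech_C0_def)
    fix T assume T: "T \<in> charts {()} (tensor_vars K V)"
    then have T': "T () \<in> charts K V"
      by (simp add: target_charts)
    have eq: "(\<lambda>_. T ()) = T"
      by (rule ext) (metis unit.exhaust)
    have "s T \<in> sections target.S 0 (target.cvars T)"
      using s(1) T by (auto simp: target.cech_Z0_iff cech_C0_def)
    moreover have "\<phi> (s T) \<in> sections I 0 (cvars (T ()))"
      using s(2) T' unfolding cech_C0_def by (auto simp: eq)
    ultimately show "s T \<in> sections ?G 0 (target.cvars T)"
      using localize_segre_image[where T = T, OF I T'] by (auto simp: sections_def)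
  qed
qed

end

section \<open>Evaluation at points\<close>

lemma evaluate_0 [simp]: "evaluate 0 x = 0"
  by (simp add: evaluate_def)

lemma evaluate_add: "evaluate (p + q) x = evaluate p x + evaluate q x"
  unfolding evaluate_def by (rule setsum_keys_plus_distrib) (simp_all add: algebra_simps)

lemma evaluate_single:
  "evaluate (single m c) x = c * (\<Prod>y\<in>keys m. x y powi lookup m y)"
  by (simp add: evaluate_def)

lemma evaluate_lscale: "evaluate (lscale a p) x = a * evaluate p x"
  by (induction p rule: poly_mapping_single_induct)
    (auto simp: lsc.scale_right_distrib evaluate_add algebra_simps lscale_def mult_single evaluate_single)

lemma evaluate_diff: "evaluate (p - q) x = evaluate p x - evaluate q x"
  by (metis add_diff_cancel_right' diff_add_cancel evaluate_add)

lemma evaluate_sum: "evaluate (sum f A) x = (\<Sum>y\<in>A. evaluate (f y) x)"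
  by (induction A rule: infinite_finite_induct) (auto simp: evaluate_add)

text \<open>Since \<open>0 powi k = 0\<close> for \<open>k < 0\<close>, evaluation is multiplicative only on the
  polynomials without poles along the coordinates vanishing at \<open>x\<close>.\<close>

definition regular_at :: "('i \<times> 'v \<Rightarrow> complex) \<Rightarrow> ('i, 'v) laurent \<Rightarrow> bool"
  where "regular_at x p \<longleftrightarrow> (\<forall>m\<in>keys p. \<forall>y. x y = 0 \<longrightarrow> 0 \<le> lookup m y)"

lemma evaluate_single_add:
  fixes x :: "'k \<Rightarrow> complex" and m n :: "'k \<Rightarrow>\<^sub>0 int"
  assumes "\<And>y. x y = 0 \<Longrightarrow> 0 \<le> lookup m y" "\<And>y. x y = 0 \<Longrightarrow> 0 \<le> lookup n y"
  shows "(\<Prod>y\<in>keys (m + n). x y powi lookup (m + n) y)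
    = (\<Prod>y\<in>keys m. x y powi lookup m y)
    * (\<Prod>y\<in>keys n. x y powi lookup n y)"
proof -
  let ?A = "keys m \<union> keys n"
  have ext: "(\<Prod>y\<in>keys k. x y powi lookup k y) = (\<Prod>y\<in>?A. x y powi lookup k y)"
    if "keys k \<subseteq> ?A" for k
    using that by (intro prod.mono_neutral_left) (auto simp: in_keys_iff)
  have pw: "x y powi lookup (m + n) y = x y powi lookup m y * x y powi lookup n y" for y
  proof (cases "x y = 0")
    case True
    then show ?thesis
      using assms[of y] by (cases "lookup m y = 0") (simp_all add: lookup_add)
  next
    case False
    then show ?thesis
      by (simp add: lookup_add power_int_add)
  qed
  show ?thesis
    using ext[OF keys_add] ext[of m] ext[of n] by (simp add: pw prod.distrib)
qed

lemma evaluate_mult: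
  assumes "regular_at x p" "regular_at x q"
  shows "evaluate (p * q) x = evaluate p x * evaluate q x"
proof -
  have *: "p * q = (\<Sum>m\<in>keys p. \<Sum>n\<in>keys q.
      single (m + n) (lookup p m * lookup q n))"
    by (subst poly_mapping_eq_sum_single[of p], subst poly_mapping_eq_sum_single[of q])
      (simp add: sum_product mult_single)
  have "evaluate (p * q) x = (\<Sum>m\<in>keys p. \<Sum>n\<in>keys q.
      (lookup p m * (\<Prod>y\<in>keys m. x y powi lookup m y))
      * (lookup q n * (\<Prod>y\<in>keys n. x y powi lookup n y)))"
    unfolding * evaluate_sum
  proof (intro sum.cong refl)
    fix m n assume mn: "m \<in> keys p" "n \<in> keys q"
    have "0 \<le> lookup m y" "0 \<le> lookup n y" if "x y = 0" for y
      using assms mn that unfolding regular_at_def by blast+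
    then show "evaluate (single (m + n) (lookup p m * lookup q n)) x
      = (lookup p m * (\<Prod>y\<in>keys m. x y powi lookup m y))
      * (lookup q n * (\<Prod>y\<in>keys n. x y powi lookup n y))"
      using evaluate_single_add[of x m n] by (simp add: evaluate_single mult_ac)
  qed
  also have "\<dots> = evaluate p x * evaluate q x"
    by (simp add: evaluate_def sum_product)
  finally show ?thesis .
qed

lemma regular_at_cox: "p \<in> cox_ring K V \<Longrightarrow> regular_at x p"
  by (auto simp: regular_at_def dest: cox_ringD(2))

lemma regular_at_lmonom: "(\<And>y. x y = 0 \<Longrightarrow> 0 \<le> lookup m y) \<Longrightarrow> regular_at x (lmonom m)"
  by (simp add: regular_at_def lmonom_def)

lemma evaluate_lmonom_nonzero:
  assumes "\<And>y. y \<in> keys m \<Longrightarrow> x y \<noteq> 0"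
  shows "evaluate (lmonom m) x \<noteq> 0"
  using assms by (auto simp: lmonom_def evaluate_single)

text \<open>Digits in a positional system: the weight of a new index exceeds every value the earlier
  digits can reach, so division recovers the new digit. It is used to separate multidegrees and to
  give every chart its own exponent.\<close>

lemma ex_digit_weights:
  assumes "finite K"
  shows "\<exists>w :: 'i \<Rightarrow> nat. \<forall>d d'. (\<forall>i\<in>K. d i < N \<and> d' i < (N::nat)) \<longrightarrow>
    (\<Sum>i\<in>K. w i * d i) = (\<Sum>i\<in>K. w i * d' i) \<longrightarrow> (\<forall>i\<in>K. d i = d' i)"
  using assms
proof (induction K)
  case empty
  then show ?case by simp
next
  case (insert k K)
  then obtain w where w: "\<And>d d'. \<lbrakk>\<forall>i\<in>K. d i < N \<and> d' i < N;
    (\<Sum>i\<in>K. w i * d i) = (\<Sum>i\<in>K. w i * d' i)\<rbrakk> \<Longrightarrow> \<forall>i\<in>K. d i = d' i"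
    by blast
  define B where "B = Suc (\<Sum>i\<in>K. w i * N)"
  have B: "B \<noteq> 0"
    by (simp add: B_def)
  have less: "(\<Sum>i\<in>K. w i * d i) < B" if "\<forall>i\<in>K. d i < N" for d
    unfolding B_def using that by (intro le_imp_less_Suc sum_mono) (auto intro: less_imp_le)
  show ?case
  proof (intro exI[of _ "w(k := B)"] allI impI)
    fix d d' assume d: "\<forall>i\<in>insert k K. d i < N \<and> d' i < N"
      and eq: "(\<Sum>i\<in>insert k K. (w(k := B)) i * d i) = (\<Sum>i\<in>insert k K. (w(k := B)) i * d' i)"
    have upd: "(\<Sum>i\<in>K. (w(k := B)) i * f i) = (\<Sum>i\<in>K. w i * f i)" for f
      using insert.hyps by (intro sum.cong) auto
    have *: "B * d k + (\<Sum>i\<in>K. w i * d i) = B * d' k + (\<Sum>i\<in>K. w i * d' i)"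
      using eq insert.hyps by (simp add: upd del: fun_upd_apply) simp
    have "d k = (B * d k + (\<Sum>i\<in>K. w i * d i)) div B"
      using less[of d] d B by simp
    also have "\<dots> = d' k"
      unfolding * using less[of d'] d B by simp
    finally have "d k = d' k" .
    moreover from this have "\<forall>i\<in>K. d i = d' i"
      using * d by (intro w) simp_all
    ultimately show "\<forall>i\<in>insert k K. d i = d' i"
      by simp
  qed
qed

section \<open>Rescaling of coordinate vectors and multihomogeneous components\<close>

context projective_product
begin

abbreviation scale_point :: "('i \<Rightarrow> complex) \<Rightarrow> ('i \<times> 'v \<Rightarrow> complex) \<Rightarrow> 'i \<times> 'v \<Rightarrow> complex"
  where "scale_point a x \<equiv> \<lambda>y. if fst y \<in> K then a (fst y) * x y else 0"

lemma equiv_proportional: "equiv (coord_vectors K V) (proportional K V)"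
proof (rule equivI)
  show "proportional K V \<subseteq> coord_vectors K V \<times> coord_vectors K V"
    by (auto simp: proportional_def)
  show "refl_on (coord_vectors K V) (proportional K V)"
    by (auto simp: refl_on_def proportional_def intro!: exI[of _ "\<lambda>_. 1"])
  show "sym (proportional K V)"
  proof (rule symI)
    fix x y assume "(x, y) \<in> proportional K V"
    then obtain a where "x \<in> coord_vectors K V" "y \<in> coord_vectors K V"
      "\<forall>i\<in>K. a i \<noteq> 0 \<and> (\<forall>v. y (i, v) = a i * x (i, v))"
      by (auto simp: proportional_def)
    then show "(y, x) \<in> proportional K V"
      by (auto simp: proportional_def intro!: exI[of _ "\<lambda>i. inverse (a i)"])
  qed
  show "trans (proportional K V)"
  proof (rule transI)
    fix x y z assume "(x, y) \<in> proportional K V" "(y, z) \<in> proportional K V"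
    then have "x \<in> coord_vectors K V" "z \<in> coord_vectors K V"
      and "\<exists>a. \<forall>i\<in>K. a i \<noteq> 0 \<and> (\<forall>v. y (i, v) = a i * x (i, v))"
      and "\<exists>b. \<forall>i\<in>K. b i \<noteq> 0 \<and> (\<forall>v. z (i, v) = b i * y (i, v))"
      by (simp_all add: proportional_def)
    moreover from this obtain a b where
      "\<forall>i\<in>K. a i \<noteq> 0 \<and> (\<forall>v. y (i, v) = a i * x (i, v))"
      "\<forall>i\<in>K. b i \<noteq> 0 \<and> (\<forall>v. z (i, v) = b i * y (i, v))"
      by blast
    ultimately show "(x, z) \<in> proportional K V"
      by (auto simp: proportional_def intro!: exI[of _ "\<lambda>i. b i * a i"])
  qed
qed

lemma point_coord_vector: "P \<in> points K V \<Longrightarrow> x \<in> P \<Longrightarrow> x \<in> coord_vectors K V"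
  unfolding points_def using Union_quotient[OF equiv_proportional] by blast

lemma scale_point_mem:
  assumes P: "P \<in> points K V" "x \<in> P" and a: "\<And>i. i \<in> K \<Longrightarrow> a i \<noteq> 0"
  shows "scale_point a x \<in> P"
proof -
  have x: "x \<in> coord_vectors K V"
    using P by (rule point_coord_vector)
  then have "scale_point a x \<in> coord_vectors K V"
    using a by (fastforce simp: coord_vectors_def)
  then have "(x, scale_point a x) \<in> proportional K V"
    using x a by (auto simp: proportional_def)
  then show ?thesis
    using P in_quotient_imp_closed[OF equiv_proportional] unfolding points_def by blast
qed

lemma point_proportional:
  assumes "P \<in> points K V" "x \<in> P" "y \<in> P"
  shows "\<exists>a. (\<forall>i\<in>K. a i \<noteq> 0) \<and> y = scale_point a x"
proof -
  have "(x, y) \<in> proportional K V"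
    using assms in_quotient_imp_in_rel[OF equiv_proportional] unfolding points_def by blast
  then obtain a where a: "\<forall>i\<in>K. a i \<noteq> 0 \<and> (\<forall>v. y (i, v) = a i * x (i, v))" "y \<in> coord_vectors K V"
    by (auto simp: proportional_def)
  then have "y z = scale_point a x z" for z
    by (cases z) (auto simp: coord_vectors_def)
  then show ?thesis
    using a by blast
qed

lemma point_nonempty: "P \<in> points K V \<Longrightarrow> \<exists>x. x \<in> P"
  using in_quotient_imp_non_empty[OF equiv_proportional] unfolding points_def by blast

lemma evaluate_scale_point_single:
  assumes m: "keys m \<subseteq> Sigma K V"
    and a: "\<And>i. i \<in> K \<Longrightarrow> a i \<noteq> 0"
  shows "evaluate (single m c) (scale_point a x)
    = (\<Prod>i\<in>K. a i powi multideg m i) * evaluate (single m c) x"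
proof -
  let ?l = "lookup m"
  have "(\<Prod>y\<in>keys m. scale_point a x y powi ?l y)
    = (\<Prod>y\<in>keys m. a (fst y) powi ?l y * x y powi ?l y)"
    using m by (intro prod.cong) (auto simp: power_int_mult_distrib)
  also have "\<dots> = (\<Prod>y\<in>keys m. a (fst y) powi ?l y) * (\<Prod>y\<in>keys m. x y powi ?l y)"
    by (rule prod.distrib)
  also have "(\<Prod>y\<in>keys m. a (fst y) powi ?l y)
    = (\<Prod>y\<in>keys m. \<Prod>i\<in>K. a i powi (if fst y = i then ?l y else 0))"
  proof (rule prod.cong)
    fix y assume "y \<in> keys m"
    then have "fst y \<in> K"
      using m by auto
    then have "(\<Prod>i\<in>K. if i = fst y then a i powi ?l y else 1) = a (fst y) powi ?l y"
      using finite_K by (simp add: prod.delta)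
    then show "a (fst y) powi ?l y = (\<Prod>i\<in>K. a i powi (if fst y = i then ?l y else 0))"
      by (simp add: if_distrib[of "\<lambda>k. _ powi k"] eq_commute[of "fst y"] cong: if_cong)
  qed simp
  also have "\<dots> = (\<Prod>i\<in>K. \<Prod>y\<in>keys m. a i powi (if fst y = i then ?l y else 0))"
    by (rule prod.swap)
  also have "\<dots> = (\<Prod>i\<in>K. a i powi multideg m i)"
  proof (rule prod.cong)
    fix i assume "i \<in> K"
    have "(\<Prod>y\<in>A. a i powi f y) = a i powi (\<Sum>y\<in>A. f y)" for A and f :: "_ \<Rightarrow> int"
      using a[OF \<open>i \<in> K\<close>] by (induction A rule: infinite_finite_induct) (auto simp: power_int_add)
    then show "(\<Prod>y\<in>keys m. a i powi (if fst y = i then ?l y else 0)) = a i powi multideg m i"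
      by (simp add: multideg_def)
  qed simp
  finally show ?thesis
    by (simp add: evaluate_single)
qed

lemma evaluate_scale_point:
  assumes p: "p \<in> homog d" "\<And>m. m \<in> keys p \<Longrightarrow> keys m \<subseteq> Sigma K V"
    and a: "\<And>i. i \<in> K \<Longrightarrow> a i \<noteq> 0"
  shows "evaluate p (scale_point a x) = (\<Prod>i\<in>K. a i powi d i) * evaluate p x"
proof -
  have "evaluate p (scale_point a x) = (\<Sum>m\<in>keys p. evaluate (single m (lookup p m)) (scale_point a x))"
    by (subst poly_mapping_eq_sum_single[of p]) (rule evaluate_sum)
  also have "\<dots> = (\<Sum>m\<in>keys p. (\<Prod>i\<in>K. a i powi d i) * evaluate (single m (lookup p m)) x)"
  proof (rule sum.cong)
    fix m assume m: "m \<in> keys p"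
    then have "multideg m = d"
      using p(1) by (simp add: homog_def)
    then show "evaluate (single m (lookup p m)) (scale_point a x)
      = (\<Prod>i\<in>K. a i powi d i) * evaluate (single m (lookup p m)) x"
      using evaluate_scale_point_single[of m a "lookup p m" x] p(2)[OF m] a by auto
  qed simp
  also have "\<dots> = (\<Prod>i\<in>K. a i powi d i) * evaluate p x"
    by (subst (2) poly_mapping_eq_sum_single[of p]) (simp add: evaluate_sum sum_distrib_left)
  finally show ?thesis .
qed

text \<open>Rescaling the factors of a point by powers of \<open>t\<close> separates the multidegrees.\<close>

lemma evaluate_component_eq_0:
  assumes P: "P \<in> points K V" and p: "p \<in> S" "\<And>x. x \<in> P \<Longrightarrow> evaluate p x = 0" and x: "x \<in> P"
  shows "evaluate (component d p) x = 0"
proof -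
  let ?D = "multideg ` keys p"
  have Dnn: "0 \<le> e i" if "e \<in> ?D" for e i
    using that cox_ringD(2)[OF p(1)] by (auto simp: multideg_def intro!: sum_nonneg)
  have Dsupp: "e i = 0" if "e \<in> ?D" "i \<notin> K" for e i
    using that multideg_supp[OF cox_ringD(1)[OF p(1)]] by auto
  have finD: "finite ?D" by simp
  \<comment> \<open>A digit base above every entry of every multidegree occurring in
    \<open>p\<close>.\<close>
  define N where "N = Suc (\<Sum>e\<in>?D. \<Sum>i\<in>K. nat (e i))"
  have less: "nat (e i) < N" if "e \<in> ?D" "i \<in> K" for e i
  proof -
    have "nat (e i) \<le> (\<Sum>i\<in>K. nat (e i))"
      using that(2) finite_K by (intro member_le_sum) auto
    also have "\<dots> \<le> (\<Sum>e\<in>?D. \<Sum>i\<in>K. nat (e i))"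
      using that(1) finD by (intro member_le_sum) auto
    finally show ?thesis
      by (simp add: N_def)
  qed
  from ex_digit_weights[OF finite_K, of N] obtain w :: "'i \<Rightarrow> nat" where w': "\<forall>d d'.
    (\<forall>i\<in>K. d i < N \<and> d' i < N) \<longrightarrow>
    (\<Sum>i\<in>K. w i * d i) = (\<Sum>i\<in>K. w i * d' i) \<longrightarrow> (\<forall>i\<in>K. d i = d' i)"
    by (elim exE)
  note w = w'[THEN spec, THEN spec, THEN mp, THEN mp]
  define g where "g e = (\<Sum>i\<in>K. w i * nat (e i))" for e :: "'i \<Rightarrow> int"
  have inj: "inj_on g ?D"
  proof (rule inj_onI, rule ext)
    fix e e' i assume e: "e \<in> ?D" "e' \<in> ?D" "g e = g e'"
    then have *: "\<forall>i\<in>K. nat (e i) = nat (e' i)"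
      using less by (intro w) (auto simp: g_def)
    show "e i = e' i"
    proof (cases "i \<in> K")
      case True
      then have "nat (e i) = nat (e' i)"
        using * by blast
      then show ?thesis
        using Dnn[OF e(1), of i] Dnn[OF e(2), of i] by simp
    next
      case False
      then show ?thesis
        using Dsupp e by metis
    qed
  qed
  \<comment> \<open>For \<open>t\<close> non-zero this polynomial gives the value of
    \<open>p\<close> at the rescaled point. Distinct multidegrees sit at distinct powers of
    \<open>t\<close>, and infinitely many zeros force all coefficients to vanish.\<close>
  define q where "q = (\<Sum>e\<in>?D. monom (evaluate (component e p) x) (g e))"
  have "poly q t = 0" if t: "t \<noteq> 0" for t
  proof -
    have "0 = evaluate p (scale_point (\<lambda>i. t ^ w i) x)"
      using p(2) scale_point_mem[OF P x, of "\<lambda>i. t ^ w i"] t by simp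
    also have "\<dots> = (\<Sum>e\<in>?D. evaluate (component e p) (scale_point (\<lambda>i. t ^ w i) x))"
      by (subst sum_component[of p]) (rule evaluate_sum)
    also have "\<dots> = (\<Sum>e\<in>?D. t ^ g e * evaluate (component e p) x)"
    proof (rule sum.cong)
      fix e assume e: "e \<in> ?D"
      have "evaluate (component e p) (scale_point (\<lambda>i. t ^ w i) x)
        = (\<Prod>i\<in>K. (t ^ w i) powi e i) * evaluate (component e p) x"
        using cox_ringD(1)[OF cox_ring_component[OF p(1)]] t
        by (intro evaluate_scale_point component_homog) auto
      also have "(\<Prod>i\<in>K. (t ^ w i) powi e i) = (\<Prod>i\<in>K. t ^ (w i * nat (e i)))"
      proof (rule prod.cong)
        fix i assume "i \<in> K"
        have "(t ^ w i) powi e i = (t ^ w i) ^ nat (e i)"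
          using Dnn[OF e, of i] by (simp add: power_int_def)
        then show "(t ^ w i) powi e i = t ^ (w i * nat (e i))"
          by (simp add: power_mult)
      qed simp
      also have "\<dots> = t ^ g e"
        by (simp add: g_def power_sum)
      finally show "evaluate (component e p) (scale_point (\<lambda>i. t ^ w i) x) = t ^ g e * evaluate (component e p) x" .
    qed simp
    also have "\<dots> = poly q t"
      by (simp add: q_def poly_sum poly_monom mult.commute)
    finally show ?thesis by simp
  qed
  then have "- {0} \<subseteq> {t. poly q t = 0}"
    by auto
  moreover have "infinite (- {0 :: complex})"
    by (simp add: infinite_UNIV_char_0 Compl_eq_Diff_UNIV)
  ultimately have "q = 0"
    using poly_roots_finite[of q] finite_subset by blast
  show ?thesis
  proof (cases "d \<in> ?D")
    case True
    have "coeff q (g d) = (\<Sum>e\<in>?D. if e = d then evaluate (component e p) x else 0)"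
      unfolding q_def coeff_sum using inj True by (intro sum.cong) (auto simp: inj_on_def)
    also have "\<dots> = evaluate (component d p) x"
      using True by (simp add: sum.delta)
    finally show ?thesis
      using \<open>q = 0\<close> by simp
  next
    case False
    then have "component d p = 0"
      by (intro poly_mapping_eqI) (auto simp: lookup_component in_keys_iff)
    then show ?thesis by simp
  qed
qed

end

section \<open>Finite sets of points\<close>

definition pscale :: "complex \<Rightarrow> ('p \<Rightarrow> complex) \<Rightarrow> 'p \<Rightarrow> complex"
  where "pscale a f = (\<lambda>x. a * f x)"

interpretation psc: complex_vector_space "pscale :: complex \<Rightarrow> ('p \<Rightarrow> complex) \<Rightarrow> _"
  unfolding complex_vector_space_def pscale_def
  by unfold_locales (auto simp: fun_eq_iff algebra_simps)

interpretation lp: complex_vector_space_pair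
  "lscale :: complex \<Rightarrow> ('i, 'v) laurent \<Rightarrow> _" "pscale :: complex \<Rightarrow> ('p \<Rightarrow> complex) \<Rightarrow> _"
  by (intro complex_vector_space_pair.intro psc.complex_vector_space_axioms complex_vector_space_lscale)

interpretation fp: complex_vector_space_pair
  "fscale :: complex \<Rightarrow> ('j \<Rightarrow> ('i, 'v) laurent) \<Rightarrow> _" "pscale :: complex \<Rightarrow> ('p \<Rightarrow> complex) \<Rightarrow> _"
  by (intro complex_vector_space_pair.intro psc.complex_vector_space_axioms fsc.complex_vector_space_axioms)

definition funs_on :: "'p set \<Rightarrow> ('p \<Rightarrow> complex) set"
  where "funs_on A = {f. \<forall>P. P \<notin> A \<longrightarrow> f P = 0}"

definition delta :: "'p \<Rightarrow> 'p \<Rightarrow> complex"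
  where "delta P = (\<lambda>Q. if Q = P then 1 else 0)"

lemma sum_fun_apply: "(\<Sum>x\<in>A. f x) y = (\<Sum>x\<in>A. f x y)"
  by (induction A rule: infinite_finite_induct) auto

lemma funs_on_expand:
  assumes "finite A" "f \<in> funs_on A"
  shows "f = (\<Sum>P\<in>A. pscale (f P) (delta P))"
proof
  fix Q
  have "(\<Sum>P\<in>A. pscale (f P) (delta P)) Q = (\<Sum>P\<in>A. if P = Q then f P else 0)"
    unfolding sum_fun_apply by (rule sum.cong) (auto simp: pscale_def delta_def)
  also have "\<dots> = f Q"
    using assms by (auto simp: sum.delta funs_on_def)
  finally show "f Q = (\<Sum>P\<in>A. pscale (f P) (delta P)) Q" ..
qed

lemma inj_delta: "inj delta"
  by (rule injI) (metis delta_def zero_neq_one)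

lemma delta_in_funs_on: "P \<in> A \<Longrightarrow> delta P \<in> funs_on A"
  by (auto simp: delta_def funs_on_def)

lemma delta_image_funs_on: "delta ` A \<subseteq> funs_on A"
  by (rule image_subsetI) (rule delta_in_funs_on)

lemma quot_dim_funs_on:
  assumes "finite A"
  shows "quot_dim pscale (funs_on A) {0} = enat (card A)"
proof (rule antisym)
  have card: "card (delta ` A) = card A"
    by (rule card_image) (rule inj_on_subset[OF inj_delta subset_UNIV])
  have "funs_on A \<subseteq> psc.span ({0} \<union> delta ` A)"
  proof
    fix f assume "f \<in> funs_on A"
    then have "f = (\<Sum>P\<in>A. pscale (f P) (delta P))"
      using assms by (rule funs_on_expand[rotated])
    also have "\<dots> \<in> psc.span ({0} \<union> delta ` A)"
      by (intro psc.span_sum psc.span_scale psc.span_base) blast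
    finally show "f \<in> psc.span ({0} \<union> delta ` A)" .
  qed
  then show "quot_dim pscale (funs_on A) {0} \<le> enat (card A)"
    unfolding card[symmetric] using assms delta_image_funs_on by (intro quot_dim_le_card) simp_all
  have "indep_mod pscale {0} (delta ` A)"
    unfolding indep_mod_def
  proof (intro conjI allI impI)
    show "finite (delta ` A)"
      using assms by simp
    fix c assume "(\<Sum>x\<in>delta ` A. pscale (c x) x) \<in> {0}"
    then have *: "(\<Sum>P\<in>A. pscale (c (delta P)) (delta P)) = 0"
      using sum.reindex[OF inj_on_subset[OF inj_delta subset_UNIV], of "\<lambda>x. pscale (c x) x" A] by simp
    show "\<forall>x\<in>delta ` A. c x = 0"
    proof safe
      fix P assume P: "P \<in> A"
      have "0 = (\<Sum>Q\<in>A. pscale (c (delta Q)) (delta Q)) P"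
        unfolding * by simp
      also have "\<dots> = (\<Sum>Q\<in>A. if Q = P then c (delta Q) else 0)"
        unfolding sum_fun_apply by (rule sum.cong) (auto simp: pscale_def delta_def)
      also have "\<dots> = c (delta P)"
        using P assms by (simp add: sum.delta)
      finally show "c (delta P) = 0" ..
    qed
  qed
  then have "\<exists>X. X \<subseteq> funs_on A \<and> indep_mod pscale {0} X \<and> card X = card A"
    using card delta_image_funs_on by (intro exI[of _ "delta ` A"]) simp
  then show "enat (card A) \<le> quot_dim pscale (funs_on A) {0}"
    by (simp only: psc.le_quot_dim_iff[OF psc.subspace_single_0])
qed

context projective_product
begin

definition nonvanishing :: "('i \<times> 'v) set \<Rightarrow> ('i \<times> 'v \<Rightarrow> complex) \<Rightarrow> bool"
  where "nonvanishing W x \<longleftrightarrow> (\<forall>y\<in>W. x y \<noteq> 0)"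

lemma localize_cox_keys:
  assumes "q \<in> localize S W" "W \<subseteq> Sigma K V" "m \<in> keys q"
  shows "keys m \<subseteq> Sigma K V" "x \<notin> W \<Longrightarrow> 0 \<le> lookup m x"
proof -
  have W: "finite W"
    using assms(2) by (rule finite_if_subset_Sigma)
  obtain N where N: "vars_pow W N * q \<in> S"
    using assms(1) unfolding localize_iff by blast
  have k: "frag_cmul (int N) (char_expo W) + m \<in> keys (vars_pow W N * q)"
    using assms(3) by (simp add: keys_lmonom_mult)
  show "0 \<le> lookup m x" if "x \<notin> W" for x
    using cox_ringD(2)[OF N k, of x] that by (simp add: lookup_add lookup_char_expo[OF W])
  show "keys m \<subseteq> Sigma K V"
  proof
    fix x assume x: "x \<in> keys m"
    show "x \<in> Sigma K V"
    proof (cases "x \<in> W")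
      case True
      then show ?thesis
        using assms(2) by blast
    next
      case False
      then have "x \<in> keys (frag_cmul (int N) (char_expo W) + m)"
        using x unfolding in_keys_iff lookup_add lookup_frag_cmul lookup_char_expo[OF W] by simp
      then show ?thesis
        using cox_ringD(1)[OF N k] by blast
    qed
  qed
qed

lemma localize_regular_at:
  assumes "q \<in> localize S W" "W \<subseteq> Sigma K V" "nonvanishing W x"
  shows "regular_at x q"
  using localize_cox_keys(2)[OF assms(1,2)] assms(3) unfolding regular_at_def nonvanishing_def by blast

lemma evaluate_char_expo:
  assumes "W \<subseteq> Sigma K V"
  shows "evaluate (vars_pow W (Suc N)) x \<noteq> 0 \<longleftrightarrow> nonvanishing W x"
proof -
  have W: "finite W"
    using assms by (rule finite_if_subset_Sigma)
  have "keys (frag_cmul (int (Suc N)) (char_expo W)) = W"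
    by (auto simp: keys_char_expo[OF W] simp del: of_nat_Suc)
  then show ?thesis
    using W by (auto simp: lmonom_def evaluate_single nonvanishing_def lookup_char_expo simp del: of_nat_Suc)
qed

lemma evaluate_invariant:
  assumes "q \<in> sections S 0 W" "W \<subseteq> Sigma K V" "P \<in> points K V" "x \<in> P" "x' \<in> P"
  shows "evaluate q x' = evaluate q x"
proof -
  obtain a where a: "\<forall>i\<in>K. a i \<noteq> 0" "x' = scale_point a x"
    using point_proportional[OF assms(3-5)] by blast
  have "evaluate q (scale_point a x) = (\<Prod>i\<in>K. a i powi (0 :: 'i \<Rightarrow> int) i) * evaluate q x"
    using assms(1) a localize_cox_keys(1)[OF _ assms(2), of q] unfolding sections_def
    by (intro evaluate_scale_point) blast+
  then show ?thesis
    by (simp add: a(2))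
qed

lemma point_in_chart:
  assumes "P \<in> points K V" "x \<in> P"
  shows "\<exists>J\<in>charts K V. nonvanishing (cvars J) x"
proof -
  have "\<forall>i\<in>K. \<exists>v\<in>V i. x (i, v) \<noteq> 0"
    using point_coord_vector[OF assms] by (simp add: coord_vectors_def)
  then obtain J where J: "\<forall>i\<in>K. J i \<in> V i \<and> x (i, J i) \<noteq> 0"
    by metis
  then have "restrict J K \<in> charts K V" "nonvanishing (cvars (restrict J K)) x"
    by (auto simp: charts_def nonvanishing_def chart_vars_def)
  then show ?thesis by blast
qed

lemma nonvanishing_point:
  assumes "P \<in> points K V" "x \<in> P" "x' \<in> P" "W \<subseteq> Sigma K V" "nonvanishing W x"
  shows "nonvanishing W x'"
proof -
  obtain a where "\<forall>i\<in>K. a i \<noteq> 0" "x' = scale_point a x"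
    using point_proportional[OF assms(1-3)] by blast
  then show ?thesis
    using assms(4,5) unfolding nonvanishing_def by auto
qed

lemma localize_points_ideal:
  assumes q: "q \<in> localize S W" and W: "W \<subseteq> Sigma K V"
  shows "q \<in> localize (points_ideal K V A) W \<longleftrightarrow>
    (\<forall>P\<in>A. \<forall>x\<in>P. nonvanishing W x \<longrightarrow> evaluate q x = 0)"
proof -
  have regm: "regular_at x (vars_pow W N)" for x N
    using finite_if_subset_Sigma[OF W] by (intro regular_at_lmonom) (simp add: lookup_char_expo)
  show ?thesis
  proof
    assume "q \<in> localize (points_ideal K V A) W"
    then obtain N where N: "vars_pow W N * q \<in> points_ideal K V A"
      unfolding localize_iff by blast
    show "\<forall>P\<in>A. \<forall>x\<in>P. nonvanishing W x \<longrightarrow> evaluate q x = 0"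
    proof (intro ballI impI)
      fix P x assume x: "P \<in> A" "x \<in> P" "nonvanishing W x"
      have "evaluate (vars_pow W N) x \<noteq> 0"
        using x(3) finite_if_subset_Sigma[OF W] keys_cmul[of "int N" "char_expo W"]
        by (intro evaluate_lmonom_nonzero) (auto simp: nonvanishing_def keys_char_expo)
      moreover have "evaluate (vars_pow W N * q) x = 0"
        using N x by (simp add: points_ideal_def)
      ultimately show "evaluate q x = 0"
        using evaluate_mult[OF regm localize_regular_at[OF q W x(3)]] by simp
    qed
  next
    assume *: "\<forall>P\<in>A. \<forall>x\<in>P. nonvanishing W x \<longrightarrow> evaluate q x = 0"
    obtain N where N: "vars_pow W N * q \<in> S"
      using q unfolding localize_iff by blast
    \<comment> \<open>One extra factor kills the points outside the open set, about which the
      assumption on \<open>q\<close> says nothing.\<close>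
    let ?m = "vars_pow W (Suc 0)"
    let ?q = "vars_pow W N * q"
    have "?m * ?q \<in> points_ideal K V A"
      unfolding points_ideal_def
    proof (intro CollectI conjI ballI)
      show "?m * ?q \<in> S"
        using char_expo_cox[OF W, of "Suc 0"] N by (rule cox_ring_mult)
      fix P x assume x: "P \<in> A" "x \<in> P"
      have "evaluate (?m * ?q) x = evaluate ?m x * evaluate ?q x"
        using regm regular_at_cox[OF N] by (rule evaluate_mult)
      also have "\<dots> = 0"
      proof (cases "nonvanishing W x")
        case True
        then show ?thesis
          using * x evaluate_mult[OF regm localize_regular_at[OF q W True]] by simp
      next
        case False
        then show ?thesis
          using evaluate_char_expo[OF W, of 0 x] by simp
      qed
      finally show "evaluate (?m * ?q) x = 0" .
    qed
    moreover have "?m * ?q = vars_pow W (Suc N) * q"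
    proof -
      have "int (Suc N) = int (Suc 0) + int N" by simp
      then show ?thesis
        by (simp only: frag_cmul_distrib lmonom_add mult.assoc)
    qed
    ultimately show "q \<in> localize (points_ideal K V A) W"
      unfolding localize_iff by metis
  qed
qed

text \<open>Components stay in the ideal by rescaling the coordinate vectors of a point, and
  saturation holds because every point lies in some chart.\<close>

lemma closed_subscheme_points_ideal:
  assumes A: "A \<subseteq> points K V"
  shows "closed_subscheme K V (points_ideal K V A)"
  unfolding closed_subscheme_def
proof (intro conjI ballI allI impI)
  show "points_ideal K V A \<subseteq> S" "0 \<in> points_ideal K V A"
    by (auto simp: points_ideal_def)
  show "p + q \<in> points_ideal K V A" if "p \<in> points_ideal K V A" "q \<in> points_ideal K V A" for p q
    using that by (auto simp: points_ideal_def cox_ring_add evaluate_add)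
  show "s * p \<in> points_ideal K V A" if "s \<in> S" "p \<in> points_ideal K V A" for s p
    using that by (auto simp: points_ideal_def cox_ring_mult evaluate_mult regular_at_cox)
  show "component d p \<in> points_ideal K V A" if "p \<in> points_ideal K V A" for p d
    using that A evaluate_component_eq_0[of _ p _ d]
    by (auto simp: points_ideal_def intro!: cox_ring_component)
  fix p assume p: "p \<in> S" "\<forall>J\<in>charts K V. p \<in> localize (points_ideal K V A) (cvars J)"
  show "p \<in> points_ideal K V A"
    unfolding points_ideal_def
  proof (intro CollectI conjI ballI p(1))
    fix P x assume x: "P \<in> A" "x \<in> P"
    then obtain J where J: "J \<in> charts K V" "nonvanishing (cvars J) x"
      using point_in_chart A by blast
    then show "evaluate p x = 0"
      using localize_points_ideal[OF localize_base[OF p(1)] cvars_subset[OF J(1)], of A] p(2) x by blast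
  qed
qed

definition rep :: "('i \<times> 'v \<Rightarrow> complex) set \<Rightarrow> 'i \<times> 'v \<Rightarrow> complex"
  where "rep P = (SOME x. x \<in> P)"

lemma rep_in: "P \<in> points K V \<Longrightarrow> rep P \<in> P"
  unfolding rep_def by (rule someI_ex[of "\<lambda>x. x \<in> P"]) (rule point_nonempty)

text \<open>Evaluation at one representative per point embeds the functions on a chart, modulo the
  ideal, into the finite-dimensional space of functions on \<open>A\<close>; in degree 0 the value
  does not depend on the representative.\<close>

lemma zero_dimensional_points_ideal:
  assumes A: "A \<subseteq> points K V" and fin: "finite A"
  shows "zero_dimensional K V (points_ideal K V A)"
  unfolding zero_dimensional_def
proof (intro conjI ballI)
  let ?I = "points_ideal K V A"
  show cs: "closed_subscheme K V ?I"
    using A by (rule closed_subscheme_points_ideal)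
  fix J assume J: "J \<in> charts K V"
  note W = cvars_subset[OF J]
  let ?f = "\<lambda>q P. if P \<in> A \<and> nonvanishing (cvars J) (rep P) then evaluate q (rep P) else 0"
  have "quot_dim lscale (sections S 0 (cvars J)) (sections ?I 0 (cvars J)) \<le> quot_dim pscale (funs_on A) {0}"
  proof (rule lp.quot_dim_le_inj)
    show "Vector_Spaces.linear lscale pscale ?f"
      by (rule lp.linearI) (auto simp: pscale_def fun_eq_iff evaluate_add evaluate_lscale)
    show "lsc.subspace (sections S 0 (cvars J))" "lsc.subspace (sections ?I 0 (cvars J))"
      by (intro sections_subspace W cs closed_subscheme_cox)+
    show "psc.subspace {0}"
      by (rule psc.subspace_single_0)
    show "?f ` sections S 0 (cvars J) \<subseteq> funs_on A"
      by (auto simp: funs_on_def)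
    fix q assume q: "q \<in> sections S 0 (cvars J)" "?f q \<in> {0}"
    have "evaluate q x = 0" if "P \<in> A" "x \<in> P" "nonvanishing (cvars J) x" for P x
    proof -
      have P: "P \<in> points K V" "rep P \<in> P"
        using that(1) A rep_in by blast+
      have "nonvanishing (cvars J) (rep P)"
        using nonvanishing_point[OF P(1) that(2) P(2) W that(3)] .
      moreover have "?f q P = 0"
        using fun_cong[OF singletonD[OF q(2)], of P] by simp
      ultimately show ?thesis
        using evaluate_invariant[OF q(1) W P that(2)] that(1) by simp
    qed
    then show "q \<in> sections ?I 0 (cvars J)"
      using q(1) localize_points_ideal[OF _ W, of q A] by (simp add: sections_def)
  qed
  also have "\<dots> < \<infinity>"
    by (simp add: quot_dim_funs_on[OF fin])
  finally show "quot_dim lscale (sections S 0 (cvars J)) (sections ?I 0 (cvars J)) < \<infinity>" .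
qed

lemma evaluate_coord: "evaluate (coord y) x = x y"
  by (simp add: coord_def evaluate_single)

text \<open>If in every factor all 2 x 2 minors of the two coordinate vectors vanished, the points
  would coincide. A non-zero minor is the value at one point of a linear form that vanishes at the
  other.\<close>

lemma ex_separating_linear_form:
  assumes P: "P \<in> points K V" "P' \<in> points K V" "P \<noteq> P'"
  shows "\<exists>f i. f \<in> S \<inter> homog (deg_of {i}) \<and> i \<in> K \<and> evaluate f (rep P) \<noteq> 0 \<and> evaluate f (rep P') = 0"
proof -
  let ?x = "rep P" and ?x' = "rep P'"
  have x: "?x \<in> P" "?x' \<in> P'"
    using P rep_in by blast+
  have cv: "?x \<in> coord_vectors K V" "?x' \<in> coord_vectors K V"
    using point_coord_vector P x by blast+
  have "\<exists>i\<in>K. \<exists>v\<in>V i. \<exists>u\<in>V i. ?x' (i, u) * ?x (i, v) \<noteq> ?x' (i, v) * ?x (i, u)"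
  proof (rule ccontr)
    assume "\<not> ?thesis"
    then have eq: "?x' (i, u) * ?x (i, v) = ?x' (i, v) * ?x (i, u)" if "i \<in> K" "u \<in> V i" "v \<in> V i" for i u v
      using that by blast
    have "\<forall>i\<in>K. \<exists>a. a \<noteq> 0 \<and> (\<forall>v. ?x' (i, v) = a * ?x (i, v))"
    proof
      fix i assume i: "i \<in> K"
      obtain u where u: "u \<in> V i" "?x (i, u) \<noteq> 0"
        using cv(1) i by (auto simp: coord_vectors_def)
      obtain w where w: "w \<in> V i" "?x' (i, w) \<noteq> 0"
        using cv(2) i by (auto simp: coord_vectors_def)
      have "?x' (i, v) = ?x' (i, u) / ?x (i, u) * ?x (i, v)" for v
      proof (cases "v \<in> V i")
        case True
        then show ?thesis
          using eq[OF i u(1) True] u(2) by (simp add: field_simps)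
      next
        case False
        then show ?thesis
          using cv by (simp add: coord_vectors_def)
      qed
      moreover from this[of w] have "?x' (i, u) / ?x (i, u) \<noteq> 0"
        using w(2) by auto
      ultimately show "\<exists>a. a \<noteq> 0 \<and> (\<forall>v. ?x' (i, v) = a * ?x (i, v))"
        by blast
    qed
    then obtain a where "\<forall>i\<in>K. a i \<noteq> 0 \<and> (\<forall>v. ?x' (i, v) = a i * ?x (i, v))"
      by metis
    then have "(?x, ?x') \<in> proportional K V"
      using cv by (auto simp: proportional_def)
    then have "P = P'"
      using quotient_eq_iff[OF equiv_proportional, of P P' ?x ?x'] P x unfolding points_def by blast
    with P(3) show False ..
  qed
  then obtain i v u where iuv: "i \<in> K" "v \<in> V i" "u \<in> V i"
    "?x' (i, u) * ?x (i, v) \<noteq> ?x' (i, v) * ?x (i, u)" by blast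
  define f where "f = lscale (?x' (i, u)) (coord (i, v)) - lscale (?x' (i, v)) (coord (i, u))"
  have "coord (i, w) \<in> homog (deg_of {i})" for w
    unfolding coord_eq_lmonom by (rule homog_lmonom) (auto simp: multideg_single deg_of_def)
  then have "f \<in> S \<inter> homog (deg_of {i})"
    unfolding f_def using iuv
    by (intro IntI cox_ring_diff homog_diff cox_ring_lscale homog_lscale cox_ring_coord) auto
  moreover have "evaluate f (rep P) \<noteq> 0" "evaluate f (rep P') = 0"
    using iuv(4) by (simp_all add: f_def evaluate_diff evaluate_lscale evaluate_coord mult.commute)
  ultimately show ?thesis
    using iuv(1) by blast
qed

text \<open>The product of linear forms, one through each point of \<open>A\<close> and none through
  \<open>P\<close>.\<close>

lemma ex_separating_form:
  assumes "finite A" "A \<subseteq> points K V" "P \<in> points K V" "P \<notin> A"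
  shows "\<exists>f d. f \<in> S \<inter> homog d \<and> (\<forall>i. i \<notin> K \<longrightarrow> d i = 0) \<and> evaluate f (rep P) \<noteq> 0 \<and>
    (\<forall>P'\<in>A. evaluate f (rep P') = 0)"
  using assms
proof (induction A)
  case empty
  have "evaluate 1 (rep P) = 1"
    using evaluate_single[of 0 1 "rep P"] by simp
  moreover have "1 \<in> S \<inter> homog 0" "\<forall>i. i \<notin> K \<longrightarrow> (0 :: 'i \<Rightarrow> int) i = 0"
    using homog_one by auto
  ultimately show ?case
    by (metis empty_iff zero_neq_one)
next
  case (insert P' A)
  then obtain f d where f: "f \<in> S \<inter> homog d" "\<forall>i. i \<notin> K \<longrightarrow> d i = 0" "evaluate f (rep P) \<noteq> 0"
    "\<forall>P'\<in>A. evaluate f (rep P') = 0"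
    by auto
  obtain g i where g: "g \<in> S \<inter> homog (deg_of {i})" "i \<in> K" "evaluate g (rep P) \<noteq> 0" "evaluate g (rep P') = 0"
    using ex_separating_linear_form[of P P'] insert.prems by auto
  have ev: "evaluate (f * g) x = evaluate f x * evaluate g x" for x
    using f(1) g(1) by (intro evaluate_mult) (auto intro: regular_at_cox)
  have "f * g \<in> S \<inter> homog (d + deg_of {i})"
    using f(1) g(1) by (auto intro: cox_ring_mult homog_mult)
  moreover have "\<forall>j. j \<notin> K \<longrightarrow> (d + deg_of {i}) j = 0"
    using f(2) g(2) by (auto simp: deg_of_def)
  moreover have "evaluate (f * g) (rep P) \<noteq> 0" "\<forall>P''\<in>insert P' A. evaluate (f * g) (rep P'') = 0"
    using f(3,4) g(3,4) by (simp_all add: ev)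
  ultimately show ?case
    by blast
qed

text \<open>A function on the scheme is determined by its values at the points, and separating forms
  realize every system of values.\<close>

lemma degree_points_ideal:
  assumes A: "A \<subseteq> points K V" and fin: "finite A"
  shows "degree K V (points_ideal K V A) = enat (card A)"
proof -
  let ?I = "points_ideal K V A"
  have cs: "closed_subscheme K V ?I"
    using A by (rule closed_subscheme_points_ideal)
  have pt: "P \<in> points K V" "rep P \<in> P" if "P \<in> A" for P
    using that A rep_in by blast+
  then have "\<forall>P\<in>A. \<exists>J\<in>charts K V. nonvanishing (cvars J) (rep P)"
    using point_in_chart by blast
  then obtain C where C: "\<And>P. P \<in> A \<Longrightarrow> C P \<in> charts K V" "\<And>P. P \<in> A \<Longrightarrow> nonvanishing (cvars (C P)) (rep P)"
    by metis
  \<comment> \<open>Evaluation in a chosen chart \<open>C P\<close> around each point. On overlaps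
    the cochain changes by a section of the ideal, so the values do not depend on the
    choice.\<close>
  let ?f = "\<lambda>s P. if P \<in> A then evaluate (s (C P)) (rep P) else 0"
  have lin: "Vector_Spaces.linear fscale pscale ?f"
    by (rule fp.linearI) (auto simp: pscale_def fscale_def fun_eq_iff evaluate_add evaluate_lscale)
  have funs: "?f s \<in> funs_on A" for s
    by (auto simp: funs_on_def)
  have inj: "s \<in> cech_C0 K V ?I 0 \<longleftrightarrow> ?f s = 0" if s: "s \<in> cech_Z0 ?I 0" for s
  proof
    assume "s \<in> cech_C0 K V ?I 0"
    then have *: "s J \<in> localize ?I (cvars J)" if "J \<in> charts K V" for J
      using that by (simp add: cech_C0_def sections_def)
    show "?f s = 0"
    proof
      fix P
      show "?f s P = 0 P"
      proof (cases "P \<in> A")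
        case True
        have "evaluate (s (C P)) (rep P) = 0"
          using localize_points_ideal[OF localize_cox[OF cs *] cvars_subset, OF C(1) C(1), OF True True]
            *[OF C(1)[OF True]] C(2)[OF True] pt(2)[OF True] True by blast
        then show ?thesis by simp
      qed simp
    qed
  next
    assume z: "?f s = 0"
    show "s \<in> cech_C0 K V ?I 0"
      unfolding cech_C0_def
    proof (intro CollectI conjI ballI allI impI)
      show "s J = 0" if "J \<notin> charts K V" for J
        using s that by (simp add: cech_Z0_iff cech_C0_def)
      fix J assume J: "J \<in> charts K V"
      have sJ: "s J \<in> sections S 0 (cvars J)"
        using s J by (simp add: cech_Z0_iff cech_C0_def)
      have "evaluate (s J) x = 0" if x: "P \<in> A" "x \<in> P" "nonvanishing (cvars J) x" for P x
      proof -
        note W = cvars_Un_subset[OF J C(1)[OF x(1)]]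
        have "nonvanishing (cvars J \<union> cvars (C P)) (rep P)"
          using nonvanishing_point[OF pt(1)[OF x(1)] x(2) pt(2)[OF x(1)] cvars_subset[OF J] x(3)] C(2)[OF x(1)]
          by (auto simp: nonvanishing_def)
        moreover have d: "s (C P) - s J \<in> sections ?I 0 (cvars J \<union> cvars (C P))"
          using s J C(1)[OF x(1)] by (simp add: cech_Z0_iff)
        ultimately have "evaluate (s (C P) - s J) (rep P) = 0"
          using localize_points_ideal[OF localize_cox[OF cs] W, of "s (C P) - s J" A] x(1) pt(2)[OF x(1)]
          by (auto simp: sections_def)
        then have "evaluate (s J) (rep P) = ?f s P"
          using x(1) by (simp add: evaluate_diff)
        then show ?thesis
          using evaluate_invariant[OF sJ cvars_subset[OF J] pt(1)[OF x(1)] pt(2)[OF x(1)] x(2)] fun_cong[OF z, of P] by simp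
      qed
      then show "s J \<in> sections ?I 0 (cvars J)"
        using sJ localize_points_ideal[OF _ cvars_subset[OF J], of "s J" A] by (simp add: sections_def)
    qed
  qed
  have surj: "delta P \<in> ?f ` cech_Z0 ?I 0" if P: "P \<in> A" for P
  proof -
    obtain g d where g: "g \<in> S \<inter> homog d" "\<forall>i. i \<notin> K \<longrightarrow> d i = 0" "evaluate g (rep P) \<noteq> 0"
      "\<forall>P'\<in>A - {P}. evaluate g (rep P') = 0"
      using ex_separating_form[of "A - {P}" P] fin A P by blast
    define r where "r J = lmonom (- xmon J d) * g" for J
    have r: "r J \<in> sections S 0 (cvars J)" if J: "J \<in> charts K V" for J
    proof -
      have "lmonom (- xmon J d) \<in> sections S (- d) (cvars J)"
        using xmon_localize[OF order_refl cvars_subset[OF J], of "- d"] multideg_xmon[of d J] g(2)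
        by (auto simp: sections_def xmon_uminus multideg_uminus intro!: homog_lmonom)
      then show ?thesis
        unfolding r_def using g(1) homog_part_sections
          sections_mult[OF closed_subscheme_cox cvars_subset[OF J], of _ "- d" g d] by fastforce
    qed
    have ev_r: "evaluate (r J) (rep P') = evaluate (lmonom (- xmon J d)) (rep P') * evaluate g (rep P')"
      "evaluate (lmonom (- xmon J d)) (rep P') \<noteq> 0"
      if "J \<in> charts K V" "nonvanishing (cvars J) (rep P')" for J P'
    proof -
      have *: "regular_at (rep P') (lmonom (- xmon J d))"
        using localize_regular_at[OF _ cvars_subset[OF that(1)] that(2)]
          xmon_localize[OF order_refl cvars_subset[OF that(1)], of "- d"] by (simp add: xmon_uminus)
      show "evaluate (r J) (rep P') = evaluate (lmonom (- xmon J d)) (rep P') * evaluate g (rep P')"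
        unfolding r_def using * g(1) by (intro evaluate_mult) (auto intro: regular_at_cox)
      show "evaluate (lmonom (- xmon J d)) (rep P') \<noteq> 0"
        using that(2) keys_xmon[of J "- d"]
        by (intro evaluate_lmonom_nonzero) (auto simp: nonvanishing_def xmon_uminus)
    qed
    \<comment> \<open>The separating form divided by the trivializing monomial and normalized to the
      value 1 at \<open>P\<close>. On charts that do not contain \<open>P\<close> the zero function
      already has the right values.\<close>
    define s where "s J = (if J \<in> charts K V \<and> nonvanishing (cvars J) (rep P)
      then lscale (inverse (evaluate (r J) (rep P))) (r J) else 0)" for J
    have sR: "s J \<in> sections S 0 (cvars J)" if "J \<in> charts K V" for J
      using r[OF that] sections_subspace[OF closed_subscheme_cox cvars_subset[OF that], of 0]
      by (auto simp: s_def lsc.subspace_def)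
    have ev: "evaluate (s J) (rep P') = delta P P'"
      if J: "J \<in> charts K V" "nonvanishing (cvars J) (rep P')" "P' \<in> A" for J P'
    proof (cases "P' = P")
      case True
      then show ?thesis
        using J ev_r[OF J(1,2)] g(3) by (simp add: s_def evaluate_lscale delta_def del: inverse_mult_distrib)
    next
      case False
      then have "evaluate (r J) (rep P') = 0"
        using ev_r(1)[OF J(1,2)] g(4) J(3) by simp
      then show ?thesis
        using False by (simp add: s_def evaluate_lscale delta_def)
    qed
    have "s \<in> cech_Z0 ?I 0"
      unfolding cech_Z0_iff
    proof (intro conjI ballI)
      show "s \<in> cech_C0 K V S 0"
        using sR by (auto simp: cech_C0_def s_def)
      fix J J' assume J: "J \<in> charts K V" "J' \<in> charts K V"
      note W = cvars_Un_subset[OF J]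
      have dR: "s J' - s J \<in> sections S 0 (cvars J \<union> cvars J')"
        using sR[OF J(1)] sR[OF J(2)] sections_Un[OF closed_subscheme_cox J]
        by (intro sections_diff[OF closed_subscheme_cox W]) blast+
      have "evaluate (s J' - s J) x = 0" if x: "P' \<in> A" "x \<in> P'" "nonvanishing (cvars J \<union> cvars J') x" for P' x
      proof -
        have "nonvanishing (cvars J \<union> cvars J') (rep P')"
          using nonvanishing_point[OF pt(1)[OF x(1)] x(2) pt(2)[OF x(1)] W x(3)] .
        then have "nonvanishing (cvars J) (rep P')" "nonvanishing (cvars J') (rep P')"
          by (auto simp: nonvanishing_def)
        then have "evaluate (s J' - s J) (rep P') = 0"
          using ev[OF J(1) _ x(1)] ev[OF J(2) _ x(1)] by (simp add: evaluate_diff)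
        then show ?thesis
          using evaluate_invariant[OF dR W pt(1)[OF x(1)] pt(2)[OF x(1)] x(2)] by simp
      qed
      then show "s J' - s J \<in> sections ?I 0 (cvars J \<union> cvars J')"
        using dR localize_points_ideal[OF _ W, of "s J' - s J" A] by (simp add: sections_def)
    qed
    moreover have "?f s = delta P"
    proof
      fix P'
      show "?f s P' = delta P P'"
        using ev[OF C(1) C(2)] P by (auto simp: delta_def)
    qed
    ultimately show ?thesis
      by (intro rev_image_eqI[of s]) (assumption, rule sym)
  qed
  have sub: "psc.subspace (?f ` cech_Z0 ?I 0)"
    using fp.linear_subspace_image[OF lin cech_Z0_subspace[OF cs]] .
  have "degree K V ?I \<le> quot_dim pscale (funs_on A) {0}"
    unfolding degree_eq
    by (rule fp.quot_dim_le_inj[OF lin])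
      (use cech_Z0_subspace[OF cs] cech_C0_subspace[OF cs] psc.subspace_single_0 funs inj in auto)
  moreover have "quot_dim pscale (funs_on A) {0} \<le> degree K V ?I"
    unfolding degree_eq
  proof (rule fp.quot_dim_le_surj[OF lin cech_C0_subspace[OF cs]])
    show "?f ` cech_Z0 ?I 0 \<subseteq> funs_on A"
      using funs by blast
    show "?f ` cech_C0 K V ?I 0 \<subseteq> {0}"
      using inj cech_C0_subset_Z0[OF cs, of 0] by blast
    fix w assume "w \<in> funs_on A"
    then have "w = (\<Sum>P\<in>A. pscale (w P) (delta P))"
      using fin by (rule funs_on_expand[rotated])
    also have "\<dots> \<in> ?f ` cech_Z0 ?I 0"
      using surj by (intro psc.subspace_sum[OF sub] psc.subspace_scale[OF sub])
    finally show "\<exists>s\<in>cech_Z0 ?I 0. w - ?f s \<in> {0}"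
      by auto
  qed
  ultimately show ?thesis
    using quot_dim_funs_on[OF fin] by simp
qed

end

section \<open>Flattenings\<close>

context projective_product
begin

lemma nonzerodivisor_mult:
  assumes "nonzerodivisor I L" "nonzerodivisor I M" "M \<in> S"
  shows "nonzerodivisor I (L * M)"
  using assms cox_ring_mult[OF assms(3)] unfolding nonzerodivisor_def by (simp add: mult.assoc)

lemma nonzerodivisor_power:
  assumes "nonzerodivisor I L" "L \<in> S"
  shows "nonzerodivisor I (L ^ n)"
proof (induction n)
  case 0
  then show ?case
    by (simp add: nonzerodivisor_def)
next
  case (Suc n)
  then show ?case
    using nonzerodivisor_mult[OF assms(1) Suc cox_ring_power[OF assms(2)]] by simp
qed

lemma nonzerodivisor_factor:
  assumes "closed_subscheme K V I" "nonzerodivisor I (L * M)" "M \<in> S"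
  shows "nonzerodivisor I L"
  unfolding nonzerodivisor_def
proof (intro ballI impI)
  fix p assume p: "p \<in> S" "L * p \<in> I"
  then have "M * (L * p) \<in> I"
    using closed_subschemeD(4)[OF assms(1) assms(3)] by blast
  then have "L * M * p \<in> I"
    by (simp add: mult_ac)
  then show "p \<in> I"
    using assms(2) p(1) unfolding nonzerodivisor_def by blast
qed

text \<open>Every term of the binomial expansion contains s^a or u^b. Adding up generators of the
  irrelevant ideal in this way, a power of their combination multiplies an element of the saturation
  into the ideal.\<close>

lemma radical_add:
  assumes H: "0 \<in> H" "\<And>p q. p \<in> H \<Longrightarrow> q \<in> H \<Longrightarrow> p + q \<in> H" "\<And>s p. s \<in> S \<Longrightarrow> p \<in> H \<Longrightarrow> s * p \<in> H"
    and su: "s \<in> S" "u \<in> S" and p: "s ^ a * p \<in> H" "u ^ b * p \<in> H"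
  shows "(s + u) ^ (a + b) * p \<in> H"
proof -
  have Hsum: "sum f A \<in> H" if "\<And>x. x \<in> A \<Longrightarrow> f x \<in> H" for f :: "nat \<Rightarrow> _" and A
    using that by (induction A rule: infinite_finite_induct) (auto simp: H)
  have "of_nat (a + b choose k) * s ^ k * u ^ (a + b - k) * p \<in> H" for k
  proof -
    have c: "of_nat (a + b choose k) \<in> S"
      by (metis cox_ring_single_0 single_of_nat)
    show ?thesis
    proof (cases "a \<le> k")
      case True
      then have "s ^ k = s ^ (k - a) * s ^ a"
        by (simp flip: power_add)
      then have "of_nat (a + b choose k) * s ^ k * u ^ (a + b - k) * p
        = (of_nat (a + b choose k) * s ^ (k - a) * u ^ (a + b - k)) * (s ^ a * p)"
        by (simp only: mult_ac)
      then show ?thesis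
        using c su p(1) H(3) by (simp add: cox_ring_mult cox_ring_power)
    next
      case False
      then have "a + b - k = (a - k) + b" by simp
      then have "of_nat (a + b choose k) * s ^ k * u ^ (a + b - k) * p
        = (of_nat (a + b choose k) * s ^ k * u ^ (a - k)) * (u ^ b * p)"
        by (simp only: power_add mult_ac)
      then show ?thesis
        using c su p(2) H(3) by (simp add: cox_ring_mult cox_ring_power)
    qed
  qed
  then show ?thesis
    by (simp add: binomial_ring sum_distrib_right Hsum)
qed

end

text \<open>Coordinates are labelled by natural numbers so that a label can serve as a digit in the
  exponent of \<open>t\<close>.\<close>

locale segre_nat = segre K V for K :: "'i set" and V :: "'i \<Rightarrow> nat set"
begin

lemma ex_chart_weights: "\<exists>w :: 'i \<Rightarrow> nat. inj_on (\<lambda>J. \<Sum>i\<in>K. w i * J i) (charts K V)"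
proof -
  define N where "N = Suc (\<Sum>i\<in>K. \<Sum>v\<in>V i. v)"
  have less: "v < N" if "i \<in> K" "v \<in> V i" for i v
  proof -
    have "v \<le> (\<Sum>v\<in>V i. v)"
      using finite_V[OF that(1)] that(2) by (intro member_le_sum) auto
    also have "\<dots> \<le> (\<Sum>i\<in>K. \<Sum>v\<in>V i. v)"
      using finite_K that(1) by (intro member_le_sum[of i K "\<lambda>i. \<Sum>v\<in>V i. v"]) auto
    finally show ?thesis
      by (simp add: N_def)
  qed
  from ex_digit_weights[OF finite_K, of N] obtain w :: "'i \<Rightarrow> nat" where w': "\<forall>d d'.
    (\<forall>i\<in>K. d i < N \<and> d' i < N) \<longrightarrow>
    (\<Sum>i\<in>K. w i * d i) = (\<Sum>i\<in>K. w i * d' i) \<longrightarrow> (\<forall>i\<in>K. d i = d' i)"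
    by (elim exE)
  note w = w'[THEN spec, THEN spec, THEN mp, THEN mp]
  have "inj_on (\<lambda>J. \<Sum>i\<in>K. w i * J i) (charts K V)"
  proof (rule inj_onI)
    fix J J' assume J: "J \<in> charts K V" "J' \<in> charts K V" "(\<Sum>i\<in>K. w i * J i) = (\<Sum>i\<in>K. w i * J' i)"
    have "\<forall>i\<in>K. J i = J' i"
      using J less by (intro w) (auto simp: charts_def)
    then show "J = J'"
      using J(1,2) unfolding charts_def by (intro PiE_ext) auto
  qed
  then show ?thesis
    by (rule exI[where x = w])
qed

definition weight :: "'i \<Rightarrow> nat"
  where "weight = (SOME w. inj_on (\<lambda>J. \<Sum>i\<in>K. w i * J i) (charts K V))"

definition chart_code :: "('i \<Rightarrow> nat) \<Rightarrow> nat"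
  where "chart_code J = (\<Sum>i\<in>K. weight i * J i)"

lemma inj_on_chart_code: "inj_on chart_code (charts K V)"
proof -
  have "chart_code = (\<lambda>J. \<Sum>i\<in>K. weight i * J i)"
    by (simp add: chart_code_def fun_eq_iff)
  then show ?thesis
    using someI_ex[OF ex_chart_weights] by (simp add: weight_def)
qed

text \<open>Being a product over the factors, this splits along every partition of them; yet for
  \<open>u = K\<close> its expansion carries a different power of \<open>t\<close> at each chart
  monomial, which is what genericity requires.\<close>

definition curve_form :: "'i set \<Rightarrow> complex \<Rightarrow> ('i, nat) laurent"
  where "curve_form u t = (\<Prod>i\<in>u. \<Sum>v\<in>V i. lscale (t ^ (weight i * v)) (coord (i, v)))"

lemma coord_homog: "coord (i, v) \<in> homog (deg_of {i})"
  unfolding coord_eq_lmonom by (rule homog_lmonom) (auto simp: multideg_single deg_of_def)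

lemma deg_of_insert: "i \<notin> u \<Longrightarrow> deg_of (insert i u) = deg_of {i} + deg_of u"
  by (auto simp: deg_of_def fun_eq_iff)

lemma curve_form_cox:
  assumes "u \<subseteq> K"
  shows "curve_form u t \<in> S \<inter> homog (deg_of u)"
proof -
  have "finite u"
    using assms finite_K finite_subset by blast
  then show ?thesis
    using assms
  proof (induction u)
    case empty
    have "deg_of {} = (0 :: 'i \<Rightarrow> int)"
      by (auto simp: deg_of_def)
    show ?case
      unfolding curve_form_def prod.empty \<open>deg_of {} = 0\<close>
      by (intro IntI cox_ring_one homog_one)
  next
    case (insert i u)
    let ?l = "\<Sum>v\<in>V i. lscale (t ^ (weight i * v)) (coord (i, v))"
    have "?l \<in> S" "?l \<in> homog (deg_of {i})"
      using insert.prems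
      by (auto intro!: cox_ring_sum homog_sum cox_ring_lscale homog_lscale cox_ring_coord coord_homog)
    moreover have "curve_form (insert i u) t = ?l * curve_form u t"
      using insert.hyps by (simp add: curve_form_def)
    moreover have "curve_form u t \<in> S \<inter> homog (deg_of u)"
      using insert by auto
    ultimately show ?case
      unfolding deg_of_insert[OF insert.hyps(2)]
      by (elim IntE, intro IntI) (simp_all only: cox_ring_mult homog_mult)
  qed
qed

lemma lscale_prod: "(\<Prod>i\<in>A. lscale (a i) (f i)) = lscale (\<Prod>i\<in>A. a i) (\<Prod>i\<in>A. f i)"
  by (induction A rule: infinite_finite_induct) (auto simp: lscale_mult_left lscale_mult_right)

text \<open>Expanding the product picks one coordinate in each factor, that is, a chart, and the
  exponents of \<open>t\<close> add up to its code.\<close>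

lemma curve_form_eq_chart_form: "curve_form K t = chart_form (\<lambda>J. t ^ chart_code J)"
proof -
  have "curve_form K t = (\<Sum>J\<in>charts K V. \<Prod>i\<in>K. lscale (t ^ (weight i * J i)) (coord (i, J i)))"
    unfolding curve_form_def charts_def by (rule prod_sum_PiE) (auto simp: finite_K finite_V)
  also have "\<dots> = chart_form (\<lambda>J. t ^ chart_code J)"
    unfolding chart_form_def
  proof (rule sum.cong)
    fix J assume "J \<in> charts K V"
    have "(\<Prod>i\<in>K. coord (i, J i)) = lmonom (xmon J unit_deg)"
      unfolding xmon_def lmonom_sum by (rule prod.cong) (auto simp: coord_eq_lmonom deg_of_def)
    then show "(\<Prod>i\<in>K. lscale (t ^ (weight i * J i)) (coord (i, J i)))
      = lscale (t ^ chart_code J) (lmonom (xmon J unit_deg))"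
      by (simp add: lscale_prod chart_code_def power_sum)
  qed simp
  finally show ?thesis .
qed

lemma curve_form_Un:
  assumes "E \<union> F = K" "E \<inter> F = {}"
  shows "curve_form E t * curve_form F t = curve_form K t"
proof -
  have "finite E" "finite F"
    using assms(1) finite_K by auto
  then have "curve_form (E \<union> F) t = curve_form E t * curve_form F t"
    unfolding curve_form_def using assms(2) by (rule prod.union_disjoint)
  then show ?thesis
    by (simp add: assms(1))
qed

abbreviation "tcharts \<equiv> charts {()} (tensor_vars K V)"

text \<open>A linear form chosen generically for a scheme in the target thus becomes on the product
  a form that splits into a part of degree E and a part of degree F.\<close>

lemma pullback_target_chart_form:
  "\<phi> (target.chart_form (\<lambda>T. t ^ chart_code (T ()))) = curve_form K t"
proof -
  have "\<phi> (target.chart_form (\<lambda>T. t ^ chart_code (T ())))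
    = (\<Sum>T\<in>tcharts. lscale (t ^ chart_code (T ())) (lmonom (xmon (T ()) unit_deg)))"
    unfolding target.chart_form_def segre_pullback_sum
  proof (rule sum.cong)
    fix T :: "unit \<Rightarrow> 'i \<Rightarrow> nat" assume "T \<in> tcharts"
    have "target.xmon T (deg_of {()}) = single ((), T ()) 1"
      by (simp add: target.xmon_def deg_of_def)
    then have "\<phi> (lmonom (target.xmon T (deg_of {()}))) = lmonom (xmon (T ()) unit_deg)"
      by (simp only: segre_pullback_lmonom segre_expo_single_1)
    then show "\<phi> (lscale (t ^ chart_code (T ())) (lmonom (target.xmon T (deg_of {()}))))
      = lscale (t ^ chart_code (T ())) (lmonom (xmon (T ()) unit_deg))"
      by (simp only: segre_pullback_lscale)
  qed simp
  also have "\<dots> = (\<Sum>J\<in>charts K V. lscale (t ^ chart_code J) (lmonom (xmon J unit_deg)))"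
    by (rule sum.reindex_bij_witness[of _ "\<lambda>J _. J" "\<lambda>T. T ()"]) (auto simp: target_charts)
  finally show ?thesis
    by (simp add: curve_form_eq_chart_form chart_form_def)
qed

lemma inj_on_target_code: "inj_on (\<lambda>T. chart_code (T ())) tcharts"
proof (rule inj_onI)
  fix T T' assume "T \<in> tcharts" "T' \<in> tcharts" "chart_code (T ()) = chart_code (T' ())"
  then have "T () = T' ()"
    using inj_on_chart_code by (auto simp: target_charts inj_on_def)
  then show "T = T'"
    by (intro ext) (metis unit.exhaust)
qed


subsection \<open>Multilinear forms as linear forms on the target\<close>

lemma lookup_xmon: "lookup (xmon J d) (i, v) = (if i \<in> K \<and> v = J i then d i else 0)"
proof -
  have "lookup (xmon J d) (i, v) = (\<Sum>j\<in>K. if j = i then (if v = J i then d i else 0) else 0)"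
    unfolding xmon_def lookup_sum by (rule sum.cong) (auto simp: lookup_single when_def)
  then show ?thesis
    using finite_K by (simp add: sum.delta)
qed

lemma inj_on_xmon: "inj_on (\<lambda>J. xmon J unit_deg) (charts K V)"
proof (rule inj_onI)
  fix J J' assume J: "J \<in> charts K V" "J' \<in> charts K V" "xmon J unit_deg = xmon J' unit_deg"
  have "J i = J' i" if "i \<in> K" for i
    using arg_cong[OF J(3), of "\<lambda>m. lookup m (i, J i)"] that
    by (simp add: lookup_xmon deg_of_def split: if_splits)
  then show "J = J'"
    using J(1,2) unfolding charts_def by (intro PiE_ext) auto
qed

text \<open>Non-negative integers with sum 1: in each factor exactly one exponent is 1 and the
  others are 0.\<close>

lemma multilinear_expo:
  assumes m: "keys m \<subseteq> Sigma K V" "\<And>x. 0 \<le> lookup m x" "multideg m = unit_deg"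
  shows "\<exists>J\<in>charts K V. m = xmon J unit_deg"
proof -
  have sum1: "(\<Sum>v\<in>V i. lookup m (i, v)) = 1" if i: "i \<in> K" for i
  proof -
    have "(\<Sum>v\<in>V i. lookup m (i, v)) = (\<Sum>x\<in>Pair i ` V i. lookup m x)"
      by (simp add: sum.reindex inj_on_def)
    also have "\<dots> = (\<Sum>x\<in>{x\<in>keys m. fst x = i}. lookup m x)"
      using m(1) finite_V[OF i] by (intro sum.mono_neutral_right) (auto simp: in_keys_iff)
    also have "\<dots> = multideg m i"
      by (simp add: multideg_def sum.If_cases Int_def)
    finally show ?thesis
      using i by (simp add: m(3) deg_of_def)
  qed
  have "\<exists>v\<in>V i. \<forall>v'. lookup m (i, v') = (if v' = v then 1 else 0)" if i: "i \<in> K" for i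
  proof -
    let ?f = "\<lambda>v. lookup m (i, v)"
    have "\<exists>v\<in>V i. ?f v \<noteq> 0"
    proof (rule ccontr)
      assume "\<not> ?thesis"
      then have "(\<Sum>v\<in>V i. ?f v) = 0"
        by (intro sum.neutral) blast
      then show False
        using sum1[OF i] by simp
    qed
    then obtain v where v: "v \<in> V i" "?f v \<noteq> 0"
      by blast
    have *: "?f v + (\<Sum>v\<in>V i - {v}. ?f v) = 1"
      using sum.remove[OF finite_V[OF i] v(1), of ?f] sum1[OF i] by simp
    have "0 \<le> (\<Sum>v\<in>V i - {v}. ?f v)" "0 \<le> ?f v"
      using m(2) by (auto intro: sum_nonneg)
    then have f: "?f v = 1" "(\<Sum>v\<in>V i - {v}. ?f v) = 0"
      using * v(2) by linarith+
    have "?f v' = 0" if "v' \<noteq> v" for v'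
    proof (cases "v' \<in> V i")
      case True
      then show ?thesis
        using f(2) that m(2) finite_V[OF i] by (subst (asm) sum_nonneg_eq_0_iff) auto
    next
      case False
      then show ?thesis
        using m(1) by (auto simp: in_keys_iff)
    qed
    then show ?thesis
      using f(1) v(1) by (intro bexI[of _ v]) auto
  qed
  then obtain J where J: "\<forall>i\<in>K. J i \<in> V i \<and> (\<forall>v'. lookup m (i, v') = (if v' = J i then 1 else 0))"
    by metis
  have "m = xmon (restrict J K) unit_deg"
  proof (rule poly_mapping_eqI)
    fix x :: "'i \<times> nat"
    obtain i v where x: "x = (i, v)" by fastforce
    show "lookup m x = lookup (xmon (restrict J K) unit_deg) x"
    proof (cases "i \<in> K")
      case True
      then show ?thesis
        using J by (simp add: x lookup_xmon deg_of_def)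
    next
      case False
      then show ?thesis
        using m(1) by (auto simp: x lookup_xmon in_keys_iff)
    qed
  qed
  moreover have "restrict J K \<in> charts K V"
    using J by (auto simp: charts_def)
  ultimately show ?thesis by blast
qed

text \<open>The inverse of the pullback on forms of multidegree (1,...,1). Such a form is a linear
  form on tensors, and \<open>evaluate (lift p) \<tau>\<close> is the pairing of the tensor
  \<open>\<tau>\<close> with \<open>p\<close>.\<close>

definition lift :: "('i, nat) laurent \<Rightarrow> (unit, 'i \<Rightarrow> nat) laurent"
  where "lift p = (\<Sum>J\<in>charts K V. lscale (lookup p (xmon J unit_deg)) (coord ((), J)))"

lemma lift_add: "lift (p + q) = lift p + lift q"
  by (simp add: lift_def lookup_add lsc.scale_left_distrib sum.distrib)

lemma lift_lscale: "lift (lscale a p) = lscale a (lift p)"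
  by (simp add: lift_def lookup_lscale lsc.scale_sum_right)

lemma lift_cox: "lift p \<in> target.S \<inter> homog (\<lambda>_. 1)"
proof -
  have "coord ((), J) \<in> homog (\<lambda>_. 1)" for J :: "'i \<Rightarrow> nat"
    unfolding coord_eq_lmonom by (rule homog_lmonom) (simp add: multideg_single fun_eq_iff)
  then show ?thesis
    unfolding lift_def
    by (intro IntI cox_ring_sum homog_sum cox_ring_lscale homog_lscale cox_ring_coord)
      (auto simp: tensor_vars_def)
qed

lemma pullback_lift:
  assumes p: "p \<in> S \<inter> homog unit_deg"
  shows "\<phi> (lift p) = p"
proof (rule poly_mapping_eqI)
  fix m
  have "\<phi> (lift p) = (\<Sum>J\<in>charts K V. lscale (lookup p (xmon J unit_deg)) (lmonom (xmon J unit_deg)))"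
    by (simp only: lift_def segre_pullback_sum segre_pullback_lscale coord_eq_lmonom
        segre_pullback_lmonom segre_expo_single_1)
  then have "lookup (\<phi> (lift p)) m
    = (\<Sum>J\<in>charts K V. if xmon J unit_deg = m then lookup p m else 0)"
    by (auto simp: lookup_sum lookup_lscale lmonom_def lookup_single when_def intro!: sum.cong)
  also have "\<dots> = lookup p m"
  proof (cases "m \<in> keys p")
    case True
    then obtain J where J: "J \<in> charts K V" "m = xmon J unit_deg"
      using multilinear_expo[of m] p cox_ringD[of p K V m] by (auto simp: homog_def)
    have "(\<Sum>J'\<in>charts K V. if xmon J' unit_deg = m then lookup p m else 0)
      = (\<Sum>J'\<in>charts K V. if J' = J then lookup p m else 0)"
      using J inj_on_xmon by (intro sum.cong) (auto simp: inj_on_def)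
    then show ?thesis
      using J(1) finite_charts by (simp add: sum.delta)
  next
    case False
    then show ?thesis
      by (auto simp: in_keys_iff intro: sum.neutral)
  qed
  finally show "lookup (\<phi> (lift p)) m = lookup p m" .
qed


subsection \<open>The flattening of a tensor\<close>

context
  fixes E F :: "'i set"
  assumes EF: "E \<union> F = K" "E \<inter> F = {}"
begin

lemma EF_subset: "E \<subseteq> K" "F \<subseteq> K"
  using EF(1) by blast+

lemma deg_of_EF: "deg_of E + deg_of F = (unit_deg :: 'i \<Rightarrow> int)"
  using EF by (auto simp: deg_of_def fun_eq_iff)

lemma mult_EF:
  assumes "f \<in> S \<inter> homog (deg_of E)" "g \<in> S \<inter> homog (deg_of F)"
  shows "f * g \<in> S \<inter> homog unit_deg"
  using assms cox_ring_mult[of f K V g] homog_mult[of f "deg_of E" g "deg_of F"] by (simp add: deg_of_EF)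

text \<open>The left kernel of the flattening matrix: the forms of degree E modulo it have the
  flattening rank as dimension. \<open>T\<close> is a point, i.e. a class of proportional tensors,
  and ranging over all of them avoids choosing one.\<close>

definition flat_kernel :: "(unit \<times> ('i \<Rightarrow> nat) \<Rightarrow> complex) set \<Rightarrow> ('i, nat) laurent set"
  where "flat_kernel T = {f \<in> S \<inter> homog (deg_of E).
    \<forall>g\<in>S \<inter> homog (deg_of F). \<forall>\<tau>\<in>T. evaluate (lift (f * g)) \<tau> = 0}"

lemma flat_kernel_subspace: "lsc.subspace (flat_kernel T)"
  unfolding lsc.subspace_def
proof (intro conjI ballI allI)
  have lift_0: "lift 0 = 0"
    by (simp add: lift_def)
  show "0 \<in> flat_kernel T"
    by (simp add: flat_kernel_def lift_0)
  show "p + q \<in> flat_kernel T" if "p \<in> flat_kernel T" "q \<in> flat_kernel T" for p q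
    using that by (auto simp: flat_kernel_def cox_ring_add homog_add distrib_right lift_add evaluate_add)
  show "lscale a p \<in> flat_kernel T" if "p \<in> flat_kernel T" for a p
    using that by (auto simp: flat_kernel_def cox_ring_lscale homog_lscale lscale_mult_left lift_lscale evaluate_lscale)
qed

text \<open>Multiply f by the generic form \<open>curve_form F t\<close>, lift and restrict to
  \<open>G\<close>. Whatever this map kills lies in the kernel of the flattening, so the flattening
  rank is at most the dimension of the linear forms modulo those vanishing on \<open>G\<close>,
  which \<open>hilbert_le_degree\<close> bounds by the degree.\<close>

lemma flattening_rank_le_degree:
  assumes G: "zero_dimensional {()} (tensor_vars K V) G" "segre_image K V {0} \<subseteq> G"
    and T: "T \<in> linear_span (tensor_vars K V) G"
  shows "quot_dim lscale (S \<inter> homog (deg_of E)) (flat_kernel T) \<le> degree {()} (tensor_vars K V) G"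
proof -
  have cs: "closed_subscheme {()} (tensor_vars K V) G"
    using G(1) by (simp add: zero_dimensional_def)
  note D = closed_subschemeD[OF cs]
  obtain t where t: "target.nonzerodivisor G (target.chart_form (\<lambda>T. t ^ chart_code (T ())))"
    using target.ex_generic_chart_form[OF G(1) inj_on_target_code] by blast
  let ?L = "target.chart_form (\<lambda>T. t ^ chart_code (T ()))"
  let ?E = "curve_form E t" and ?F = "curve_form F t"
  have E: "?E \<in> S \<inter> homog (deg_of E)" and F: "?F \<in> S \<inter> homog (deg_of F)"
    using EF_subset by (auto intro: subsetD[OF _ curve_form_cox] simp: curve_form_cox[THEN IntD1] curve_form_cox[THEN IntD2])
  have L: "?L \<in> target.S \<inter> homog (deg_of {()})" "\<phi> ?L = ?E * ?F"
    using target.chart_form_cox pullback_target_chart_form curve_form_Un[OF EF] by simp_all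
  have deg1: "deg_of {()} = (\<lambda>_. 1 :: int)"
    by (auto simp: deg_of_def)
  let ?M = "{f \<in> S \<inter> homog (deg_of E). lift (f * ?F) \<in> G}"
  have subspaceM: "lsc.subspace ?M"
    unfolding lsc.subspace_def
  proof (intro conjI ballI allI)
    show "0 \<in> ?M"
      using D(2) by (simp add: lift_def)
    show "p + q \<in> ?M" if "p \<in> ?M" "q \<in> ?M" for p q
      using that D(3) by (simp add: cox_ring_add homog_add distrib_right lift_add)
    show "lscale a p \<in> ?M" if "p \<in> ?M" for a p
      using that D(4)[OF cox_ring_single_0, of "lift (p * ?F)" a]
      by (simp add: cox_ring_lscale homog_lscale lscale_mult_left lift_lscale) (simp add: lscale_def)
  qed
  have "?M \<subseteq> flat_kernel T"
  proof
    fix f assume f: "f \<in> ?M"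
    then have fE: "f \<in> S \<inter> homog (deg_of E)" by blast
    show "f \<in> flat_kernel T"
      unfolding flat_kernel_def
    proof (intro CollectI conjI ballI)
      show "f \<in> S \<inter> homog (deg_of E)" by (rule fE)
      fix g \<tau> assume g: "g \<in> S \<inter> homog (deg_of F)" and \<tau>: "\<tau> \<in> T"
      txt \<open>A \<open>2 \<times> 2\<close> minor vanishing on the Segre variety: \<open>(?E ?F) (f g) = (?E g) (f ?F)\<close>.\<close>
      let ?a = "lift (f * ?F)" and ?b = "lift (?E * g)" and ?c = "lift (f * g)"
      have cox: "?a \<in> target.S" "?b \<in> target.S" "?c \<in> target.S" "?L \<in> target.S"
        using lift_cox L(1) by blast+
      have "\<phi> (?L * ?c) = \<phi> (?b * ?a)"
        using mult_EF[OF fE F] mult_EF[OF E g] mult_EF[OF fE g]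
        by (simp add: segre_pullback_mult pullback_lift L(2) mult_ac)
      then have "\<phi> (?L * ?c - ?b * ?a) = 0"
        by (simp add: segre_pullback_diff)
      then have "?L * ?c - ?b * ?a \<in> segre_image K V {0}"
        using cox by (simp add: segre_image_def cox_ring_diff cox_ring_mult)
      then have "?L * ?c - ?b * ?a \<in> G"
        using G(2) by blast
      moreover have "?b * ?a \<in> G"
        using f D(4)[OF cox(2)] by blast
      ultimately have "(?L * ?c - ?b * ?a) + ?b * ?a \<in> G"
        by (rule D(3))
      then have "?L * ?c \<in> G"
        by simp
      then have "?c \<in> G"
        using t cox(3) unfolding target.nonzerodivisor_def by blast
      then show "evaluate ?c \<tau> = 0"
        using T \<tau> lift_cox[of "f * g"] unfolding linear_span_def by blast
    qed
  qed
  then have "quot_dim lscale (S \<inter> homog (deg_of E)) (flat_kernel T) \<le> quot_dim lscale (S \<inter> homog (deg_of E)) ?M"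
    by (rule lsc.quot_dim_antimono[OF subspaceM flat_kernel_subspace])
  also have "\<dots> \<le> quot_dim lscale (target.S \<inter> homog (deg_of {()})) (G \<inter> homog (deg_of {()}))"
  proof (rule ll.quot_dim_le_inj)
    show "Vector_Spaces.linear lscale lscale (\<lambda>f. lift (f * ?F))"
      by (rule ll.linearI) (simp_all add: distrib_right lift_add lscale_mult_left lift_lscale)
    show "lsc.subspace (S \<inter> homog (deg_of E))" "lsc.subspace (G \<inter> homog (deg_of {()}))"
      by (intro homog_part_subspace target.homog_part_subspace closed_subscheme_cox cs)+
    show "lsc.subspace ?M"
      by (rule subspaceM)
    show "(\<lambda>f. lift (f * ?F)) ` (S \<inter> homog (deg_of E)) \<subseteq> target.S \<inter> homog (deg_of {()})"
      using lift_cox unfolding deg1 by blast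
  qed blast
  also have "\<dots> \<le> degree {()} (tensor_vars K V) G"
    using L(1) t by (intro target.hilbert_le_degree[OF G(1)]) (auto simp: deg_of_def)
  finally show ?thesis .
qed

text \<open>A form f of the kernel outside \<open>I\<close> would cut out a proper subscheme whose
  span still contains \<open>T\<close>: each linear form vanishing on it pulls back, modulo
  \<open>I\<close>, to f * g with g of degree F, and \<open>T\<close> annihilates such products by
  the definition of the kernel.\<close>

lemma flat_kernel_subset_ideal:
  assumes I: "zero_dimensional K V I" "degree K V I = enat n"
    and h1: "h1 K V I (deg_of E) = 0" "h1 K V I (deg_of F) = 0"
    and T: "minimally_spanned K V I T"
  shows "flat_kernel T \<subseteq> I"
proof (rule subsetI, rule ccontr)
  fix f assume f: "f \<in> flat_kernel T" and fI: "f \<notin> I"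
  have cs: "closed_subscheme K V I"
    using I(1) by (simp add: zero_dimensional_def)
  note D = closed_subschemeD[OF cs]
  have fS: "f \<in> S" and fE: "f \<in> homog (deg_of E)"
    using f by (auto simp: flat_kernel_def)
  define H where "H = {i + f * s | i s. i \<in> I \<and> s \<in> S}"
  have HI: "i + f * s \<in> H" if "i \<in> I" "s \<in> S" for i s
    using that by (auto simp: H_def)
  have H0: "0 \<in> H"
    using HI[OF D(2) cox_ring_0] by simp
  have IH: "i \<in> H" if "i \<in> I" for i
    using HI[OF that cox_ring_0] by simp
  have fH: "f \<in> H"
    using HI[OF D(2) cox_ring_one] by simp
  have Hadd: "p + q \<in> H" if pq: "p \<in> H" "q \<in> H" for p q
  proof -
    obtain i s j u where "p = i + f * s" "q = j + f * u" "i \<in> I" "j \<in> I" "s \<in> S" "u \<in> S"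
      using pq unfolding H_def by blast
    then show ?thesis
      using HI[OF D(3), of i j "s + u"] by (simp add: cox_ring_add algebra_simps)
  qed
  have Hmult: "r * p \<in> H" if rp: "r \<in> S" "p \<in> H" for r p
  proof -
    obtain i s where "p = i + f * s" "i \<in> I" "s \<in> S"
      using rp(2) unfolding H_def by blast
    then show ?thesis
      using HI[OF D(4)[OF rp(1)], of i "r * s"] rp(1) by (simp add: cox_ring_mult algebra_simps)
  qed
  have comp_f: "component d (f * s) = f * component (d - deg_of E) s" for d s
    using component_mult_homog[OF fE, of "d - deg_of E" s] by simp
  have Hcomp: "component d p \<in> H" if p: "p \<in> H" for d p
  proof -
    obtain i s where "p = i + f * s" "i \<in> I" "s \<in> S"
      using p unfolding H_def by blast
    then show ?thesis
      using HI[OF D(5) cox_ring_component, of i s d "d - deg_of E"] by (simp add: component_add comp_f)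
  qed
  have ge: "\<exists>N::nat. \<forall>N'\<ge>N. vars_pow (cvars J) N' * q \<in> H"
    if "J \<in> charts K V" "q \<in> localize H (cvars J)" for J q
    by (rule localize_ideal_all_ge[OF _ cvars_subset[OF that(1)] that(2)]) (rule Hmult)
  txt \<open>\<open>I'\<close> is the saturation of \<open>I + (f)\<close>; it contradicts the minimality of \<open>I\<close> because \<open>T\<close>
    lies in the span of the subscheme it defines.\<close>
  define I' where "I' = {p \<in> S. \<forall>J\<in>charts K V. p \<in> localize H (cvars J)}"
  have "closed_subscheme K V I'"
    unfolding closed_subscheme_def
  proof (intro conjI ballI allI impI)
    show "I' \<subseteq> S"
      by (auto simp: I'_def)
    show "0 \<in> I'"
      using localize_base[OF H0] by (simp add: I'_def)
    show "p + q \<in> I'" if pq: "p \<in> I'" "q \<in> I'" for p q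
      unfolding I'_def
    proof (intro CollectI conjI ballI)
      show "p + q \<in> S"
        using pq by (simp add: I'_def cox_ring_add)
      fix J assume J: "J \<in> charts K V"
      obtain M N where "\<forall>N'\<ge>M. vars_pow (cvars J) N' * p \<in> H"
        "\<forall>N'\<ge>N. vars_pow (cvars J) N' * q \<in> H"
        using ge[OF J, of p] ge[OF J, of q] pq J unfolding I'_def by blast
      then have "vars_pow (cvars J) (max M N) * (p + q) \<in> H"
        using Hadd by (simp add: distrib_left)
      then show "p + q \<in> localize H (cvars J)"
        unfolding localize_iff by blast
    qed
    show "s * p \<in> I'" if "s \<in> S" "p \<in> I'" for s p
    proof -
      have "s * p \<in> localize H (cvars J)" if J: "J \<in> charts K V" for J
      proof -
        obtain N where "vars_pow (cvars J) N * p \<in> H"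
          using \<open>p \<in> I'\<close> J unfolding I'_def localize_iff by blast
        then have "s * (vars_pow (cvars J) N * p) \<in> H"
          by (rule Hmult[OF \<open>s \<in> S\<close>])
        then show ?thesis
          unfolding localize_iff by (intro exI[of _ N]) (simp only: mult.left_commute)
      qed
      then show ?thesis
        using that by (simp add: I'_def cox_ring_mult)
    qed
    show "component d p \<in> I'" if p: "p \<in> I'" for p d
    proof -
      have "component d p \<in> localize H (cvars J)" if J: "J \<in> charts K V" for J
      proof -
        obtain N where N: "vars_pow (cvars J) N * p \<in> H"
          using p J unfolding I'_def localize_iff by blast
        let ?m = "frag_cmul (int N) (char_expo (cvars J))"
        have "component (d + multideg ?m) (lmonom ?m * p) = lmonom ?m * component d p"
          by (rule component_mult_homog[OF homog_lmonom[OF refl]])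
        then show ?thesis
          unfolding localize_iff using Hcomp[OF N] by metis
      qed
      then show ?thesis
        using p by (simp add: I'_def cox_ring_component)
    qed
    fix p assume p: "p \<in> S" "\<forall>J\<in>charts K V. p \<in> localize I' (cvars J)"
    have "p \<in> localize H (cvars J)" if J: "J \<in> charts K V" for J
    proof -
      obtain N where "vars_pow (cvars J) N * p \<in> I'"
        using p J unfolding localize_iff by blast
      then obtain N' where "vars_pow (cvars J) N'
          * (vars_pow (cvars J) N * p) \<in> H"
        using J unfolding I'_def localize_iff by blast
      then have "vars_pow (cvars J) (N' + N) * p \<in> H"
        by (simp only: of_nat_add frag_cmul_distrib lmonom_add mult.assoc)
      then show ?thesis
        unfolding localize_iff by blast
    qed
    then show "p \<in> I'"
      using p(1) by (simp add: I'_def)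
  qed
  moreover have "I \<subset> I'"
  proof
    show "I \<subseteq> I'"
      using D(1) localize_base[OF IH] unfolding I'_def by blast
    show "I \<noteq> I'"
      using fI fS localize_base[OF fH] unfolding I'_def by blast
  qed
  ultimately have "T \<notin> segre_span K V I'"
    using T unfolding minimally_spanned_def by blast
  obtain t where t: "nonzerodivisor I (chart_form (\<lambda>J. t ^ chart_code J))"
    using ex_generic_chart_form[OF I(1) inj_on_chart_code] by blast
  \<comment> \<open>As \<open>?L\<close> is the product of \<open>?E\<close> and \<open>?F\<close>,
    a single \<open>t\<close> makes both \<open>?L\<close> and \<open>?F\<close>
    non-zero-divisors.\<close>
  let ?E = "curve_form E t" and ?F = "curve_form F t" and ?L = "curve_form K t"
  have ES: "?E \<in> S" and F: "?F \<in> S \<inter> homog (deg_of F)" and L: "?L \<in> S \<inter> homog unit_deg"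
    using curve_form_cox[OF EF_subset(1)] curve_form_cox[OF EF_subset(2)] curve_form_cox[OF order_refl] by blast+
  have LS: "?L \<in> S"
    using L by blast
  have nzL: "nonzerodivisor I ?L"
    using t by (simp add: curve_form_eq_chart_form)
  have nzF: "nonzerodivisor I ?F"
    using nonzerodivisor_factor[OF cs _ ES, of ?F] nzL curve_form_Un[OF EF, of t] by (simp add: mult.commute)
  have power_homog: "?L ^ M \<in> homog (\<lambda>i. int M * unit_deg i)" for M
  proof (induction M)
    case 0
    have "(\<lambda>i. int 0 * unit_deg i) = (0 :: 'i \<Rightarrow> int)"
      by (simp add: fun_eq_iff)
    then show ?case
      using homog_one by (metis power_0)
  next
    case (Suc M)
    have "(\<lambda>i. int (Suc M) * unit_deg i) = unit_deg + (\<lambda>i. int M * unit_deg i)"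
      by (simp add: fun_eq_iff algebra_simps)
    then show ?case
      using homog_mult[OF IntD2[OF L] Suc] by (metis power_Suc)
  qed
  have "T \<in> segre_span K V I'"
    unfolding segre_span_def linear_span_def
  proof (intro CollectI conjI ballI)
    have TI: "T \<in> linear_span (tensor_vars K V) (segre_image K V I)"
      using T by (simp add: minimally_spanned_def segre_span_def)
    then show "T \<in> points {()} (tensor_vars K V)"
      by (simp add: linear_span_def)
    fix l \<tau> assume l: "l \<in> segre_image K V I' \<inter> homog (\<lambda>_. 1)" and \<tau>: "\<tau> \<in> T"
    define p where "p = \<phi> l"
    have "diag_deg K 1 = (unit_deg :: 'i \<Rightarrow> int)"
      by (auto simp: diag_deg_def deg_of_def)
    then have p: "p \<in> I'" "p \<in> S" "p \<in> homog unit_deg" and lS: "l \<in> target.S"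
      using l segre_pullback_homog[OF finite_K, of l "\<lambda>_. 1"] unfolding p_def segre_image_def I'_def by auto
    have pow: "\<exists>M. lscale a (lmonom (xmon J unit_deg)) ^ M * p \<in> H" if J: "J \<in> charts K V" for a J
    proof -
      obtain N where N: "vars_pow (cvars J) N * p \<in> H"
        using p(1) J unfolding I'_def localize_iff by blast
      have "single 0 (a ^ N) * (vars_pow (cvars J) N * p) \<in> H"
        by (rule Hmult[OF cox_ring_single_0 N])
      moreover have "lscale a q ^ N = lscale (a ^ N) (q ^ N)" for q :: "('i, nat) laurent"
        by (induction N) (auto simp: lscale_mult_left lscale_mult_right)
      ultimately have "lscale a (lmonom (xmon J unit_deg)) ^ N * p \<in> H"
        by (simp add: lmonom_power char_expo_cvars lscale_mult_left) (simp add: lscale_def)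
      then show ?thesis ..
    qed
    \<comment> \<open>The generators are added one at a time by \<open>radical_add\<close>, since
      for each single one a power multiplies \<open>p\<close> into \<open>H\<close>.\<close>
    have "\<exists>M. (\<Sum>J\<in>C. lscale (t ^ chart_code J) (lmonom (xmon J unit_deg))) ^ M * p \<in> H"
      if "finite C" "C \<subseteq> charts K V" for C
      using that
    proof (induction C)
      case empty
      then show ?case
        using H0 by (intro exI[of _ 1]) simp
    next
      case (insert J C)
      let ?x = "\<lambda>J. lscale (t ^ chart_code J) (lmonom (xmon J unit_deg))"
      obtain a b where ab: "?x J ^ a * p \<in> H" "(\<Sum>J\<in>C. ?x J) ^ b * p \<in> H"
        using insert pow[of J "t ^ chart_code J"] by blast
      have "?x J \<in> S" "(\<Sum>J\<in>C. ?x J) \<in> S"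
        using insert.prems by (auto intro!: cox_ring_sum cox_ring_lscale xmon_unit_cox)
      from radical_add[OF H0 Hadd Hmult this ab] show ?case
        using insert.hyps by auto
    qed
    txt \<open>As \<open>?L\<close> is a combination of the generators of the irrelevant ideal, a power of it moves \<open>p\<close>
      from the saturation into \<open>I + (f)\<close>.\<close>
    from this[OF finite_charts order_refl] obtain M where "?L ^ M * p \<in> H"
      unfolding curve_form_eq_chart_form chart_form_def by blast
    then obtain i s where dec: "?L ^ M * p = i + f * s" "i \<in> I" "s \<in> S"
      unfolding H_def by blast
    \<comment> \<open>\<open>p\<close> has multidegree (1,...,1), the sum of the degrees of E and F;
      f takes the share of E, so this is what remains for the cofactor of f in
      \<open>?L ^ M * p\<close>.\<close>
    define d where "d = (\<lambda>i. int M * unit_deg i) + deg_of F"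
    define s' where "s' = component d s"
    have s': "s' \<in> S \<inter> homog d"
      using dec(3) by (simp add: s'_def cox_ring_component component_homog)
    have "?L ^ M * p \<in> homog (d + deg_of E)"
    proof -
      have "d + deg_of E = (\<lambda>i. int M * unit_deg i) + unit_deg"
        unfolding d_def by (simp only: add.assoc add.commute[of "deg_of F"] deg_of_EF)
      then show ?thesis
        using homog_mult[OF power_homog[of M] p(3)] by simp
    qed
    then have "?L ^ M * p = component (d + deg_of E) (i + f * s)"
      by (metis dec(1) component_homog_same)
    also have "\<dots> = component (d + deg_of E) i + f * s'"
      by (simp only: component_add component_mult_homog[OF fE] s'_def)
    finally have Lp: "?L ^ M * p = component (d + deg_of E) i + f * s'" .
    have d: "0 \<le> deg_of F i" "i \<notin> K \<Longrightarrow> d i = 0" for i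
      using EF_subset(2) by (auto simp: d_def deg_of_def)
    \<comment> \<open>Multiplication by \<open>?L ^ M\<close> is injective modulo \<open>I\<close>.
      Its source has dimension at least \<open>n\<close>, by h^1 = 0 in degree F, and its target at
      most \<open>n\<close>; hence it is onto, and \<open>s'\<close> comes down to degree F.\<close>
    have "\<exists>g\<in>S \<inter> homog (deg_of F). s' - ?L ^ M * g \<in> I \<inter> homog d"
    proof (rule ll.surj_mod_if_inj_mod[where f = "\<lambda>g. ?L ^ M * g" and n = n])
      show "Vector_Spaces.linear lscale lscale (\<lambda>g. ?L ^ M * g)"
        by (rule ll.linearI) (simp_all add: distrib_left lscale_mult_right)
      show "lsc.subspace (S \<inter> homog (deg_of F))" "lsc.subspace (I \<inter> homog (deg_of F))"
        "lsc.subspace (I \<inter> homog d)"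
        by (intro homog_part_subspace closed_subscheme_cox cs)+
      have LM: "?L ^ M * g \<in> S \<inter> homog d" if "g \<in> S \<inter> homog (deg_of F)" for g
        unfolding d_def
        using that cox_ring_mult[OF cox_ring_power[OF LS]] homog_mult[OF power_homog] by blast
      then show "(\<lambda>g. ?L ^ M * g) ` (S \<inter> homog (deg_of F)) \<subseteq> S \<inter> homog d"
        by blast
      show "g \<in> I \<inter> homog (deg_of F)"
        if "g \<in> S \<inter> homog (deg_of F)" "?L ^ M * g \<in> I \<inter> homog d" for g
        using that nonzerodivisor_power[OF nzL LS, of M] unfolding nonzerodivisor_def by blast
      show "enat n \<le> quot_dim lscale (S \<inter> homog (deg_of F)) (I \<inter> homog (deg_of F))"
        using degree_le_hilbert[OF cs h1(2) d(1) F nzF] by (simp add: I(2))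
      have "?F \<in> S"
        using F by blast
      then show "quot_dim lscale (S \<inter> homog d) (I \<inter> homog d) \<le> enat n"
        using hilbert_le_degree[OF I(1) d(2) LM[OF F]
            nonzerodivisor_mult[OF nonzerodivisor_power[OF nzL LS] nzF]] by (simp add: I(2))
    qed (rule s')
    then obtain g where g: "g \<in> S \<inter> homog (deg_of F)" "s' - ?L ^ M * g \<in> I"
      by blast
    have "?L ^ M * (p - f * g) = component (d + deg_of E) i + f * (s' - ?L ^ M * g)"
      using Lp by (simp add: algebra_simps)
    also have "\<dots> \<in> I"
      using D(3)[OF D(5)[OF dec(2)] D(4)[OF fS g(2)]] .
    finally have pfg: "p - f * g \<in> I"
      using nonzerodivisor_power[OF nzL LS, of M] p(2) fS g(1) unfolding nonzerodivisor_def
      by (auto simp: cox_ring_diff cox_ring_mult)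
    have "f * g \<in> S \<inter> homog unit_deg"
      using mult_EF[OF _ g(1)] fS fE by blast
    then have "l - lift (f * g) \<in> segre_image K V I \<inter> homog (\<lambda>_. 1)"
      using pfg lS lift_cox[of "f * g"] l
      by (auto simp: segre_image_def segre_pullback_diff pullback_lift cox_ring_diff p_def intro: homog_diff)
    then have "evaluate (l - lift (f * g)) \<tau> = 0"
      using TI \<tau> unfolding linear_span_def by blast
    moreover have "evaluate (lift (f * g)) \<tau> = 0"
      using f g(1) \<tau> by (simp add: flat_kernel_def)
    ultimately show "evaluate l \<tau> = 0"
      by (simp add: evaluate_diff)
  qed
  with \<open>T \<notin> segre_span K V I'\<close> show False ..
qed

text \<open>Three dimensions of the forms of degree E: modulo \<open>I\<close> it is at least
  \<open>n\<close> because h^1 = 0, modulo the kernel it is no smaller because the kernel lies in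
  \<open>I\<close>, and the flattening bound puts it below the degree of \<open>G\<close>.\<close>

theorem degree_le_if_minimally_spanned:
  assumes I: "zero_dimensional K V I" "degree K V I = enat n"
    and h1: "h1 K V I (deg_of E) = 0" "h1 K V I (deg_of F) = 0"
    and T: "minimally_spanned K V I T"
    and G: "zero_dimensional {()} (tensor_vars K V) G" "segre_image K V {0} \<subseteq> G"
      "T \<in> linear_span (tensor_vars K V) G"
  shows "enat n \<le> degree {()} (tensor_vars K V) G"
proof -
  have cs: "closed_subscheme K V I"
    using I(1) by (simp add: zero_dimensional_def)
  obtain t where t: "nonzerodivisor I (chart_form (\<lambda>J. t ^ chart_code J))"
    using ex_generic_chart_form[OF I(1) inj_on_chart_code] by blast
  have F: "curve_form F t \<in> S"
    using curve_form_cox[OF EF_subset(2)] by blast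
  have nzE: "nonzerodivisor I (curve_form E t)"
    using nonzerodivisor_factor[OF cs _ F] t curve_form_Un[OF EF, of t] by (simp add: curve_form_eq_chart_form)
  have "enat n \<le> quot_dim lscale (S \<inter> homog (deg_of E)) (I \<inter> homog (deg_of E))"
    using degree_le_hilbert[OF cs h1(1) _ curve_form_cox[OF EF_subset(1)] nzE]
    by (simp add: I(2) deg_of_def)
  also have "\<dots> \<le> quot_dim lscale (S \<inter> homog (deg_of E)) (flat_kernel T)"
    using flat_kernel_subset_ideal[OF I h1 T]
    by (intro lsc.quot_dim_antimono flat_kernel_subspace homog_part_subspace cs)
      (auto simp: flat_kernel_def)
  also have "\<dots> \<le> degree {()} (tensor_vars K V) G"
    by (rule flattening_rank_le_degree[OF G])
  finally show ?thesis .
qed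

text \<open>The Segre image of the scheme attains the bound: its degree is at most \<open>n\<close>
  by pullback of functions and at least \<open>n\<close> by the bound applied to the image
  itself.\<close>

theorem cactus_rank_eq:
  assumes I: "zero_dimensional K V I" "degree K V I = enat n"
    and h1: "h1 K V I (deg_of E) = 0" "h1 K V I (deg_of F) = 0"
    and T: "minimally_spanned K V I T"
  shows "cactus_rank K V T = n"
  unfolding cactus_rank_def
proof (rule Least_equality)
  let ?G = "segre_image K V I"
  have cs: "closed_subscheme K V I"
    using I(1) by (simp add: zero_dimensional_def)
  have G: "zero_dimensional {()} (tensor_vars K V) ?G" "segre_image K V {0} \<subseteq> ?G"
    "T \<in> linear_span (tensor_vars K V) ?G"
    using zero_dimensional_segre_image[OF I(1)] closed_subschemeD(2)[OF cs] T
    by (auto simp: segre_image_def minimally_spanned_def segre_span_def)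
  moreover have "degree {()} (tensor_vars K V) ?G = enat n"
    using degree_le_if_minimally_spanned[OF I h1 T G] degree_segre_image_le[OF cs]
    by (simp add: I(2))
  ultimately show "\<exists>G. zero_dimensional {()} (tensor_vars K V) G \<and> segre_image K V {0} \<subseteq> G \<and>
    degree {()} (tensor_vars K V) G = enat n \<and> T \<in> linear_span (tensor_vars K V) G"
    by blast
next
  fix r assume "\<exists>G. zero_dimensional {()} (tensor_vars K V) G \<and> segre_image K V {0} \<subseteq> G \<and>
    degree {()} (tensor_vars K V) G = enat r \<and> T \<in> linear_span (tensor_vars K V) G"
  then show "n \<le> r"
    using degree_le_if_minimally_spanned[OF I h1 T] by (metis enat_ord_simps(1))
qed

text \<open>A finite set competing for the rank has a Segre image of degree at most its cardinality,
  and the lower bound for schemes in the target applies to that image.\<close>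

theorem rank_eq:
  assumes A: "finite A" "A \<subseteq> points K V"
    and h1: "h1 K V (points_ideal K V A) (deg_of E) = 0" "h1 K V (points_ideal K V A) (deg_of F) = 0"
    and T: "minimally_spanned K V (points_ideal K V A) T"
  shows "tensor_rank K V T = card A"
  unfolding tensor_rank_def
proof (rule Least_equality)
  show "\<exists>S. finite S \<and> S \<subseteq> points K V \<and> card S = card A \<and> T \<in> segre_span K V (points_ideal K V S)"
    using A T by (auto simp: minimally_spanned_def)
next
  fix r assume "\<exists>S. finite S \<and> S \<subseteq> points K V \<and> card S = r \<and> T \<in> segre_span K V (points_ideal K V S)"
  then obtain B where B: "finite B" "B \<subseteq> points K V" "card B = r" "T \<in> segre_span K V (points_ideal K V B)"
    by blast
  let ?G = "segre_image K V (points_ideal K V B)"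
  have cs: "closed_subscheme K V (points_ideal K V B)"
    using B(2) by (rule closed_subscheme_points_ideal)
  have "enat (card A) \<le> degree {()} (tensor_vars K V) ?G"
  proof (rule degree_le_if_minimally_spanned[OF _ _ h1 T])
    show "zero_dimensional K V (points_ideal K V A)" "degree K V (points_ideal K V A) = enat (card A)"
      using zero_dimensional_points_ideal degree_points_ideal A by blast+
    show "zero_dimensional {()} (tensor_vars K V) ?G"
      using zero_dimensional_segre_image[OF zero_dimensional_points_ideal[OF B(2,1)]] .
    show "segre_image K V {0} \<subseteq> ?G" "T \<in> linear_span (tensor_vars K V) ?G"
      using B(4) closed_subschemeD(2)[OF cs] by (auto simp: segre_image_def segre_span_def)
  qed
  also have "\<dots> \<le> enat r"
    using degree_segre_image_le[OF cs] degree_points_ideal[OF B(2,1)] B(3) by simp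
  finally show "card A \<le> r"
    by simp
qed

end

end

section \<open>The result in coordinates 0, ..., n_i\<close>

theorem corollary3p3:
  fixes k h c :: nat and n :: "nat \<Rightarrow> nat" and E F :: "nat set"
    and V :: "nat \<Rightarrow> nat set"
  assumes V_def: "\<And>i. V i = {0..n i}"
    and partition: "E \<union> F = {1..k}" "E \<inter> F = {}"
    and h: "card F = h" "0 < h" "h < k"
    and c: "0 < c" "c < (\<Prod>i \<in> F. n i + 1)"
  shows "(\<forall>A T.
            zero_dimensional {1..k} V A \<and> degree {1..k} V A = enat (c + 1) \<and>
            h1 {1..k} V A (deg_of E) = 0 \<and> h1 {1..k} V A (deg_of F) = 0 \<and>
            T \<in> segre_target {1..k} V \<and> minimally_spanned {1..k} V A T \<longrightarrow>
            cactus_rank {1..k} V T = c + 1)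
       \<and> (\<forall>A T.
            finite A \<and> A \<subseteq> points {1..k} V \<and> card A = c + 1 \<and>
            h1 {1..k} V (points_ideal {1..k} V A) (deg_of E) = 0 \<and>
            h1 {1..k} V (points_ideal {1..k} V A) (deg_of F) = 0 \<and>
            T \<in> segre_target {1..k} V \<and>
            minimally_spanned {1..k} V (points_ideal {1..k} V A) T \<longrightarrow>
            cactus_rank {1..k} V T = c + 1 \<and> tensor_rank {1..k} V T = c + 1)"
proof -
  \<comment> \<open>\<open>0 < h\<close> and \<open>h < k\<close> make the index set non-empty,
    which keeps different degrees apart under the Segre pullback.\<close>
  interpret segre_nat "{1..k}" V
    using h(2,3) by unfold_locales (simp_all add: V_def)
  show ?thesis
  proof (intro conjI allI impI; elim conjE)
    fix A :: "(nat, nat) laurent set" and T :: "(unit \<times> (nat \<Rightarrow> nat) \<Rightarrow> complex) set"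
    assume "zero_dimensional {1..k} V A" "degree {1..k} V A = enat (c + 1)"
      "h1 {1..k} V A (deg_of E) = 0" "h1 {1..k} V A (deg_of F) = 0" "minimally_spanned {1..k} V A T"
    then show "cactus_rank {1..k} V T = c + 1"
      by (rule cactus_rank_eq[OF partition])
  next
    fix A :: "(nat \<times> nat \<Rightarrow> complex) set set" and T :: "(unit \<times> (nat \<Rightarrow> nat) \<Rightarrow> complex) set"
    assume A: "finite A" "A \<subseteq> points {1..k} V" "card A = c + 1"
      and h1: "h1 {1..k} V (points_ideal {1..k} V A) (deg_of E) = 0"
        "h1 {1..k} V (points_ideal {1..k} V A) (deg_of F) = 0"
      and T: "minimally_spanned {1..k} V (points_ideal {1..k} V A) T"
    show "cactus_rank {1..k} V T = c + 1"
      using cactus_rank_eq[OF partition zero_dimensional_points_ideal[OF A(2,1)] _ h1 T]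
        degree_points_ideal[OF A(2,1)] A(3) by simp
    show "tensor_rank {1..k} V T = c + 1"
      using rank_eq[OF partition A(1,2) h1 T] A(3) by simp
  qed
qed

end
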